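(* The following problem is NP-complete, even when the input is restricted to strongly connected oriented graphs: given an oriented graph $D$, decide whether $\operatorname{inv}(D)\leq 1$.
   Context: An oriented graph is a digraph with no loops, no multiple arcs and no directed cycle of length 2. Inverting a vertex set $X$ means reversing every arc with both ends in $X$; $\operatorname{inv}(D)$ is the minimum number of successive inversions needed to make $D$ acyclic. Thus $\operatorname{inv}(D)\le 1$ iff $D$ is acyclic or there is a set $X\subseteq V(D)$ whose inversion makes $D$ acyclic. *)

theory Defs
  imports
    "Graph_Theory.Graph_Theory"
    "HOL-Computational_Algebra.Polynomial"
begin

section \<open>Deterministic multi-tape Turing machines\<close>

datatype head_move = Move_Left | Move_None | Move_Right

text \<open>
  States are the numbers below \<open>tm_states\<close> and tape symbols the numbers below \<open>tm_symbols\<close>, where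
  \<open>0\<close> is the blank and \<open>1\<close>, \<open>2\<close> stand for the two bits. The transition function maps the current state
  and the list of scanned symbols (one per tape) to the new state and, for each tape, the symbol to
  write and the head movement.
\<close>

record turing_machine =
  tm_tapes :: nat
  tm_states :: nat
  tm_symbols :: nat
  tm_start :: nat
  tm_halt :: nat
  tm_delta :: "nat \<Rightarrow> nat list \<Rightarrow> nat \<times> (nat \<times> head_move) list"

definition wf_turing_machine :: "turing_machine \<Rightarrow> bool" where
  "wf_turing_machine M \<longleftrightarrow>
     1 \<le> tm_tapes M \<and> 3 \<le> tm_symbols M \<and> tm_start M < tm_states M \<and> tm_halt M < tm_states M \<and>
     (\<forall>q ss. q < tm_states M \<and> q \<noteq> tm_halt M \<and>
         length ss = tm_tapes M \<and> (\<forall>s \<in> set ss. s < tm_symbols M) \<longrightarrow>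
       fst (tm_delta M q ss) < tm_states M \<and>
       length (snd (tm_delta M q ss)) = tm_tapes M \<and>
       (\<forall>a \<in> set (snd (tm_delta M q ss)). fst a < tm_symbols M))"

text \<open>A tape is infinite in both directions; it is paired with the position of its head.\<close>

type_synonym tape = "(int \<Rightarrow> nat) \<times> int"

type_synonym tm_config = "nat \<times> tape list"

definition tape_read :: "tape \<Rightarrow> nat" where
  "tape_read t = fst t (snd t)"

fun head_shift :: "head_move \<Rightarrow> int" where
  "head_shift Move_Left = -1"
| "head_shift Move_None = 0"
| "head_shift Move_Right = 1"

definition tape_act :: "nat \<times> head_move \<Rightarrow> tape \<Rightarrow> tape" where
  "tape_act a t = ((fst t)(snd t := fst a), snd t + head_shift (snd a))"

definition tm_step :: "turing_machine \<Rightarrow> tm_config \<Rightarrow> tm_config" where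
  "tm_step M c =
     (if fst c = tm_halt M then c
      else let r = tm_delta M (fst c) (map tape_read (snd c))
           in (fst r, map2 tape_act (snd r) (snd c)))"

definition bit_symbol :: "bool \<Rightarrow> nat" where
  "bit_symbol b = (if b then 2 else 1)"

definition input_tape :: "bool list \<Rightarrow> tape" where
  "input_tape x =
     (\<lambda>i. if 0 \<le> i \<and> i < int (length x) then bit_symbol (x ! nat i) else 0, 0)"

definition blank_tape :: tape where
  "blank_tape = (\<lambda>_. 0, 0)"

definition tm_init :: "turing_machine \<Rightarrow> bool list \<Rightarrow> tm_config" where
  "tm_init M x = (tm_start M, input_tape x # replicate (tm_tapes M - 1) blank_tape)"

definition tape_holds :: "tape \<Rightarrow> bool list \<Rightarrow> bool" where
  "tape_holds t y \<longleftrightarrow>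
     (\<forall>i < length y. fst t (int i) = bit_symbol (y ! i)) \<and> fst t (int (length y)) = 0"

text \<open>
  The input is given on the first tape and the output is read off the last one. The halting state is
  absorbing, so being in it after \<open>T (length x)\<close> steps means halting within that many steps.
\<close>

definition tm_computes_in_time ::
    "turing_machine \<Rightarrow> (bool list \<Rightarrow> bool list) \<Rightarrow> (nat \<Rightarrow> nat) \<Rightarrow> bool" where
  "tm_computes_in_time M f T \<longleftrightarrow>
     (\<forall>x. let c = (tm_step M ^^ T (length x)) (tm_init M x)
          in fst c = tm_halt M \<and> tape_holds (last (snd c)) (f x))"

definition polytime_computable :: "(bool list \<Rightarrow> bool list) \<Rightarrow> bool" where
  "polytime_computable f \<longleftrightarrow>
     (\<exists>M (p :: nat poly). wf_turing_machine M \<and> tm_computes_in_time M f (poly p))"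


section \<open>NP-completeness of languages over the binary alphabet\<close>

definition complexity_P :: "bool list set set" where
  "complexity_P = {L. polytime_computable (\<lambda>x. [x \<in> L])}"

text \<open>Every bit of the first component is doubled; the block \<open>01\<close> ends it.\<close>

definition pair_strings :: "bool list \<Rightarrow> bool list \<Rightarrow> bool list" where
  "pair_strings x y = concat (map (\<lambda>b. [b, b]) x) @ [False, True] @ y"

definition complexity_NP :: "bool list set set" where
  "complexity_NP =
     {L. \<exists>V \<in> complexity_P. \<exists>p :: nat poly. \<forall>x.
           x \<in> L \<longleftrightarrow> (\<exists>y. length y \<le> poly p (length x) \<and> pair_strings x y \<in> V)}"

definition polytime_reducible :: "bool list set \<Rightarrow> bool list set \<Rightarrow> bool" where
  "polytime_reducible A B \<longleftrightarrow>
     (\<exists>f. polytime_computable f \<and> (\<forall>x. x \<in> A \<longleftrightarrow> f x \<in> B))"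

definition NP_hard :: "bool list set \<Rightarrow> bool" where
  "NP_hard L \<longleftrightarrow> (\<forall>A \<in> complexity_NP. polytime_reducible A L)"

definition NP_complete :: "bool list set \<Rightarrow> bool" where
  "NP_complete L \<longleftrightarrow> L \<in> complexity_NP \<and> NP_hard L"


section \<open>Oriented graphs and inversions\<close>

text \<open>\<^locale>\<open>pair_digraph\<close> already excludes loops and multiple arcs and requires finiteness.\<close>

definition oriented_graph :: "'a pair_pre_digraph \<Rightarrow> bool" where
  "oriented_graph D \<longleftrightarrow>
     pair_digraph D \<and> (\<forall>u v. (u, v) \<in> parcs D \<longrightarrow> (v, u) \<notin> parcs D)"

definition invert :: "'a set \<Rightarrow> 'a pair_pre_digraph \<Rightarrow> 'a pair_pre_digraph" where
  "invert X D = D\<lparr>parcs := (parcs D - X \<times> X) \<union> (parcs D \<inter> X \<times> X)\<inverse>\<rparr>"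

text \<open>
  Every oriented graph can be made acyclic by inverting two-element sets, so the minimum below
  ranges over a nonempty set.
\<close>

definition inversion_number :: "'a pair_pre_digraph \<Rightarrow> nat" where
  "inversion_number D =
     (LEAST k. \<exists>Xs. length Xs = k \<and> (\<forall>X \<in> set Xs. X \<subseteq> pverts D) \<and>
                 acyclic (parcs (fold invert Xs D)))"


section \<open>The decision problem\<close>

text \<open>
  A digraph with vertex set \<open>{0, \<dots>, n - 1}\<close> is encoded by \<open>n\<close> in unary followed by its adjacency
  matrix, row by row.
\<close>

definition encode_digraph :: "nat pair_pre_digraph \<Rightarrow> bool list" where
  "encode_digraph D =
     (let n = card (pverts D)
      in replicate n True @ [False] @
         concat (map (\<lambda>u. map (\<lambda>v. (u, v) \<in> parcs D) [0..<n]) [0..<n]))"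

text \<open>
  The language of the problem ``given an oriented graph satisfying \<open>C\<close>, decide whether its inversion
  number is at most 1''.
\<close>

definition inv_le_1_problem :: "(nat pair_pre_digraph \<Rightarrow> bool) \<Rightarrow> bool list set" where
  "inv_le_1_problem C =
     {encode_digraph D | D. pverts D = {..<card (pverts D)} \<and> oriented_graph D \<and> C D \<and>
                            inversion_number D \<le> 1}"

end

theory Submission
  imports Defs
begin

text \<open>
  Hardness. A directed triangle becomes acyclic iff exactly two of its vertices are inverted. Triangles
  can thus force vertices to be inverted and make two vertices take opposite values, and a directed
  cycle in which the occurrences of the literals of a clause alternate with forced vertices becomes
  acyclic iff some, but not all, of the occurrences are inverted. As the remaining arcs can be
  ordered, satisfiability of formulas in conjunctive normal form reduces to \<open>inv \<le> 1\<close>. An additional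
  source and sink, joined by a path back that two inverted vertices break, make the graph strongly
  connected. The formula is a Cook--Levin tableau of a multi-tape machine.

  Polynomial time. All functions that have to be computed can be defined from the bits and the length
  of the input by addition, truncated subtraction and bounded summation over numbers. Such
  definitions are compiled to structured programs whose variables are unary counters, one on each
  tape, and the states of the Turing machine are the residual programs.

  Membership. The certificate lists the inverted set together with partial orders that witness
  acyclicity and reachability; verifying it takes bounded quantifiers only.
\<close>

section \<open>Structured programs on Turing machines\<close>

text \<open>Hardness is proved from the definition of NP, starting with an arbitrary verifier, so
  all functions involved have to be computed by explicit machines. Unary counters suffice because
  every number that occurs is polynomially bounded: a bounded sum has as many terms as the value of
  its bound, and polynomials are closed under sum, product and composition. The same operations
  yield products, division, bounded quantifiers and finite tables. Hence a formula is never written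
  down as a list: clauses and literals are numbers whose digits in a common base are the indices of
  the tableau, occurrence is an arithmetical predicate, and the adjacency matrix is defined bit by
  bit. For the same reason a clause cycle runs through all literals, whether they occur in the
  clause or not. Acyclicity after an inversion is shown by explicit potentials; around a clause
  cycle such a potential exists only if its increments can sum up to zero, which requires both an
  inverted and a non-inverted vertex among those of the literals.\<close>

datatype com =
    Skip
  | Act nat "bool option" head_move
  | Seq com com
  | IfNe nat nat com com
  | WhileNe nat nat com

text \<open>A test, the start of another round of a loop and the removal of a finished
  \<open>Skip\<close> each take a step of their own that leaves the tapes alone. This accounts for
  the additive constants in the running times below.\<close>

fun small_step :: "com \<Rightarrow> (nat \<Rightarrow> nat) \<Rightarrow> com \<times> (nat \<times> bool option \<times> head_move) option" where
  "small_step Skip s = (Skip, None)"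
| "small_step (Act i w m) s = (Skip, Some (i, w, m))"
| "small_step (Seq c d) s =
     (if c = Skip then (d, None) else (Seq (fst (small_step c s)) d, snd (small_step c s)))"
| "small_step (IfNe i a c d) s = (if s i \<noteq> a then c else d, None)"
| "small_step (WhileNe i a c) s = (if s i \<noteq> a then Seq c (WhileNe i a c) else Skip, None)"

definition write_symbol :: "bool option \<Rightarrow> nat \<Rightarrow> nat" where
  "write_symbol w s = (case w of None \<Rightarrow> s | Some b \<Rightarrow> bit_symbol b)"

definition perform :: "(nat \<times> bool option \<times> head_move) option \<Rightarrow> nat \<Rightarrow> nat \<Rightarrow> nat \<times> head_move" where
  "perform a j s =
     (case a of None \<Rightarrow> (s, Move_None)
      | Some (i, w, m) \<Rightarrow> if i = j then (write_symbol w s, m) else (s, Move_None))"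

definition com_step :: "com \<times> (nat \<Rightarrow> tape) \<Rightarrow> com \<times> (nat \<Rightarrow> tape)" where
  "com_step p =
     (let r = small_step (fst p) (\<lambda>i. tape_read (snd p i))
      in (fst r, \<lambda>j. tape_act (perform (snd r) j (tape_read (snd p j))) (snd p j)))"

fun tapes_below :: "nat \<Rightarrow> com \<Rightarrow> bool" where
  "tapes_below k Skip = True"
| "tapes_below k (Act i w m) = (i < k)"
| "tapes_below k (Seq c d) = (tapes_below k c \<and> tapes_below k d)"
| "tapes_below k (IfNe i a c d) = (i < k \<and> tapes_below k c \<and> tapes_below k d)"
| "tapes_below k (WhileNe i a c) = (i < k \<and> tapes_below k c)"

lemma tapes_below_mono: "tapes_below k c \<Longrightarrow> k \<le> l \<Longrightarrow> tapes_below l c"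
  by (induction c) auto

text \<open>A superset of the programs reachable by \<open>small_step\<close>. It is finite because
  the body of a loop is always followed by the same loop. Its elements become the states of the
  machine.\<close>

fun residuals :: "com \<Rightarrow> com set" where
  "residuals Skip = {Skip}"
| "residuals (Act i w m) = {Act i w m, Skip}"
| "residuals (Seq c d) = (\<lambda>c'. Seq c' d) ` residuals c \<union> residuals d"
| "residuals (IfNe i a c d) = insert (IfNe i a c d) (residuals c \<union> residuals d)"
| "residuals (WhileNe i a c) =
     {WhileNe i a c, Skip} \<union> (\<lambda>c'. Seq c' (WhileNe i a c)) ` residuals c"

lemma finite_residuals: "finite (residuals c)"
  by (induction c) auto

lemma self_in_residuals [simp]: "c \<in> residuals c"
  by (induction c) auto

lemma skip_in_residuals [simp]: "Skip \<in> residuals c"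
  by (induction c) auto

lemma small_step_residuals: "c' \<in> residuals c \<Longrightarrow> fst (small_step c' s) \<in> residuals c"
  by (induction c arbitrary: c') (auto split: if_splits)

lemma residuals_tapes_below: "c' \<in> residuals c \<Longrightarrow> tapes_below k c \<Longrightarrow> tapes_below k c'"
  by (induction c arbitrary: c') auto

lemma small_step_cong:
  "tapes_below k c \<Longrightarrow> (\<And>i. i < k \<Longrightarrow> s i = s' i) \<Longrightarrow> small_step c s = small_step c s'"
  by (induction c) auto

text \<open>As \<open>Skip\<close> is idle, n is an upper bound on the running time and not its
  exact value; see \<open>run_mono\<close>.\<close>

definition run :: "com \<Rightarrow> (nat \<Rightarrow> tape) \<Rightarrow> nat \<Rightarrow> (nat \<Rightarrow> tape) \<Rightarrow> bool" where
  "run c \<tau> n \<tau>' \<longleftrightarrow> (com_step ^^ n) (c, \<tau>) = (Skip, \<tau>')"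

lemma tape_act_idle [simp]: "tape_act (tape_read t, Move_None) t = t"
  by (cases t) (simp add: tape_act_def tape_read_def)

lemma com_step_skip [simp]: "com_step (Skip, \<tau>) = (Skip, \<tau>)"
  by (simp add: com_step_def perform_def)

lemma com_steps_skip [simp]: "(com_step ^^ n) (Skip, \<tau>) = (Skip, \<tau>)"
  by (induction n) auto

lemma run_Suc: "run c \<tau> (Suc n) \<tau>' \<longleftrightarrow> (case com_step (c, \<tau>) of (d, \<sigma>) \<Rightarrow> run d \<sigma> n \<tau>')"
  by (simp add: run_def funpow_Suc_right del: funpow.simps split: prod.split)

lemma run_mono: "run c \<tau> n \<tau>' \<Longrightarrow> n \<le> m \<Longrightarrow> run c \<tau> m \<tau>'"
  using funpow_add[of "m - n" n com_step] by (simp add: run_def)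

lemma run_skip: "run Skip \<tau> n \<tau>"
  by (simp add: run_def)

lemma run_act: "run (Act i w m) \<tau> 1 (\<tau>(i := tape_act (write_symbol w (tape_read (\<tau> i)), m) (\<tau> i)))"
  by (auto simp: run_def com_step_def perform_def fun_eq_iff)

lemma run_seq: "run c \<tau> n \<tau>1 \<Longrightarrow> run d \<tau>1 m \<tau>2 \<Longrightarrow> run (Seq c d) \<tau> (n + m + 1) \<tau>2"
proof (induction n arbitrary: c \<tau>)
  case 0
  then have "c = Skip" "\<tau> = \<tau>1" by (auto simp: run_def)
  then show ?case using 0 by (simp add: run_Suc com_step_def perform_def)
next
  case (Suc n)
  show ?case
  proof (cases "c = Skip")
    case True
    then have "\<tau> = \<tau>1" using Suc.prems(1) by (simp add: run_def)
    then show ?thesis using True run_mono[OF Suc.prems(2), of "Suc (n + m)"]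
      by (simp add: run_Suc com_step_def perform_def)
  next
    case False
    obtain c' \<sigma> where s: "com_step (c, \<tau>) = (c', \<sigma>)" by fastforce
    then have "run c' \<sigma> n \<tau>1" using Suc.prems(1) by (simp add: run_Suc)
    then have "run (Seq c' d) \<sigma> (n + m + 1) \<tau>2" using Suc by blast
    moreover have "com_step (Seq c d, \<tau>) = (Seq c' d, \<sigma>)"
      using s False by (auto simp: com_step_def Let_def)
    ultimately show ?thesis by (simp add: run_Suc)
  qed
qed

lemma run_if_true:
  "tape_read (\<tau> i) \<noteq> a \<Longrightarrow> run c \<tau> n \<tau>' \<Longrightarrow> run (IfNe i a c d) \<tau> (n + 1) \<tau>'"
  by (simp add: run_Suc com_step_def perform_def)

lemma run_if_false:
  "tape_read (\<tau> i) = a \<Longrightarrow> run d \<tau> n \<tau>' \<Longrightarrow> run (IfNe i a c d) \<tau> (n + 1) \<tau>'"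
  by (simp add: run_Suc com_step_def perform_def)

lemma run_while_false: "tape_read (\<tau> i) = a \<Longrightarrow> run (WhileNe i a c) \<tau> 1 \<tau>"
  by (simp add: run_def com_step_def perform_def)

lemma run_while_true:
  assumes "tape_read (\<tau> i) \<noteq> a" "run c \<tau> n \<tau>1" "run (WhileNe i a c) \<tau>1 m \<tau>2"
  shows "run (WhileNe i a c) \<tau> (n + m + 2) \<tau>2"
  using run_seq[OF assms(2,3)] assms(1) by (simp add: run_Suc com_step_def perform_def)

text \<open>The tapes before round k are \<open>\<sigma> k\<close>. A round costs two steps beyond
  its body: the test and the removal of the \<open>Skip\<close> that the body leaves.\<close>

lemma run_while:
  assumes "\<And>k. k < n \<Longrightarrow> tape_read (\<sigma> k i) \<noteq> a \<and> run c (\<sigma> k) t (\<sigma> (Suc k))"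
    and "tape_read (\<sigma> n i) = a"
  shows "run (WhileNe i a c) (\<sigma> 0) (n * (t + 2) + 1) (\<sigma> n)"
  using assms
proof (induction n arbitrary: \<sigma>)
  case 0
  then show ?case by (simp add: run_while_false del: One_nat_def)
next
  case (Suc n)
  have "run (WhileNe i a c) (\<sigma> (Suc 0)) (n * (t + 2) + 1) (\<sigma> (Suc n))"
    using Suc.IH[of "\<lambda>k. \<sigma> (Suc k)"] Suc.prems by auto
  then have "run (WhileNe i a c) (\<sigma> 0) (t + (n * (t + 2) + 1) + 2) (\<sigma> (Suc n))"
    using run_while_true Suc.prems(1)[of 0] by blast
  then show ?case by (simp add: algebra_simps)
qed

section \<open>Compilation of programs to Turing machines\<close>

definition machine_of :: "nat \<Rightarrow> com \<Rightarrow> turing_machine" where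
  "machine_of k c =
     (let en = to_nat_on (residuals c); de = from_nat_into (residuals c)
      in \<lparr>tm_tapes = k, tm_states = card (residuals c), tm_symbols = 3, tm_start = en c,
          tm_halt = en Skip,
          tm_delta = (\<lambda>q ss. let r = small_step (de q) (\<lambda>i. ss ! i)
             in (en (fst r), map (\<lambda>j. perform (snd r) j (ss ! j)) [0..<k]))\<rparr>)"

lemma residual_code_less:
  "c' \<in> residuals c \<Longrightarrow> to_nat_on (residuals c) c' < card (residuals c)"
  using bij_betwE[OF to_nat_on_finite[OF finite_residuals[of c]]] by simp

lemma wf_machine_of:
  assumes "1 \<le> k"
  shows "wf_turing_machine (machine_of k c)"
proof -
  have "from_nat_into (residuals c) q \<in> residuals c" for q
    by (metis from_nat_into empty_iff self_in_residuals)
  then show ?thesis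
    using assms unfolding wf_turing_machine_def machine_of_def Let_def
    by (auto simp: residual_code_less small_step_residuals perform_def write_symbol_def
        bit_symbol_def split: option.splits)
qed


text \<open>The numbering is injective on the residuals, so only \<open>Skip\<close> is mapped to
  the halting state, and the program looks only at tapes that the machine has.\<close>

lemma machine_of_step:
  assumes "c' \<in> residuals c" "tapes_below k c"
  shows "tm_step (machine_of k c) (to_nat_on (residuals c) c', map \<tau> [0..<k]) =
    (to_nat_on (residuals c) (fst (com_step (c', \<tau>))), map (snd (com_step (c', \<tau>))) [0..<k])"
proof (cases "c' = Skip")
  case True
  then show ?thesis by (simp add: tm_step_def machine_of_def Let_def)
next
  case False
  have cnt: "countable (residuals c)" by (simp add: countable_finite finite_residuals)
  have ne: "to_nat_on (residuals c) c' \<noteq> to_nat_on (residuals c) Skip"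
    using False assms(1) cnt by simp
  have st: "small_step c' (\<lambda>i. map tape_read (map \<tau> [0..<k]) ! i) = small_step c' (\<lambda>i. tape_read (\<tau> i))"
    using residuals_tapes_below[OF assms] by (intro small_step_cong) auto
  show ?thesis
    using ne cnt assms(1) st
    by (auto simp: tm_step_def machine_of_def Let_def com_step_def intro!: nth_equalityI)
qed

lemma machine_of_run:
  assumes "run c \<tau> n \<tau>'" "tapes_below k c"
  shows "(tm_step (machine_of k c) ^^ n) (to_nat_on (residuals c) c, map \<tau> [0..<k]) =
    (to_nat_on (residuals c) Skip, map \<tau>' [0..<k])"
proof -
  have "fst ((com_step ^^ n) (c, \<tau>)) \<in> residuals c \<and>
    (tm_step (machine_of k c) ^^ n) (to_nat_on (residuals c) c, map \<tau> [0..<k]) =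
      (to_nat_on (residuals c) (fst ((com_step ^^ n) (c, \<tau>))), map (snd ((com_step ^^ n) (c, \<tau>))) [0..<k])"
    for n
  proof (induction n)
    case 0
    then show ?case by simp
  next
    case (Suc n)
    obtain d \<sigma> where d: "(com_step ^^ n) (c, \<tau>) = (d, \<sigma>)" by fastforce
    then have "d \<in> residuals c" using Suc by simp
    then have "fst (com_step (d, \<sigma>)) \<in> residuals c"
      by (simp add: com_step_def Let_def small_step_residuals)
    then show ?case using Suc d machine_of_step[OF \<open>d \<in> residuals c\<close> assms(2)] by simp
  qed
  then show ?thesis using assms(1) by (simp add: run_def)
qed

lemma polytime_computable_by_run:
  assumes "tapes_below k c" "1 \<le> k"
    and "\<And>x. \<exists>\<tau>'. run c (\<lambda>i. if i = 0 then input_tape x else blank_tape) (poly p (length x)) \<tau>' \<and>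
           tape_holds (\<tau>' (k - 1)) (f x)"
  shows "polytime_computable f"
proof -
  have "tm_computes_in_time (machine_of k c) f (poly p)"
    unfolding tm_computes_in_time_def
  proof
    fix x
    obtain \<tau>' where r: "run c (\<lambda>i. if i = 0 then input_tape x else blank_tape) (poly p (length x)) \<tau>'"
      and h: "tape_holds (\<tau>' (k - 1)) (f x)" using assms(3) by blast
    have i: "tm_init (machine_of k c) x =
        (to_nat_on (residuals c) c, map (\<lambda>i. if i = 0 then input_tape x else blank_tape) [0..<k])"
      using assms(2)
      by (auto simp: tm_init_def machine_of_def Let_def intro!: nth_equalityI split: nat.splits
          simp: nth_Cons)
    have "last (map \<tau>' [0..<k]) = \<tau>' (k - 1)"
      using assms(2) by (simp add: last_map)
    then show "let c' = (tm_step (machine_of k c) ^^ poly p (length x)) (tm_init (machine_of k c) x)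
        in fst c' = tm_halt (machine_of k c) \<and> tape_holds (last (snd c')) (f x)"
      using h by (simp add: i machine_of_run[OF r assms(1)]) (simp add: machine_of_def Let_def)
  qed
  then show ?thesis using wf_machine_of[OF assms(2)] by (auto simp: polytime_computable_def)
qed

text \<open>A counter is stored as the position of a head on a tape whose only mark is on cell \<open>0\<close>.\<close>

definition counter :: "nat \<Rightarrow> tape" where
  "counter n = ((\<lambda>_. 0)(0 := 1), int n)"

section \<open>Elementary programs on counters\<close>

abbreviation "Inc i \<equiv> Act i None Move_Right"
abbreviation "Dec i \<equiv> Act i None Move_Left"

lemma counter_read [simp]: "tape_read (counter n) = (if n = 0 then 1 else 0)"
  by (simp add: counter_def tape_read_def)

lemma tape_act_read [simp]:
  "tape_act (tape_read t, m) t = (fst t, snd t + head_shift m)"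
  by (simp add: tape_act_def tape_read_def)

lemma run_inc: "\<tau> i = counter n \<Longrightarrow> run (Inc i) \<tau> 1 (\<tau>(i := counter (Suc n)))"
  using run_act[of i None Move_Right \<tau>]
  by (simp add: write_symbol_def del: counter_read) (simp add: counter_def add.commute)

lemma run_dec: "\<tau> i = counter (Suc n) \<Longrightarrow> run (Dec i) \<tau> 1 (\<tau>(i := counter n))"
  using run_act[of i None Move_Left \<tau>]
  by (simp add: write_symbol_def del: counter_read) (simp add: counter_def)

text \<open>Abstracts from the kind of tape, so that the same lemmas on loops serve counters going
  up or down and the input head going right or left.\<close>

definition advances :: "com \<Rightarrow> nat \<Rightarrow> (nat \<Rightarrow> tape) \<Rightarrow> nat \<Rightarrow> bool" where
  "advances c i s n \<longleftrightarrow> (\<forall>k < n. \<forall>\<tau>. \<tau> i = s k \<longrightarrow> run c \<tau> 1 (\<tau>(i := s (Suc k))))"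

lemma advances_inc: "advances (Inc i) i (\<lambda>k. counter (m + k)) n"
  using run_inc by (auto simp: advances_def)

lemma advances_dec: "advances (Dec i) i (\<lambda>k. counter (n - k)) n"
  using run_dec by (auto simp: advances_def Suc_diff_Suc)

text \<open>The factor 5 consists of the two commands, one step for \<open>Seq\<close> and two for
  the loop. The third command in \<open>run_lockstep3\<close> adds two more.\<close>

lemma run_lockstep2:
  assumes c: "advances c i s n" and d: "advances d j t n" and "i \<noteq> j" "\<tau> i = s 0" "\<tau> j = t 0"
    and "\<And>k. k < n \<Longrightarrow> tape_read (s k) \<noteq> a" "tape_read (s n) = a"
  shows "run (WhileNe i a (Seq c d)) \<tau> (5 * n + 1) (\<tau>(i := s n, j := t n))"
proof -
  define \<sigma> where "\<sigma> k = \<tau>(i := s k, j := t k)" for k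
  have "run (Seq c d) (\<sigma> k) (1 + 1 + 1) (\<sigma> (Suc k))" if k: "k < n" for k
  proof (rule run_seq)
    have "\<sigma> k i = s k" using assms(3) by (simp add: \<sigma>_def)
    then show "run c (\<sigma> k) 1 ((\<sigma> k)(i := s (Suc k)))" using c k unfolding advances_def by blast
    have "\<sigma> (Suc k) = ((\<sigma> k)(i := s (Suc k)))(j := t (Suc k))"
      using assms(3) by (auto simp: \<sigma>_def fun_eq_iff)
    moreover have "((\<sigma> k)(i := s (Suc k))) j = t k" using assms(3) by (simp add: \<sigma>_def)
    ultimately show "run d ((\<sigma> k)(i := s (Suc k))) 1 (\<sigma> (Suc k))"
      using d k unfolding advances_def by metis
  qed
  then have "run (WhileNe i a (Seq c d)) (\<sigma> 0) (n * (1 + 1 + 1 + 2) + 1) (\<sigma> n)"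
    using assms by (intro run_while[where \<sigma> = \<sigma>]) (auto simp: \<sigma>_def)
  moreover have "\<sigma> 0 = \<tau>" using assms by (auto simp: \<sigma>_def fun_eq_iff)
  ultimately show ?thesis by (auto elim!: run_mono simp: \<sigma>_def)
qed

lemma run_lockstep3:
  assumes c: "advances c i s n" and d: "advances d j t n" and e: "advances e l u n"
    and ne: "i \<noteq> j" "i \<noteq> l" "j \<noteq> l" and "\<tau> i = s 0" "\<tau> j = t 0" "\<tau> l = u 0"
    and "\<And>k. k < n \<Longrightarrow> tape_read (s k) \<noteq> a" "tape_read (s n) = a"
  shows "run (WhileNe i a (Seq c (Seq d e))) \<tau> (7 * n + 1) (\<tau>(i := s n, j := t n, l := u n))"
proof -
  define \<sigma> where "\<sigma> k = \<tau>(i := s k, j := t k, l := u k)" for k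
  have "run (Seq c (Seq d e)) (\<sigma> k) (1 + (1 + 1 + 1) + 1) (\<sigma> (Suc k))" if k: "k < n" for k
  proof (intro run_seq)
    let ?\<sigma>1 = "(\<sigma> k)(i := s (Suc k))" and ?\<sigma>2 = "(\<sigma> k)(i := s (Suc k), j := t (Suc k))"
    have "\<sigma> k i = s k" using ne by (simp add: \<sigma>_def)
    then show "run c (\<sigma> k) 1 ?\<sigma>1" using c k unfolding advances_def by blast
    have "?\<sigma>1 j = t k" using ne by (simp add: \<sigma>_def)
    then show "run d ?\<sigma>1 1 ?\<sigma>2" using d k unfolding advances_def by blast
    have "\<sigma> (Suc k) = ?\<sigma>2(l := u (Suc k))" "?\<sigma>2 l = u k"
      using ne by (auto simp: \<sigma>_def fun_eq_iff)
    then show "run e ?\<sigma>2 1 (\<sigma> (Suc k))" using e k unfolding advances_def by metis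
  qed
  then have "run (WhileNe i a (Seq c (Seq d e))) (\<sigma> 0) (n * (1 + (1 + 1 + 1) + 1 + 2) + 1) (\<sigma> n)"
    using assms by (intro run_while[where \<sigma> = \<sigma>]) (auto simp: \<sigma>_def)
  moreover have "\<sigma> 0 = \<tau>" using assms by (auto simp: \<sigma>_def fun_eq_iff)
  ultimately show ?thesis by (auto elim!: run_mono simp: \<sigma>_def)
qed

definition transfer :: "nat \<Rightarrow> nat \<Rightarrow> com" where
  "transfer i j = WhileNe i 1 (Seq (Dec i) (Inc j))"

lemma run_transfer:
  assumes "\<tau> i = counter n" "\<tau> j = counter m" "i \<noteq> j"
  shows "run (transfer i j) \<tau> (5 * n + 1) (\<tau>(i := counter 0, j := counter (m + n)))"
  using run_lockstep2[OF advances_dec[of i n] advances_inc[of j m n] assms(3), of \<tau> 1] assms(1,2)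
  by (simp add: transfer_def)

definition clear :: "nat \<Rightarrow> com" where
  "clear i = WhileNe i 1 (Dec i)"

lemma run_clear:
  assumes "\<tau> i = counter n"
  shows "run (clear i) \<tau> (3 * n + 1) (\<tau>(i := counter 0))"
proof -
  define \<sigma> where "\<sigma> k = \<tau>(i := counter (n - k))" for k
  have "run (Dec i) (\<sigma> k) 1 (\<sigma> (Suc k))" if "k < n" for k
  proof -
    have "\<sigma> (Suc k) = (\<sigma> k)(i := counter (n - Suc k))" by (auto simp: \<sigma>_def)
    then show ?thesis using that by (simp only:) (rule run_dec, auto simp: \<sigma>_def Suc_diff_Suc)
  qed
  then have "run (WhileNe i 1 (Dec i)) (\<sigma> 0) (n * (1 + 2) + 1) (\<sigma> n)"
    using assms by (intro run_while[where \<sigma> = \<sigma>]) (auto simp: \<sigma>_def)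
  moreover have "\<sigma> 0 = \<tau>" using assms by (auto simp: \<sigma>_def fun_eq_iff)
  ultimately show ?thesis using assms by (auto elim!: run_mono simp: \<sigma>_def clear_def)
qed

lemma poly_nat_mono: "m \<le> n \<Longrightarrow> poly (p :: nat poly) m \<le> poly p n"
  by (induction p) (auto intro: add_mono mult_mono)

text \<open>The calling convention: tape 0 holds the input with its head on cell 0, tape
  \<open>loc j\<close> holds variable j, and the w tapes from r on are work space set to zero. The
  result appears on tape r and all other tapes are restored, so calls can be nested. A single
  polynomial bounds the value as well as the time, in terms of a bound m on the input length and on
  all variables.\<close>

definition counter_program ::
    "(bool list \<Rightarrow> (nat \<Rightarrow> nat) \<Rightarrow> nat) \<Rightarrow> nat poly \<Rightarrow> nat \<Rightarrow> (nat \<Rightarrow> nat) \<Rightarrow> nat \<Rightarrow> com \<Rightarrow> bool" where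
  "counter_program F p w loc r c \<longleftrightarrow> tapes_below (r + w) c \<and>
     (\<forall>x \<rho> \<tau> m. \<tau> 0 = input_tape x \<and> (\<forall>j. \<tau> (loc j) = counter (\<rho> j)) \<and>
        (\<forall>i. r \<le> i \<and> i < r + w \<longrightarrow> \<tau> i = counter 0) \<and> length x \<le> m \<and> (\<forall>j. \<rho> j \<le> m) \<longrightarrow>
        F x \<rho> \<le> poly p m \<and> run c \<tau> (poly p m) (\<tau>(r := counter (F x \<rho>))))"

text \<open>Width and polynomial are fixed before the placement of the tapes, because a caller
  builds its own width and polynomial from them and only then chooses where the call is placed.
  Variables may share a tape, so infinitely many of them fit on finitely many tapes.\<close>

definition counter_computable :: "(bool list \<Rightarrow> (nat \<Rightarrow> nat) \<Rightarrow> nat) \<Rightarrow> bool" where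
  "counter_computable F \<longleftrightarrow>
     (\<exists>w p. 1 \<le> w \<and> (\<forall>loc r. (\<forall>j. 1 \<le> loc j \<and> loc j < r) \<longrightarrow> (\<exists>c. counter_program F p w loc r c)))"

section \<open>Arithmetic on counters\<close>

lemma counter_programI:
  assumes "tapes_below (r + w) c"
    and "\<And>x \<rho> \<tau> m. \<tau> 0 = input_tape x \<Longrightarrow> (\<And>j. \<tau> (loc j) = counter (\<rho> j)) \<Longrightarrow>
        (\<And>i. r \<le> i \<Longrightarrow> i < r + w \<Longrightarrow> \<tau> i = counter 0) \<Longrightarrow> length x \<le> m \<Longrightarrow> (\<And>j. \<rho> j \<le> m) \<Longrightarrow>
        F x \<rho> \<le> poly p m \<and> (\<exists>n \<le> poly p m. run c \<tau> n (\<tau>(r := counter (F x \<rho>))))"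
  shows "counter_program F p w loc r c"
  unfolding counter_program_def using assms run_mono by blast

lemma counter_programD:
  assumes "counter_program F p w loc r c"
    and "\<tau> 0 = input_tape x" "\<And>j. \<tau> (loc j) = counter (\<rho> j)"
    and "\<And>i. r \<le> i \<Longrightarrow> i < r + w \<Longrightarrow> \<tau> i = counter 0" "length x \<le> m" "\<And>j. \<rho> j \<le> m"
  shows "F x \<rho> \<le> poly p m" "run c \<tau> (poly p m) (\<tau>(r := counter (F x \<rho>)))"
  using assms unfolding counter_program_def by blast+

lemma counter_computable_var: "counter_computable (\<lambda>x \<rho>. \<rho> v)"
  unfolding counter_computable_def
proof (rule exI[of _ 2], rule exI[of _ "[:4, 13:]"], intro conjI allI impI)
  fix loc :: "nat \<Rightarrow> nat" and r
  assume loc: "\<forall>j. 1 \<le> loc j \<and> loc j < r"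
  define i where "i = loc v"
  have i: "1 \<le> i" "i < r" using loc by (auto simp: i_def)
  \<comment> \<open>Reading out a counter destroys it. So the value is moved to two tapes at once,
    and one of the copies is moved back.\<close>
  define c where "c = Seq (WhileNe i 1 (Seq (Dec i) (Seq (Inc r) (Inc (Suc r))))) (transfer (Suc r) i)"
  have "counter_program (\<lambda>x \<rho>. \<rho> v) [:4, 13:] 2 loc r c"
  proof (rule counter_programI)
    show "tapes_below (r + 2) c" using i by (auto simp: c_def transfer_def)
  next
    fix x \<rho> \<tau> m
    assume 0: "\<tau> 0 = input_tape x" and env: "\<And>j. \<tau> (loc j) = counter (\<rho> j)"
      and z: "\<And>i. r \<le> i \<Longrightarrow> i < r + 2 \<Longrightarrow> \<tau> i = counter 0" and m: "length x \<le> m" "\<And>j. \<rho> j \<le> m"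
    define n where "n = \<rho> v"
    have t: "\<tau> i = counter n" "\<tau> r = counter 0" "\<tau> (Suc r) = counter 0"
      using env z by (auto simp: i_def n_def)
    have "run (WhileNe i 1 (Seq (Dec i) (Seq (Inc r) (Inc (Suc r))))) \<tau> (7 * n + 1)
        (\<tau>(i := counter 0, r := counter n, Suc r := counter n))"
      using run_lockstep3[OF advances_dec[of i n] advances_inc[of r 0 n] advances_inc[of "Suc r" 0 n], of \<tau> 1]
        i t by simp
    moreover have "run (transfer (Suc r) i) (\<tau>(i := counter 0, r := counter n, Suc r := counter n)) (5 * n + 1)
        (\<tau>(i := counter 0, r := counter n, Suc r := counter n, Suc r := counter 0, i := counter (0 + n)))"
      using i by (intro run_transfer) auto
    moreover have "\<tau>(i := counter 0, r := counter n, Suc r := counter n, Suc r := counter 0, i := counter (0 + n)) =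
        \<tau>(r := counter n)"
      using i t by (auto simp: fun_eq_iff)
    ultimately have "run c \<tau> (7 * n + 1 + (5 * n + 1) + 1) (\<tau>(r := counter n))"
      unfolding c_def by (metis run_seq)
    moreover have "n \<le> m" using m by (simp add: n_def)
    ultimately show "\<rho> v \<le> poly [:4, 13:] m \<and> (\<exists>n\<le>poly [:4, 13:] m. run c \<tau> n (\<tau>(r := counter (\<rho> v))))"
      unfolding n_def[symmetric] by (intro conjI exI[of _ "7 * n + 1 + (5 * n + 1) + 1"]) auto
  qed
  then show "\<exists>c. counter_program (\<lambda>x \<rho>. \<rho> v) [:4, 13:] 2 loc r c" by blast
qed simp

lemma counter_computable_one: "counter_computable (\<lambda>x \<rho>. 1)"
  unfolding counter_computable_def
proof (rule exI[of _ 1], rule exI[of _ 1], intro conjI allI impI)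
  fix loc :: "nat \<Rightarrow> nat" and r
  have "counter_program (\<lambda>x \<rho>. 1) 1 1 loc r (Inc r)"
    by (rule counter_programI) (use run_inc[where n = 0] in auto)
  then show "\<exists>c. counter_program (\<lambda>x \<rho>. 1) 1 1 loc r c" by blast
qed simp

section \<open>Access to the input\<close>

definition input_at :: "bool list \<Rightarrow> nat \<Rightarrow> tape" where
  "input_at x k = (fst (input_tape x), int k)"

lemma input_at_0: "input_at x 0 = input_tape x"
  by (simp add: input_at_def input_tape_def)

lemma read_input_at: "tape_read (input_at x k) = (if k < length x then bit_symbol (x ! k) else 0)"
  by (simp add: input_at_def tape_read_def input_tape_def)

lemma run_input_right: "\<tau> i = input_at x k \<Longrightarrow> run (Inc i) \<tau> 1 (\<tau>(i := input_at x (Suc k)))"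
  using run_act[of i None Move_Right \<tau>]
  by (simp add: write_symbol_def) (simp add: input_at_def add.commute)

lemma run_input_left: "\<tau> i = input_at x (Suc k) \<Longrightarrow> run (Dec i) \<tau> 1 (\<tau>(i := input_at x k))"
  using run_act[of i None Move_Left \<tau>]
  by (simp add: write_symbol_def) (simp add: input_at_def)

lemma advances_right: "advances (Inc i) i (\<lambda>k. input_at x k) n"
  using run_input_right by (auto simp: advances_def)

lemma advances_left: "advances (Dec i) i (\<lambda>k. input_at x (n - k)) n"
  using run_input_left by (auto simp: advances_def Suc_diff_Suc)

definition rewind :: "nat \<Rightarrow> com" where
  "rewind i = WhileNe i 1 (Seq (Dec i) (Dec 0))"

lemma run_rewind:
  assumes "\<tau> i = counter n" "\<tau> 0 = input_at x n" "0 < i"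
  shows "run (rewind i) \<tau> (5 * n + 1) (\<tau>(i := counter 0, 0 := input_tape x))"
  using run_lockstep2[OF advances_dec[of i n] advances_left[of 0 x n], of \<tau> 1] assms
  by (simp add: rewind_def input_at_0)

lemma counter_computable_length: "counter_computable (\<lambda>x \<rho>. length x)"
  unfolding counter_computable_def
proof (rule exI[of _ 2], rule exI[of _ "[:4, 13:]"], intro conjI allI impI)
  fix loc :: "nat \<Rightarrow> nat" and r
  assume loc: "\<forall>j. 1 \<le> loc j \<and> loc j < r"
  then have r: "0 < r" by (metis gr_zeroI not_less0)
  \<comment> \<open>The input tape bears no mark at its beginning; the second count, on tape
    \<open>Suc r\<close>, tells how far the head has to go back.\<close>
  define c where "c = Seq (WhileNe 0 0 (Seq (Inc 0) (Seq (Inc r) (Inc (Suc r))))) (rewind (Suc r))"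
  have "counter_program (\<lambda>x \<rho>. length x) [:4, 13:] 2 loc r c"
  proof (rule counter_programI)
    show "tapes_below (r + 2) c" by (auto simp: c_def rewind_def)
  next
    fix x \<tau> m and \<rho> :: "nat \<Rightarrow> nat"
    assume 0: "\<tau> 0 = input_tape x"
      and z: "\<And>i. r \<le> i \<Longrightarrow> i < r + 2 \<Longrightarrow> \<tau> i = counter 0" and m: "length x \<le> m"
    define n where "n = length x"
    have "run (WhileNe 0 0 (Seq (Inc 0) (Seq (Inc r) (Inc (Suc r))))) \<tau> (7 * n + 1)
        (\<tau>(0 := input_at x n, r := counter n, Suc r := counter n))"
      using run_lockstep3[OF advances_right[of 0 x n] advances_inc[of r 0 n] advances_inc[of "Suc r" 0 n], of \<tau> 0]
        r 0 z[of r] z[of "Suc r"] by (simp add: input_at_0 read_input_at n_def bit_symbol_def)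
    moreover have "run (rewind (Suc r)) (\<tau>(0 := input_at x n, r := counter n, Suc r := counter n)) (5 * n + 1)
        (\<tau>(0 := input_at x n, r := counter n, Suc r := counter n, Suc r := counter 0, 0 := input_tape x))"
      using r by (intro run_rewind) auto
    moreover have "\<tau>(0 := input_at x n, r := counter n, Suc r := counter n, Suc r := counter 0, 0 := input_tape x) =
        \<tau>(r := counter n)"
      using r z 0 by (auto simp: fun_eq_iff)
    ultimately have "run c \<tau> (7 * n + 1 + (5 * n + 1) + 1) (\<tau>(r := counter n))"
      unfolding c_def by (metis run_seq)
    moreover have "n \<le> m" using m by (simp add: n_def)
    ultimately show "length x \<le> poly [:4, 13:] m \<and>
        (\<exists>n\<le>poly [:4, 13:] m. run c \<tau> n (\<tau>(r := counter (length x))))"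
      unfolding n_def[symmetric] by (intro conjI exI[of _ "7 * n + 1 + (5 * n + 1) + 1"]) auto
  qed
  then show "\<exists>c. counter_program (\<lambda>x \<rho>. length x) [:4, 13:] 2 loc r c" by blast
qed simp

lemma counter_computable_bit:
  assumes "counter_computable F"
  shows "counter_computable (\<lambda>x \<rho>. of_bool (F x \<rho> < length x \<and> x ! F x \<rho>))"
proof -
  obtain w p where w: "1 \<le> w"
    and F: "\<And>loc r. (\<forall>j. 1 \<le> loc j \<and> loc j < r) \<Longrightarrow> \<exists>c. counter_program F p w loc r c"
    using assms unfolding counter_computable_def by blast
  define G where "G = (\<lambda>x \<rho>. of_bool (F x \<rho> < length x \<and> x ! F x \<rho>) :: nat)"
  define q where "q = [:13:] * p + [:8:]"
  have "\<exists>c. counter_program G q (w + 1) loc r c"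
    if loc: "\<forall>j. 1 \<le> loc j \<and> loc j < r" for loc r
  proof -
    obtain c1 where c1: "counter_program F p w loc r c1" using F[OF loc] by blast
    have r: "0 < r" using loc by (metis gr_zeroI not_less0)
    define L where "L = WhileNe r 1 (Seq (Dec r) (Seq (Inc (Suc r)) (Inc 0)))"
    \<comment> \<open>Beyond the input the head reads the blank 0, so the first test decides the
      comparison with \<open>length x\<close>. In the second one, the symbol 1 stands for
      \<open>False\<close>.\<close>
    define I where "I = IfNe 0 0 (IfNe 0 1 (Inc r) Skip) Skip"
    define c where "c = Seq c1 (Seq L (Seq I (rewind (Suc r))))"
    have "counter_program G q (w + 1) loc r c"
    proof (rule counter_programI)
      show "tapes_below (r + (w + 1)) c"
        using c1 w by (auto simp: c_def L_def I_def rewind_def counter_program_def intro: tapes_below_mono)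
    next
      fix x \<rho> \<tau> m
      assume 0: "\<tau> 0 = input_tape x" and env: "\<And>j. \<tau> (loc j) = counter (\<rho> j)"
        and z: "\<And>i. r \<le> i \<Longrightarrow> i < r + (w + 1) \<Longrightarrow> \<tau> i = counter 0"
        and m: "length x \<le> m" "\<And>j. \<rho> j \<le> m"
      define n where "n = F x \<rho>"
      have n: "n \<le> poly p m" and R1: "run c1 \<tau> (poly p m) (\<tau>(r := counter n))"
        using counter_programD[OF c1, of \<tau> x \<rho> m] 0 env z m by (auto simp: n_def)
      define \<sigma> where "\<sigma> = \<tau>(r := counter 0, Suc r := counter n, 0 := input_at x n)"
      have R2: "run L (\<tau>(r := counter n)) (7 * n + 1) \<sigma>"
        using run_lockstep3[OF advances_dec[of r n] advances_inc[of "Suc r" 0 n] advances_right[of 0 x n],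
            of "\<tau>(r := counter n)" 1] r w 0 z[of "Suc r"]
        by (simp add: L_def \<sigma>_def input_at_0)
      have R3: "run I \<sigma> (1 + 1 + 1) (\<sigma>(r := counter (G x \<rho>)))"
      proof (cases "n < length x")
        case True
        show ?thesis
        proof (cases "x ! n")
          case t: True
          have "run (Inc r) \<sigma> 1 (\<sigma>(r := counter (Suc 0)))"
            using r by (intro run_inc) (auto simp: \<sigma>_def)
          then show ?thesis unfolding I_def using True t r
            by (intro run_if_true) (auto simp: \<sigma>_def read_input_at bit_symbol_def G_def n_def)
        next
          case f: False
          have "run Skip \<sigma> 1 (\<sigma>(r := counter 0))"
            using run_skip[of "\<sigma>" 1] r by (simp add: \<sigma>_def fun_upd_twist)
          then show ?thesis unfolding I_def using True f r
            by (intro run_if_true run_if_false) (auto simp: \<sigma>_def read_input_at bit_symbol_def G_def n_def)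
        qed
      next
        case False
        have "run Skip \<sigma> (1 + 1) (\<sigma>(r := counter 0))"
          using run_skip[of "\<sigma>" "1 + 1"] r by (simp add: \<sigma>_def fun_upd_twist)
        then show ?thesis unfolding I_def using False r
          by (intro run_if_false) (auto simp: \<sigma>_def read_input_at bit_symbol_def G_def n_def)
      qed
      have "run (rewind (Suc r)) (\<sigma>(r := counter (G x \<rho>))) (5 * n + 1)
          (\<sigma>(r := counter (G x \<rho>), Suc r := counter 0, 0 := input_tape x))"
        using r by (intro run_rewind) (auto simp: \<sigma>_def)
      moreover have "\<sigma>(r := counter (G x \<rho>), Suc r := counter 0, 0 := input_tape x) =
          \<tau>(r := counter (G x \<rho>))"
        using r z w 0 by (auto simp: \<sigma>_def fun_eq_iff)
      ultimately have R4: "run (rewind (Suc r)) (\<sigma>(r := counter (G x \<rho>))) (5 * n + 1)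
          (\<tau>(r := counter (G x \<rho>)))" by simp
      have "run c \<tau> (poly p m + (7 * n + 1 + (1 + 1 + 1 + (5 * n + 1) + 1) + 1) + 1) (\<tau>(r := counter (G x \<rho>)))"
        unfolding c_def by (intro run_seq[OF R1] run_seq[OF R2] run_seq[OF R3] R4)
      then show "G x \<rho> \<le> poly q m \<and> (\<exists>n\<le>poly q m. run c \<tau> n (\<tau>(r := counter (G x \<rho>))))"
        using n by (intro conjI exI[of _ "poly p m + (7 * n + 1 + (1 + 1 + 1 + (5 * n + 1) + 1) + 1) + 1"])
          (auto simp: q_def G_def)
    qed
    then show ?thesis by blast
  qed
  then show ?thesis unfolding counter_computable_def G_def by (intro exI[of _ "w + 1"] exI[of _ q]) auto
qed


text \<open>The common frame of addition and truncated subtraction: the second argument is computed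
  on tape \<open>Suc r\<close>, next to the first result, and \<open>cmb\<close> folds it into tape
  r. The time \<open>6 * n + 1\<close> is that of \<open>subtract\<close> and exceeds that of
  \<open>transfer\<close>.\<close>

lemma counter_computable_combine:
  assumes F: "counter_computable F" and G: "counter_computable G"
    and below: "\<And>i j. tapes_below (Suc (max i j)) (cmb i j)"
    and run_cmb: "\<And>\<tau> i j m n. \<tau> i = counter n \<Longrightarrow> \<tau> j = counter m \<Longrightarrow> i \<noteq> j \<Longrightarrow>
      run (cmb i j) \<tau> (6 * n + 1) (\<tau>(i := counter 0, j := counter (f m n)))"
    and le: "\<And>m n. f m n \<le> m + n"
  shows "counter_computable (\<lambda>x \<rho>. f (F x \<rho>) (G x \<rho>))"
proof -
  obtain w1 p1 where w1: "1 \<le> w1"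
    and cF: "\<And>loc r. (\<forall>j. 1 \<le> loc j \<and> loc j < r) \<Longrightarrow> \<exists>c. counter_program F p1 w1 loc r c"
    using F unfolding counter_computable_def by blast
  obtain w2 p2 where w2: "1 \<le> w2"
    and cG: "\<And>loc r. (\<forall>j. 1 \<le> loc j \<and> loc j < r) \<Longrightarrow> \<exists>c. counter_program G p2 w2 loc r c"
    using G unfolding counter_computable_def by blast
  define q where "q = p1 + [:7:] * p2 + [:3:]"
  define w where "w = w1 + w2 + 1"
  have "\<exists>c. counter_program (\<lambda>x \<rho>. f (F x \<rho>) (G x \<rho>)) q w loc r c"
    if loc: "\<forall>j. 1 \<le> loc j \<and> loc j < r" for loc r
  proof -
    obtain c1 where c1: "counter_program F p1 w1 loc r c1" using cF[OF loc] by blast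
    obtain c2 where c2: "counter_program G p2 w2 loc (Suc r) c2"
      using cG[of loc "Suc r"] loc less_SucI by blast
    have locr: "loc j \<noteq> r" "0 < r" for j using loc by (auto simp: nat_neq_iff dest: spec[of _ j])
    define c where "c = Seq c1 (Seq c2 (cmb (Suc r) r))"
    have "counter_program (\<lambda>x \<rho>. f (F x \<rho>) (G x \<rho>)) q w loc r c"
    proof (rule counter_programI)
      show "tapes_below (r + w) c"
        using c1 c2 w1 by (auto simp: c_def w_def counter_program_def intro: tapes_below_mono intro!: tapes_below_mono[OF below])
    next
      fix x \<rho> \<tau> m
      assume 0: "\<tau> 0 = input_tape x" and env: "\<And>j. \<tau> (loc j) = counter (\<rho> j)"
        and z: "\<And>i. r \<le> i \<Longrightarrow> i < r + w \<Longrightarrow> \<tau> i = counter 0"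
        and m: "length x \<le> m" "\<And>j. \<rho> j \<le> m"
      define a where "a = F x \<rho>"
      define b where "b = G x \<rho>"
      have a: "a \<le> poly p1 m" and R1: "run c1 \<tau> (poly p1 m) (\<tau>(r := counter a))"
        using counter_programD[OF c1, of \<tau> x \<rho> m] 0 env z m by (auto simp: a_def w_def)
      have b: "b \<le> poly p2 m"
        and R2: "run c2 (\<tau>(r := counter a)) (poly p2 m) (\<tau>(r := counter a, Suc r := counter b))"
        using counter_programD[OF c2, of "\<tau>(r := counter a)" x \<rho> m] 0 env z m locr
        by (auto simp: b_def w_def)
      have "run (cmb (Suc r) r) (\<tau>(r := counter a, Suc r := counter b)) (6 * b + 1)
          (\<tau>(r := counter a, Suc r := counter b, Suc r := counter 0, r := counter (f a b)))"
        by (intro run_cmb) auto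
      moreover have "\<tau>(r := counter a, Suc r := counter b, Suc r := counter 0, r := counter (f a b)) =
          \<tau>(r := counter (f a b))"
        using z w1 by (auto simp: fun_eq_iff w_def)
      ultimately have R3: "run (cmb (Suc r) r) (\<tau>(r := counter a, Suc r := counter b)) (6 * b + 1)
          (\<tau>(r := counter (f a b)))" by simp
      have "run c \<tau> (poly p1 m + (poly p2 m + (6 * b + 1) + 1) + 1) (\<tau>(r := counter (f a b)))"
        unfolding c_def by (intro run_seq[OF R1] run_seq[OF R2] R3)
      then show "f (F x \<rho>) (G x \<rho>) \<le> poly q m \<and> (\<exists>n\<le>poly q m. run c \<tau> n (\<tau>(r := counter (f (F x \<rho>) (G x \<rho>)))))"
        unfolding a_def[symmetric] b_def[symmetric] using a b le[of a b]
        by (intro conjI exI[of _ "poly p1 m + (poly p2 m + (6 * b + 1) + 1) + 1"]) (auto simp: q_def)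
    qed
    then show ?thesis by blast
  qed
  then show ?thesis unfolding counter_computable_def
    by (intro exI[of _ w] exI[of _ q]) (auto simp: w_def)
qed

lemma counter_computable_add:
  assumes "counter_computable F" "counter_computable G"
  shows "counter_computable (\<lambda>x \<rho>. F x \<rho> + G x \<rho>)"
  using assms
proof (rule counter_computable_combine[where cmb = transfer])
  show "run (transfer i j) \<tau> (6 * n + 1) (\<tau>(i := counter 0, j := counter (m + n)))"
    if "\<tau> i = counter n" "\<tau> j = counter m" "i \<noteq> j" for \<tau> i j m n
    using run_transfer[OF that] by (rule run_mono) simp
qed (auto simp: transfer_def)

text \<open>The inner test keeps the head from passing the mark on cell 0, which truncates the
  difference at zero.\<close>

definition subtract :: "nat \<Rightarrow> nat \<Rightarrow> com" where
  "subtract i j = WhileNe i 1 (Seq (Dec i) (IfNe j 1 (Dec j) Skip))"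

lemma run_subtract:
  assumes "\<tau> i = counter n" "\<tau> j = counter m" "i \<noteq> j"
  shows "run (subtract i j) \<tau> (6 * n + 1) (\<tau>(i := counter 0, j := counter (m - n)))"
proof -
  define \<sigma> where "\<sigma> k = \<tau>(i := counter (n - k), j := counter (m - k))" for k
  have "run (Seq (Dec i) (IfNe j 1 (Dec j) Skip)) (\<sigma> k) (1 + (1 + 1) + 1) (\<sigma> (Suc k))" if "k < n" for k
  proof (rule run_seq)
    show "run (Dec i) (\<sigma> k) 1 ((\<sigma> k)(i := counter (n - Suc k)))"
      using assms that by (intro run_dec) (auto simp: \<sigma>_def Suc_diff_Suc)
    have s: "\<sigma> (Suc k) = ((\<sigma> k)(i := counter (n - Suc k)))(j := counter (m - Suc k))"
      using assms by (auto simp: \<sigma>_def fun_eq_iff)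
    show "run (IfNe j 1 (Dec j) Skip) ((\<sigma> k)(i := counter (n - Suc k))) (1 + 1) (\<sigma> (Suc k))"
    proof (cases "k < m")
      case True
      have "run (Dec j) ((\<sigma> k)(i := counter (n - Suc k))) 1 (\<sigma> (Suc k))"
        unfolding s using assms True by (intro run_dec) (auto simp: \<sigma>_def Suc_diff_Suc)
      then show ?thesis using assms True by (intro run_if_true) (auto simp: \<sigma>_def)
    next
      case False
      have "run Skip ((\<sigma> k)(i := counter (n - Suc k))) 1 (\<sigma> (Suc k))"
      proof -
        have "(\<sigma> k)(i := counter (n - Suc k)) = \<sigma> (Suc k)"
          using False assms by (auto simp: \<sigma>_def fun_eq_iff)
        then show ?thesis by (simp add: run_skip)
      qed
      then show ?thesis using assms False by (intro run_if_false) (auto simp: \<sigma>_def)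
    qed
  qed
  then have "run (WhileNe i 1 (Seq (Dec i) (IfNe j 1 (Dec j) Skip))) (\<sigma> 0) (n * (1 + (1 + 1) + 1 + 2) + 1) (\<sigma> n)"
    using assms by (intro run_while[where \<sigma> = \<sigma>]) (auto simp: \<sigma>_def)
  moreover have "\<sigma> 0 = \<tau>" using assms by (auto simp: \<sigma>_def fun_eq_iff)
  ultimately show ?thesis using assms by (auto elim!: run_mono simp: \<sigma>_def subtract_def)
qed

lemma counter_computable_diff:
  assumes "counter_computable F" "counter_computable G"
  shows "counter_computable (\<lambda>x \<rho>. F x \<rho> - G x \<rho>)"
  using assms
proof (rule counter_computable_combine[where cmb = subtract])
  show "run (subtract i j) \<tau> (6 * n + 1) (\<tau>(i := counter 0, j := counter (m - n)))"
    if "\<tau> i = counter n" "\<tau> j = counter m" "i \<noteq> j" for \<tau> i j m n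
    by (rule run_subtract[OF that])
qed (auto simp: subtract_def)

lemma counter_computable_sum:
  assumes "counter_computable F" "counter_computable G"
  shows "counter_computable (\<lambda>x \<rho>. \<Sum>i < F x \<rho>. G x (case_nat i \<rho>))"
proof -
  obtain w1 p1 where w1: "1 \<le> w1"
    and F: "\<And>loc r. (\<forall>j. 1 \<le> loc j \<and> loc j < r) \<Longrightarrow> \<exists>c. counter_program F p1 w1 loc r c"
    using assms(1) unfolding counter_computable_def by blast
  obtain w2 p2 where w2: "1 \<le> w2"
    and G: "\<And>loc r. (\<forall>j. 1 \<le> loc j \<and> loc j < r) \<Longrightarrow> \<exists>c. counter_program G p2 w2 loc r c"
    using assms(2) unfolding counter_computable_def by blast
  define H where "H = (\<lambda>x \<rho>. \<Sum>i < F x \<rho>. G x (case_nat i \<rho>))"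
  \<comment> \<open>The index stays below the number of terms, so \<open>m + poly p1 m\<close>
    bounds all variables of the summand; its polynomial is composed with this bound.\<close>
  define b where "b = pcompose p2 ([:0, 1:] + p1)"
  define q where "q = p1 + (p1 * ([:6:] * b + [:8:]) + [:1:]) + ([:3:] * p1 + [:1:]) + ([:6:] * (p1 * b) + [:1:]) + [:3:]"
  define w where "w = w1 + w2 + 3"
  have "\<exists>c. counter_program H q w loc r c"
    if loc: "\<forall>j. 1 \<le> loc j \<and> loc j < r" for loc r
  proof -
    obtain c1 where c1: "counter_program F p1 w1 loc r c1" using F[OF loc] by blast
    \<comment> \<open>Tape r counts the terms that remain, \<open>r + 1\<close> holds the summation
      index, \<open>r + 2\<close> the partial sum, and the summand is computed from tape
      \<open>r + 3\<close> on.\<close>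
    obtain c2 where c2: "counter_program G p2 w2 (case_nat (r + 1) loc) (r + 3) c2"
    proof -
      have "\<forall>j. 1 \<le> case_nat (r + 1) loc j \<and> case_nat (r + 1) loc j < r + 3"
        using loc by (auto split: nat.split simp: less_SucI numeral_3_eq_3)
      then show ?thesis using G that by blast
    qed
    have locr: "loc j \<noteq> r" "loc j \<noteq> Suc r" "loc j \<noteq> r + 2" "0 < r" for j
      using loc by (auto simp: nat_neq_iff less_SucI dest: spec[of _ j])
    define S where "S = Seq (Dec r) (Seq c2 (Seq (transfer (r + 3) (r + 2)) (Inc (r + 1))))"
    define c where "c = Seq c1 (Seq (WhileNe r 1 S) (Seq (clear (r + 1)) (transfer (r + 2) r)))"
    have "counter_program H q w loc r c"
    proof (rule counter_programI)
      show "tapes_below (r + w) c"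
        using c1 c2 w2 by (auto simp: c_def S_def w_def transfer_def clear_def counter_program_def
            intro: tapes_below_mono)
    next
      fix x \<rho> \<tau> m
      assume 0: "\<tau> 0 = input_tape x" and env: "\<And>j. \<tau> (loc j) = counter (\<rho> j)"
        and z: "\<And>i. r \<le> i \<Longrightarrow> i < r + w \<Longrightarrow> \<tau> i = counter 0"
        and m: "length x \<le> m" "\<And>j. \<rho> j \<le> m"
      define n where "n = F x \<rho>"
      define g where "g k = G x (case_nat k \<rho>)" for k
      have n: "n \<le> poly p1 m" and R1: "run c1 \<tau> (poly p1 m) (\<tau>(r := counter n))"
        using counter_programD[OF c1, of \<tau> x \<rho> m] 0 env z m by (auto simp: n_def w_def)
      define m' where "m' = m + poly p1 m"
      have bm: "poly b m = poly p2 m'" by (simp add: b_def m'_def poly_pcompose)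
      define \<sigma> where "\<sigma> k = \<tau>(r := counter (n - k), r + 1 := counter k, r + 2 := counter (\<Sum>i<k. g i))" for k
      have body: "g k \<le> poly b m \<and> run S (\<sigma> k) (6 * poly b m + 6) (\<sigma> (Suc k))" if k: "k < n" for k
      proof -
        let ?t = "(\<sigma> k)(r := counter (n - Suc k))"
        have S1: "run (Dec r) (\<sigma> k) 1 ?t"
          using that by (intro run_dec) (auto simp: \<sigma>_def Suc_diff_Suc)
        have km: "case_nat k \<rho> j \<le> m'" for j
          using m k n by (auto simp: m'_def split: nat.split intro: trans_le_add1 less_imp_le)
        have e: "?t (case_nat (r + 1) loc j) = counter (case_nat k \<rho> j)" for j
          using env locr by (auto simp: \<sigma>_def split: nat.split)
        have "g k \<le> poly p2 m' \<and> run c2 ?t (poly p2 m') (?t(r + 3 := counter (g k)))"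
          unfolding g_def
          using counter_programD[where \<tau> = ?t and \<rho> = "case_nat k \<rho>" and m = m', OF c2 _ e _ _ km, of x] 0 locr z m by (auto simp: \<sigma>_def w_def m'_def)
        then have gk: "g k \<le> poly b m" and S2: "run c2 ?t (poly b m) (?t(r + 3 := counter (g k)))"
          using bm by auto
        have "run (transfer (r + 3) (r + 2)) (?t(r + 3 := counter (g k))) (5 * g k + 1)
           (?t(r + 3 := counter (g k), r + 3 := counter 0, r + 2 := counter ((\<Sum>i<k. g i) + g k)))"
          by (intro run_transfer) (auto simp: \<sigma>_def)
        moreover have "?t(r + 3 := counter (g k), r + 3 := counter 0, r + 2 := counter ((\<Sum>i<k. g i) + g k)) =
            ?t(r + 2 := counter (\<Sum>i<Suc k. g i))"
          using z w2 by (auto simp: \<sigma>_def fun_eq_iff w_def)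
        ultimately have S3: "run (transfer (r + 3) (r + 2)) (?t(r + 3 := counter (g k))) (5 * g k + 1)
           (?t(r + 2 := counter (\<Sum>i<Suc k. g i)))" by simp
        have "\<sigma> (Suc k) = (?t(r + 2 := counter (\<Sum>i<Suc k. g i)))(r + 1 := counter (Suc k))"
          by (auto simp: \<sigma>_def fun_eq_iff)
        then have S4: "run (Inc (r + 1)) (?t(r + 2 := counter (\<Sum>i<Suc k. g i))) 1 (\<sigma> (Suc k))"
          by (simp only:) (rule run_inc, auto simp: \<sigma>_def)
        have "run S (\<sigma> k) (1 + (poly b m + (5 * g k + 1 + 1 + 1) + 1) + 1) (\<sigma> (Suc k))"
          unfolding S_def by (intro run_seq[OF S1] run_seq[OF S2] run_seq[OF S3] S4)
        then show ?thesis using gk by (auto elim!: run_mono)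
      qed
      have "run (WhileNe r 1 S) (\<sigma> 0) (n * (6 * poly b m + 6 + 2) + 1) (\<sigma> n)"
        using body by (intro run_while[where \<sigma> = \<sigma>]) (auto simp: \<sigma>_def)
      moreover have "\<sigma> 0 = \<tau>(r := counter n)"
        using z w2 by (auto simp: \<sigma>_def fun_eq_iff w_def)
      ultimately have R2: "run (WhileNe r 1 S) (\<tau>(r := counter n)) (poly p1 m * (6 * poly b m + 8) + 1) (\<sigma> n)"
        using n by (auto elim!: run_mono intro!: mult_mono)
      have R3: "run (clear (r + 1)) (\<sigma> n) (3 * n + 1) ((\<sigma> n)(r + 1 := counter 0))"
        by (intro run_clear) (auto simp: \<sigma>_def)
      have h: "H x \<rho> = (\<Sum>i<n. g i)" by (simp add: H_def n_def g_def)
      have "(\<Sum>i<n. g i) \<le> of_nat (card {..<n}) * poly b m"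
        using body by (intro sum_bounded_above) auto
      also have "\<dots> \<le> poly p1 m * poly b m" using n by simp
      finally have hb: "H x \<rho> \<le> poly p1 m * poly b m" by (simp add: h)
      have "run (transfer (r + 2) r) ((\<sigma> n)(r + 1 := counter 0)) (5 * H x \<rho> + 1)
          ((\<sigma> n)(r + 1 := counter 0, r + 2 := counter 0, r := counter (0 + H x \<rho>)))"
        by (intro run_transfer) (auto simp: \<sigma>_def h)
      moreover have "(\<sigma> n)(r + 1 := counter 0, r + 2 := counter 0, r := counter (0 + H x \<rho>)) =
          \<tau>(r := counter (H x \<rho>))"
        using z w2 by (auto simp: \<sigma>_def fun_eq_iff w_def)
      ultimately have R4: "run (transfer (r + 2) r) ((\<sigma> n)(r + 1 := counter 0)) (5 * H x \<rho> + 1)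
          (\<tau>(r := counter (H x \<rho>)))" by simp
      have "run c \<tau> (poly p1 m + (poly p1 m * (6 * poly b m + 8) + 1 + (3 * n + 1 + (5 * H x \<rho> + 1) + 1) + 1) + 1)
          (\<tau>(r := counter (H x \<rho>)))"
        unfolding c_def by (intro run_seq[OF R1] run_seq[OF R2] run_seq[OF R3] R4)
      moreover have "poly p1 m + (poly p1 m * (6 * poly b m + 8) + 1 + (3 * n + 1 + (5 * H x \<rho> + 1) + 1) + 1) + 1 \<le> poly q m"
        using n hb by (simp add: q_def algebra_simps)
      moreover have "H x \<rho> \<le> poly q m" using hb by (simp add: q_def)
      ultimately show "H x \<rho> \<le> poly q m \<and> (\<exists>n\<le>poly q m. run c \<tau> n (\<tau>(r := counter (H x \<rho>))))"
        by blast
    qed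
    then show ?thesis by blast
  qed
  then show ?thesis unfolding counter_computable_def H_def
    by (intro exI[of _ w] exI[of _ q]) (auto simp: w_def)
qed

text \<open>
  The environment lists the values of the variables in de Bruijn order: the summation index is
  variable \<open>0\<close> of the summand.
\<close>

inductive definable :: "(bool list \<Rightarrow> (nat \<Rightarrow> nat) \<Rightarrow> nat) \<Rightarrow> bool" where
  definable_var: "definable (\<lambda>x \<rho>. \<rho> v)"
| definable_one: "definable (\<lambda>x \<rho>. 1)"
| definable_length: "definable (\<lambda>x \<rho>. length x)"
| definable_bit: "definable F \<Longrightarrow> definable (\<lambda>x \<rho>. of_bool (F x \<rho> < length x \<and> x ! F x \<rho>))"
| definable_add: "definable F \<Longrightarrow> definable G \<Longrightarrow> definable (\<lambda>x \<rho>. F x \<rho> + G x \<rho>)"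
| definable_diff: "definable F \<Longrightarrow> definable G \<Longrightarrow> definable (\<lambda>x \<rho>. F x \<rho> - G x \<rho>)"
| definable_sum_raw:
    "definable F \<Longrightarrow> definable G \<Longrightarrow> definable (\<lambda>x \<rho>. \<Sum>i < F x \<rho>. G x (case_nat i \<rho>))"

lemma definable_counter_computable: "definable F \<Longrightarrow> counter_computable F"
  by (induction rule: definable.induct)
     (rule counter_computable_var counter_computable_one counter_computable_length
       counter_computable_bit counter_computable_add counter_computable_diff counter_computable_sum;
       assumption?)+

section \<open>Definable functions\<close>

text \<open>Work tapes are blank initially, whereas a counter of value 0 has a 1 on cell 0. This
  symbol is the one that represents \<open>False\<close>.\<close>

fun mark_tapes :: "nat \<Rightarrow> com" where
  "mark_tapes 0 = Skip"
| "mark_tapes (Suc n) = Seq (mark_tapes n) (Act (Suc n) (Some False) Move_None)"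

lemma run_mark_tapes:
  "(\<And>i. 1 \<le> i \<Longrightarrow> i \<le> n \<Longrightarrow> \<tau> i = blank_tape) \<Longrightarrow>
   run (mark_tapes n) \<tau> (2 * n) (\<lambda>i. if 1 \<le> i \<and> i \<le> n then counter 0 else \<tau> i)"
proof (induction n)
  case 0
  have "(\<lambda>i. if 1 \<le> i \<and> i \<le> 0 then counter 0 else \<tau> i) = \<tau>" by auto
  then show ?case by (simp add: run_skip)
next
  case (Suc n)
  let ?s = "\<lambda>i. if 1 \<le> i \<and> i \<le> n then counter 0 else \<tau> i"
  have 1: "run (mark_tapes n) \<tau> (2 * n) ?s" using Suc by simp
  have 2: "?s (Suc n) = blank_tape" using Suc.prems[of "Suc n"] by simp
  have "run (Act (Suc n) (Some False) Move_None) ?s 1 (?s(Suc n := counter 0))"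
    using run_act[of "Suc n" "Some False" Move_None ?s] 2
    by (simp add: write_symbol_def bit_symbol_def tape_act_def blank_tape_def counter_def)
  moreover have "?s(Suc n := counter 0) = (\<lambda>i. if 1 \<le> i \<and> i \<le> Suc n then counter 0 else \<tau> i)"
    by (auto simp: fun_eq_iff)
  ultimately show ?case using run_seq[OF 1] by fastforce
qed

lemma mark_tapes_below: "n < k \<Longrightarrow> tapes_below k (mark_tapes n)"
  by (induction n) auto

definition output_tape :: "(nat \<Rightarrow> bool) \<Rightarrow> nat \<Rightarrow> tape" where
  "output_tape b k = (\<lambda>i. if 0 \<le> i \<and> i < int k then bit_symbol (b (nat i)) else 0, int k)"

lemma run_output:
  assumes "\<tau> i = output_tape b k"
  shows "run (Act i (Some (b k)) Move_Right) \<tau> 1 (\<tau>(i := output_tape b (Suc k)))"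
proof -
  have "tape_act (bit_symbol (b k), Move_Right) (output_tape b k) = output_tape b (Suc k)"
    by (auto simp: tape_act_def output_tape_def fun_eq_iff)
  then show ?thesis using run_act[of i "Some (b k)" Move_Right \<tau>] assms by (simp add: write_symbol_def)
qed

text \<open>The output is written by a loop over its positions, so it suffices that its length and
  its individual bits are definable.\<close>

lemma polytime_computable_definable:
  assumes "definable L" "definable E"
  shows "polytime_computable (\<lambda>x. map (\<lambda>i. E x (case_nat i (\<lambda>_. 0)) \<noteq> 0) [0..<L x (\<lambda>_. 0)])"
proof -
  obtain w1 p1 where w1: "1 \<le> w1"
    and L: "\<And>loc r. (\<forall>j. 1 \<le> loc j \<and> loc j < r) \<Longrightarrow> \<exists>c. counter_program L p1 w1 loc r c"
    using definable_counter_computable[OF assms(1)] unfolding counter_computable_def by blast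
  obtain w2 p2 where w2: "1 \<le> w2"
    and E: "\<And>loc r. (\<forall>j. 1 \<le> loc j \<and> loc j < r) \<Longrightarrow> \<exists>c. counter_program E p2 w2 loc r c"
    using definable_counter_computable[OF assms(2)] unfolding counter_computable_def by blast
  \<comment> \<open>Tape 1 remains 0 and serves all variables that have no value of their own. In
    the output loop, tape 2 counts the bits still to be written, tape 3 holds the current position,
    and the bit is computed from tape 4 on. The output tape \<open>ot\<close> comes last.\<close>
  obtain c1 where c1: "counter_program L p1 w1 (\<lambda>_. 1) 2 c1" using L[of "\<lambda>_. 1" 2] by auto
  have "\<forall>j. 1 \<le> case_nat 3 (\<lambda>_. 1 :: nat) j \<and> case_nat 3 (\<lambda>_. 1) j < (4 :: nat)" by (auto split: nat.split)
  then obtain c2 where c2: "counter_program E p2 w2 (case_nat 3 (\<lambda>_. 1)) 4 c2" using E by blast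
  define ot where "ot = 4 + w1 + w2"
  define I where "I = IfNe 4 1 (Seq (clear 4) (Act ot (Some True) Move_Right)) (Act ot (Some False) Move_Right)"
  define S where "S = Seq (Dec 2) (Seq c2 (Seq I (Inc 3)))"
  define c where "c = Seq (mark_tapes (ot - 1)) (Seq c1 (WhileNe 2 1 S))"
  define b where "b = pcompose p2 ([:0, 1:] + p1)"
  define q where "q = [:2 * (ot - 1):] + (p1 + (p1 * ([:4:] * b + [:11:]) + [:1:]) + [:1:]) + [:1:]"
  show ?thesis
  proof (rule polytime_computable_by_run[of "Suc ot" c q])
    show "tapes_below (Suc ot) c"
      using c1 c2 w1 w2 by (auto simp: c_def S_def I_def clear_def counter_program_def ot_def
          intro!: mark_tapes_below elim!: tapes_below_mono)
    show "1 \<le> Suc ot" by simp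
    fix x :: "bool list"
    define m where "m = length x"
    define n where "n = L x (\<lambda>_. 0)"
    define e where "e i = E x (case_nat i (\<lambda>_. 0))" for i
    define \<tau> where "\<tau> i = (if i = 0 then input_tape x else blank_tape)" for i :: nat
    define \<tau>1 where "\<tau>1 i = (if 1 \<le> i \<and> i \<le> ot - 1 then counter 0 else \<tau> i)" for i
    have R0: "run (mark_tapes (ot - 1)) \<tau> (2 * (ot - 1)) \<tau>1"
      unfolding \<tau>1_def by (rule run_mark_tapes) (auto simp: \<tau>_def)
    have t1: "\<tau>1 0 = input_tape x" "\<tau>1 ot = output_tape (\<lambda>i. e i \<noteq> 0) 0"
      and tz: "\<And>i. 1 \<le> i \<Longrightarrow> i < ot \<Longrightarrow> \<tau>1 i = counter 0"
      by (auto simp: \<tau>1_def \<tau>_def ot_def output_tape_def blank_tape_def)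
    have n: "n \<le> poly p1 m" and R1: "run c1 \<tau>1 (poly p1 m) (\<tau>1(2 := counter n))"
      using counter_programD[OF c1, of \<tau>1 x "\<lambda>_. 0" m] t1 tz by (auto simp: n_def ot_def m_def)
    define m' where "m' = m + poly p1 m"
    have bm: "poly b m = poly p2 m'" by (simp add: b_def m'_def poly_pcompose)
    define \<sigma> where "\<sigma> k = \<tau>1(2 := counter (n - k), 3 := counter k, ot := output_tape (\<lambda>i. e i \<noteq> 0) k)" for k
    have oto: "ot > 4" using w1 by (simp add: ot_def)
    have body: "run S (\<sigma> k) (4 * poly b m + 9) (\<sigma> (Suc k))" if k: "k < n" for k
    proof -
      let ?t = "(\<sigma> k)(2 := counter (n - Suc k))"
      have S1: "run (Dec 2) (\<sigma> k) 1 ?t"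
        using that oto by (intro run_dec) (auto simp: \<sigma>_def Suc_diff_Suc)
      have km: "case_nat k (\<lambda>_. 0) j \<le> m'" for j
        using k n by (auto simp: m'_def split: nat.split intro: trans_le_add1 less_imp_le)
      have env: "?t (case_nat 3 (\<lambda>_. 1) j) = counter (case_nat k (\<lambda>_. 0) j)" for j
        using tz oto by (auto simp: \<sigma>_def split: nat.split)
      have "e k \<le> poly p2 m' \<and> run c2 ?t (poly p2 m') (?t(4 := counter (e k)))"
        unfolding e_def
        using counter_programD[where \<tau> = ?t and \<rho> = "case_nat k (\<lambda>_. 0)" and m = m', OF c2 _ env _ _ km, of x] t1 tz oto by (auto simp: \<sigma>_def ot_def m'_def m_def)
      then have ek: "e k \<le> poly b m" and S2: "run c2 ?t (poly b m) (?t(4 := counter (e k)))"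
        using bm by auto
      have t4: "?t(4 := counter 0) = ?t" using tz oto by (auto simp: \<sigma>_def fun_eq_iff)
      have out: "run (Act ot (Some (e k \<noteq> 0)) Move_Right) ?t 1 (?t(ot := output_tape (\<lambda>i. e i \<noteq> 0) (Suc k)))"
        using run_output[of ?t ot "\<lambda>i. e i \<noteq> 0" k] oto by (simp add: \<sigma>_def)
      have S3: "run I (?t(4 := counter (e k))) (3 * e k + 1 + 1 + 1 + 1) (?t(ot := output_tape (\<lambda>i. e i \<noteq> 0) (Suc k)))"
      proof (cases "e k = 0")
        case True
        moreover have "\<sigma> k 4 = counter 0" using tz oto by (auto simp: \<sigma>_def)
        ultimately show ?thesis unfolding I_def using out t4
          by (intro run_if_false) (auto elim!: run_mono)
      next
        case False
        have "run (clear 4) (?t(4 := counter (e k))) (3 * e k + 1) ?t"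
          using run_clear[of "?t(4 := counter (e k))" 4 "e k"] t4 by simp
        then show ?thesis unfolding I_def using out False
          by (intro run_if_true run_seq[of _ _ _ ?t]) auto
      qed
      have "\<sigma> (Suc k) = (?t(ot := output_tape (\<lambda>i. e i \<noteq> 0) (Suc k)))(3 := counter (Suc k))"
        using oto by (auto simp: \<sigma>_def fun_eq_iff)
      then have S4: "run (Inc 3) (?t(ot := output_tape (\<lambda>i. e i \<noteq> 0) (Suc k))) 1 (\<sigma> (Suc k))"
        using oto by (simp only:) (rule run_inc, auto simp: \<sigma>_def)
      have "run S (\<sigma> k) (1 + (poly b m + (3 * e k + 1 + 1 + 1 + 1 + 1 + 1) + 1) + 1) (\<sigma> (Suc k))"
        unfolding S_def by (intro run_seq[OF S1] run_seq[OF S2] run_seq[OF S3] S4)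
      then show ?thesis using ek by (auto elim!: run_mono)
    qed
    have "run (WhileNe 2 1 S) (\<sigma> 0) (n * (4 * poly b m + 9 + 2) + 1) (\<sigma> n)"
      using body oto by (intro run_while[where \<sigma> = \<sigma>]) (auto simp: \<sigma>_def)
    moreover have "\<sigma> 0 = \<tau>1(2 := counter n)"
      using tz t1 oto by (auto simp: \<sigma>_def fun_eq_iff)
    ultimately have R2: "run (WhileNe 2 1 S) (\<tau>1(2 := counter n)) (poly p1 m * (4 * poly b m + 11) + 1) (\<sigma> n)"
      using n by (auto elim!: run_mono intro!: mult_mono)
    have "run c \<tau> (2 * (ot - 1) + (poly p1 m + (poly p1 m * (4 * poly b m + 11) + 1) + 1) + 1) (\<sigma> n)"
      unfolding c_def by (intro run_seq[OF R0] run_seq[OF R1] R2)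
    then have "run c \<tau> (poly q (length x)) (\<sigma> n)" by (simp add: q_def m_def algebra_simps)
    moreover have "tape_holds (\<sigma> n ot) (map (\<lambda>i. e i \<noteq> 0) [0..<n])"
      by (simp add: \<sigma>_def tape_holds_def output_tape_def)
    ultimately show "\<exists>\<tau>'. run c (\<lambda>i. if i = 0 then input_tape x else blank_tape) (poly q (length x)) \<tau>' \<and>
        tape_holds (\<tau>' (Suc ot - 1)) (map (\<lambda>i. E x (case_nat i (\<lambda>_. 0)) \<noteq> 0) [0..<L x (\<lambda>_. 0)])"
      unfolding \<tau>_def n_def e_def by auto
  qed
qed

section \<open>Closure properties of definable functions and predicates\<close>

lemma definable_rename: "definable F \<Longrightarrow> definable (\<lambda>x \<rho>. F x (\<lambda>j. \<rho> (f j)))"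
proof (induction arbitrary: f rule: definable.induct)
  case (definable_sum_raw F G)
  have eq: "case_nat i (\<lambda>j. \<rho> (f j)) = (\<lambda>j. case_nat i \<rho> (case_nat 0 (\<lambda>j. Suc (f j)) j))" for i \<rho>
    by (auto simp: fun_eq_iff split: nat.split)
  show ?case
    using definable.definable_sum_raw[OF definable_sum_raw.IH(1)[of f]
        definable_sum_raw.IH(2)[of "case_nat 0 (\<lambda>j. Suc (f j))"]] by (simp only: eq[symmetric])
qed (auto intro: definable.intros simp del: One_nat_def)

lemma definable_shift: "definable F \<Longrightarrow> definable (\<lambda>x \<rho>. F x (\<lambda>j. \<rho> (Suc j)))"
  by (rule definable_rename)

text \<open>With the index as an explicit argument of \<open>B\<close>, sums over ordinary bound
  variables are recognised by higher-order unification, and no environment has to be given by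
  hand.\<close>

lemma definable_sum:
  assumes "definable A" "definable (\<lambda>x \<rho>. B x (\<lambda>j. \<rho> (Suc j)) (\<rho> 0))"
  shows "definable (\<lambda>x \<rho>. \<Sum>i < A x \<rho>. B x \<rho> i)"
  using definable_sum_raw[OF assms] by simp

lemma definable_const: "definable (\<lambda>x \<rho>. c)"
proof (induction c)
  case 0
  show ?case using definable_diff[OF definable_one definable_one] by simp
next
  case (Suc c)
  show ?case using definable_add[OF Suc definable_one] by simp
qed

lemma definable_Suc: "definable A \<Longrightarrow> definable (\<lambda>x \<rho>. Suc (A x \<rho>))"
  using definable_add[OF _ definable_one] by simp

lemma definable_mult:
  assumes "definable A" "definable B"
  shows "definable (\<lambda>x \<rho>. A x \<rho> * B x \<rho>)"
  using definable_sum[OF assms(1), of "\<lambda>x \<rho> i. B x \<rho>"] definable_shift[OF assms(2)] by simp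

definition definable_pred :: "(bool list \<Rightarrow> (nat \<Rightarrow> nat) \<Rightarrow> bool) \<Rightarrow> bool" where
  "definable_pred P \<longleftrightarrow> definable (\<lambda>x \<rho>. of_bool (P x \<rho>))"

lemma definable_of_bool: "definable_pred P \<Longrightarrow> definable (\<lambda>x \<rho>. of_bool (P x \<rho>))"
  by (simp add: definable_pred_def)

lemma definable_pred_const: "definable_pred (\<lambda>x \<rho>. b)"
  by (simp add: definable_pred_def definable_const)

lemma definable_pred_bit:
  "definable A \<Longrightarrow> definable_pred (\<lambda>x \<rho>. A x \<rho> < length x \<and> x ! A x \<rho>)"
  unfolding definable_pred_def by (rule definable_bit)

lemma definable_pred_not:
  assumes "definable_pred P"
  shows "definable_pred (\<lambda>x \<rho>. \<not> P x \<rho>)"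
proof -
  have "1 - of_bool p = (of_bool (\<not> p) :: nat)" for p by simp
  then show ?thesis
    using definable_diff[OF definable_one assms[unfolded definable_pred_def]]
    by (simp only: definable_pred_def)
qed

lemma definable_pred_conj:
  "definable_pred P \<Longrightarrow> definable_pred Q \<Longrightarrow> definable_pred (\<lambda>x \<rho>. P x \<rho> \<and> Q x \<rho>)"
  unfolding definable_pred_def of_bool_conj by (rule definable_mult)

lemma definable_pred_disj:
  assumes "definable_pred P" "definable_pred Q"
  shows "definable_pred (\<lambda>x \<rho>. P x \<rho> \<or> Q x \<rho>)"
  using definable_pred_not[OF definable_pred_conj[OF assms[THEN definable_pred_not]]] by simp

lemma definable_pred_imp:
  assumes "definable_pred P" "definable_pred Q"
  shows "definable_pred (\<lambda>x \<rho>. P x \<rho> \<longrightarrow> Q x \<rho>)"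
  using definable_pred_disj[OF definable_pred_not[OF assms(1)] assms(2)] by (simp only: imp_conv_disj)

lemma definable_pred_le:
  assumes "definable A" "definable B"
  shows "definable_pred (\<lambda>x \<rho>. A x \<rho> \<le> B x \<rho>)"
proof -
  have "1 - (a - b) = of_bool (a \<le> b)" for a b :: nat by auto
  then show ?thesis
    unfolding definable_pred_def using definable_diff[OF definable_one definable_diff[OF assms]] by simp
qed

lemma definable_pred_less:
  assumes "definable A" "definable B"
  shows "definable_pred (\<lambda>x \<rho>. A x \<rho> < B x \<rho>)"
  using definable_pred_not[OF definable_pred_le[OF assms(2,1)]] by (simp add: not_le)

lemma definable_pred_eq:
  assumes "definable A" "definable B"
  shows "definable_pred (\<lambda>x \<rho>. A x \<rho> = B x \<rho>)"
  using definable_pred_conj[OF definable_pred_le[OF assms] definable_pred_le[OF assms(2,1)]]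
  by (simp only: order_eq_iff)

lemma definable_pred_iff:
  assumes "definable_pred P" "definable_pred Q"
  shows "definable_pred (\<lambda>x \<rho>. P x \<rho> \<longleftrightarrow> Q x \<rho>)"
  using definable_pred_conj[OF definable_pred_imp[OF assms] definable_pred_imp[OF assms(2,1)]]
  by (simp only: iff_conv_conj_imp)

lemma definable_pred_ex:
  assumes "definable A" "definable_pred (\<lambda>x \<rho>. P x (\<lambda>j. \<rho> (Suc j)) (\<rho> 0))"
  shows "definable_pred (\<lambda>x \<rho>. \<exists>i < A x \<rho>. P x \<rho> i)"
proof -
  have "definable_pred (\<lambda>x \<rho>. (1 :: nat) \<le> (\<Sum>i < A x \<rho>. of_bool (P x \<rho> i)))"
    using assms by (intro definable_pred_le definable_const definable_sum definable_of_bool)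
  moreover have "(1 :: nat) \<le> (\<Sum>i < a. of_bool (p i)) \<longleftrightarrow> (\<exists>i < a. p i)" for a and p :: "nat \<Rightarrow> bool"
    by (simp add: Suc_le_eq) (auto simp: sum_eq_0_iff simp flip: neq0_conv)
  ultimately show ?thesis by simp
qed

lemma definable_pred_all:
  assumes "definable A" "definable_pred (\<lambda>x \<rho>. P x (\<lambda>j. \<rho> (Suc j)) (\<rho> 0))"
  shows "definable_pred (\<lambda>x \<rho>. \<forall>i < A x \<rho>. P x \<rho> i)"
  using definable_pred_not[OF definable_pred_ex[OF assms(1), of "\<lambda>x \<rho> i. \<not> P x \<rho> i"]]
    definable_pred_not[OF assms(2)] by simp

lemma definable_if:
  assumes "definable_pred P" "definable A" "definable B"
  shows "definable (\<lambda>x \<rho>. if P x \<rho> then A x \<rho> else B x \<rho>)"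
proof -
  have "definable (\<lambda>x \<rho>. of_bool (P x \<rho>) * A x \<rho> + of_bool (\<not> P x \<rho>) * B x \<rho>)"
    using assms by (intro definable_add definable_mult definable_of_bool definable_pred_not)
  moreover have "of_bool p * a + of_bool (\<not> p) * b = (if p then a else b)" for p and a b :: nat by simp
  ultimately show ?thesis by simp
qed

lemma definable_pred_if:
  assumes "definable_pred P" "definable_pred A" "definable_pred B"
  shows "definable_pred (\<lambda>x \<rho>. if P x \<rho> then A x \<rho> else B x \<rho>)"
  using definable_if[OF assms[unfolded definable_pred_def, folded definable_pred_def[of P]]]
  by (simp add: definable_pred_def if_distrib)

text \<open>The quotient counts the positive multiples of the divisor that do not exceed the
  dividend.\<close>

lemma definable_div:
  assumes "definable A" "definable B"
  shows "definable (\<lambda>x \<rho>. A x \<rho> div B x \<rho>)"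
proof -
  have "definable (\<lambda>x \<rho>. if B x \<rho> = 0 then 0 else \<Sum>i < A x \<rho>. of_bool (Suc i * B x \<rho> \<le> A x \<rho>))"
    using assms by (intro definable_if definable_const definable_sum definable_of_bool definable_pred_eq
        definable_pred_le definable_mult definable_Suc definable_var definable_shift)
  moreover have "(if b = 0 then 0 else \<Sum>i < a. of_bool (Suc i * b \<le> a)) = a div b" for a b :: nat
  proof (cases "b = 0")
    case False
    then have "Suc i * b \<le> a \<longleftrightarrow> i < a div b" for i
      by (metis Suc_le_eq less_eq_div_iff_mult_less_eq neq0_conv)
    then have "(\<Sum>i < a. of_bool (Suc i * b \<le> a)) = card ({..<a} \<inter> {i. i < a div b})" by simp
    also have "{..<a} \<inter> {i. i < a div b} = {..<a div b}" by (auto intro: less_le_trans)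
    finally show ?thesis using False by simp
  qed simp
  ultimately show ?thesis by simp
qed

lemma definable_mod:
  assumes "definable A" "definable B"
  shows "definable (\<lambda>x \<rho>. A x \<rho> mod B x \<rho>)"
  using definable_diff[OF assms(1) definable_mult[OF assms(2) definable_div[OF assms]]]
  by (simp add: minus_mult_div_eq_mod)

lemma definable_power: "definable A \<Longrightarrow> definable (\<lambda>x \<rho>. A x \<rho> ^ n)"
  by (induction n) (auto intro: definable_const definable_mult)

lemma definable_poly: "definable A \<Longrightarrow> definable (\<lambda>x \<rho>. poly p (A x \<rho>))"
  by (induction p) (auto intro: definable_const definable_add definable_mult)

text \<open>A function of finite support is a finite sum of indicator terms. The transition function
  of a fixed machine enters in this way.\<close>

lemma definable_table:
  assumes "definable A" "\<And>a. n \<le> a \<Longrightarrow> G a = 0"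
  shows "definable (\<lambda>x \<rho>. G (A x \<rho>))"
proof -
  have "definable (\<lambda>x \<rho>. \<Sum>a < n. of_bool (A x \<rho> = a) * G a)"
    by (induction n) (auto intro!: assms(1) definable_const definable_add definable_mult
        definable_of_bool definable_pred_eq)
  moreover have "(\<Sum>a < n. of_bool (c = a) * G a) = G c" for c
  proof (cases "c < n")
    case True
    then show ?thesis by (simp add: sum.delta' if_distrib cong: if_cong)
  qed (use assms(2)[of c] in auto)
  ultimately show ?thesis by simp
qed

lemma definable_table2:
  assumes "definable A" "definable B" "\<And>a b. n \<le> a \<or> m \<le> b \<Longrightarrow> G a b = 0"
  shows "definable (\<lambda>x \<rho>. G (A x \<rho>) (B x \<rho>))"
proof -
  have "definable (\<lambda>x \<rho>. \<Sum>b < m. of_bool (B x \<rho> = b) * G (A x \<rho>) b)"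
  proof (induction m)
    case (Suc m)
    have "definable (\<lambda>x \<rho>. G (A x \<rho>) m)"
      using assms(3) by (intro definable_table[OF assms(1), of n]) auto
    then show ?case using Suc
      by (auto intro!: assms(2) definable_const definable_add definable_mult definable_of_bool definable_pred_eq)
  qed (simp add: definable_const)
  moreover have "(\<Sum>b < m. of_bool (c = b) * G a b) = G a c" for a c
  proof (cases "c < m")
    case True
    then show ?thesis by (simp add: sum.delta' if_distrib cong: if_cong)
  qed (use assms(3)[of a c] in auto)
  ultimately show ?thesis by simp
qed

lemmas definable_intros =
  definable_var definable_length definable_Suc definable_add definable_diff definable_mult
  definable_sum definable_if definable_div definable_mod definable_power definable_poly
  definable_of_bool definable_const definable_pred_bit definable_pred_not definable_pred_conj
  definable_pred_disj definable_pred_imp definable_pred_le definable_pred_less definable_pred_eq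
  definable_pred_iff definable_pred_ex definable_pred_all definable_pred_if definable_pred_const

section \<open>Inversions\<close>

definition invert_rel :: "'a set \<Rightarrow> 'a rel \<Rightarrow> 'a rel" where
  "invert_rel X R = (R - X \<times> X) \<union> (R \<inter> X \<times> X)\<inverse>"

lemma in_invert_rel:
  "(u, v) \<in> invert_rel X R \<longleftrightarrow> (if u \<in> X \<and> v \<in> X then (v, u) \<in> R else (u, v) \<in> R)"
  by (auto simp: invert_rel_def)

lemma parcs_invert: "parcs (invert X D) = invert_rel X (parcs D)"
  by (simp add: invert_def invert_rel_def)

lemma pverts_invert: "pverts (invert X D) = pverts D"
  by (simp add: invert_def)

lemma invert_rel_mono: "R \<subseteq> S \<Longrightarrow> invert_rel X R \<subseteq> invert_rel X S"
  by (auto simp: invert_rel_def)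

section \<open>Acyclicity by potentials and homomorphisms\<close>

lemma acyclic_rank2:
  fixes f :: "'a \<Rightarrow> 'b :: order" and g :: "'a \<Rightarrow> 'c :: order"
  assumes "\<And>u v. (u, v) \<in> R \<Longrightarrow> f u < f v \<or> f u = f v \<and> g u < g v"
  shows "acyclic R"
proof -
  have "f u < f v \<or> f u = f v \<and> g u < g v" if "(u, v) \<in> R\<^sup>+" for u v
    using that by (induction rule: trancl_induct) (auto dest!: assms intro: less_trans)
  then show ?thesis unfolding acyclic_def by fastforce
qed

lemma acyclic_rank:
  fixes f :: "'a \<Rightarrow> 'b :: order"
  assumes "\<And>u v. (u, v) \<in> R \<Longrightarrow> f u < f v"
  shows "acyclic R"
  using acyclic_rank2[of R f f] assms by blast

lemma acyclic_hom:
  assumes "acyclic S" "\<And>a b. (a, b) \<in> R \<Longrightarrow> (f a, f b) \<in> S"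
  shows "acyclic R"
proof -
  have "(f a, f b) \<in> S\<^sup>+" if "(a, b) \<in> R\<^sup>+" for a b
    using that by (induction rule: trancl_induct) (auto dest: assms(2) intro: trancl_into_trancl)
  then show ?thesis using assms(1) unfolding acyclic_def by blast
qed

text \<open>Inversions can be pulled back along homomorphisms, even along those that identify
  vertices. This is used to renumber the vertices.\<close>

lemma acyclic_invert_hom:
  assumes "acyclic (invert_rel X S)" "\<And>a b. (a, b) \<in> R \<Longrightarrow> (f a, f b) \<in> S"
  shows "acyclic (invert_rel (f -` X) R)"
  by (rule acyclic_hom[OF assms(1), of _ f]) (auto simp: in_invert_rel assms(2) split: if_splits)

text \<open>The number of proper ancestors is a potential, which provides a converse to
  \<open>acyclic_rank\<close>.\<close>

lemma finite_acyclic_rank: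
  assumes "finite R" "acyclic R" "(u, v) \<in> R"
  shows "card {w. (w, u) \<in> R\<^sup>+} < card {w. (w, v) \<in> R\<^sup>+}"
proof (rule psubset_card_mono)
  have "{w. (w, v) \<in> R\<^sup>+} \<subseteq> fst ` (R\<^sup>+)" by force
  then show "finite {w. (w, v) \<in> R\<^sup>+}" using assms(1) by (simp add: finite_subset)
  show "{w. (w, u) \<in> R\<^sup>+} \<subset> {w. (w, v) \<in> R\<^sup>+}"
    using assms(2,3) by (auto simp: acyclic_def intro: trancl_into_trancl)
qed

lemma acyclic_no_triangle:
  "acyclic S \<Longrightarrow> (a, b) \<in> S \<Longrightarrow> (b, c) \<in> S \<Longrightarrow> (c, a) \<in> S \<Longrightarrow> False"
  unfolding acyclic_def by (meson r_into_trancl trancl_into_trancl)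

text \<open>Inverting at most one vertex of a directed triangle changes none of its arcs, and
  inverting all three reverses the whole cycle.\<close>

lemma triangle_two_inverted:
  assumes "acyclic (invert_rel X R)" "(a, b) \<in> R" "(b, c) \<in> R" "(c, a) \<in> R"
  shows "a \<in> X \<and> b \<in> X \<and> c \<notin> X \<or> a \<in> X \<and> b \<notin> X \<and> c \<in> X \<or> a \<notin> X \<and> b \<in> X \<and> c \<in> X"
proof (rule ccontr)
  assume n: "\<not> ?thesis"
  consider "a \<in> X \<and> b \<in> X \<and> c \<in> X" | "\<not> (a \<in> X \<and> b \<in> X) \<and> \<not> (b \<in> X \<and> c \<in> X) \<and> \<not> (c \<in> X \<and> a \<in> X)"
    using n by blast
  then show False
  proof cases
    case 1
    then show False
      using acyclic_no_triangle[OF assms(1), of a c b] assms(2-4) by (simp add: in_invert_rel)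
  next
    case 2
    then show False
      using acyclic_no_triangle[OF assms(1), of a b c] assms(2-4) by (auto simp: in_invert_rel)
  qed
qed

section \<open>Inversion number at most one, and strong connectivity\<close>

lemma oriented_graph_iff:
  "oriented_graph D \<longleftrightarrow> finite (pverts D) \<and> parcs D \<subseteq> pverts D \<times> pverts D \<and>
     (\<forall>u v. (u, v) \<in> parcs D \<longrightarrow> (v, u) \<notin> parcs D)"
proof
  assume o: "oriented_graph D"
  then interpret pair_digraph D by (simp add: oriented_graph_def)
  show "finite (pverts D) \<and> parcs D \<subseteq> pverts D \<times> pverts D \<and>
     (\<forall>u v. (u, v) \<in> parcs D \<longrightarrow> (v, u) \<notin> parcs D)"
    using o in_arcsD1 in_arcsD2 by (auto simp: oriented_graph_def)
next
  assume a: "finite (pverts D) \<and> parcs D \<subseteq> pverts D \<times> pverts D \<and>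
     (\<forall>u v. (u, v) \<in> parcs D \<longrightarrow> (v, u) \<notin> parcs D)"
  moreover have "finite (parcs D)" using a finite_subset by blast
  moreover have "pair_digraph D"
  proof -
    have "(b, b) \<notin> parcs D" for b using a by blast
    then show ?thesis by unfold_locales (use a \<open>finite (parcs D)\<close> in auto)
  qed
  ultimately show "oriented_graph D" by (simp add: oriented_graph_def)
qed

text \<open>Inverting both ends of an arc reverses this arc alone, so arcs that point to smaller
  numbers can be corrected one at a time. Consequently the \<open>LEAST\<close> in
  \<open>inversion_number\<close> is attained.\<close>

lemma invert_pairs_acyclic:
  fixes D :: "nat pair_pre_digraph"
  assumes "finite (parcs D)" "parcs D \<subseteq> pverts D \<times> pverts D"
    "\<And>u v. (u, v) \<in> parcs D \<Longrightarrow> (v, u) \<notin> parcs D"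
  shows "\<exists>Xs. (\<forall>X \<in> set Xs. X \<subseteq> pverts D) \<and> acyclic (parcs (fold invert Xs D))"
  using assms
proof (induction "card {(u, v) \<in> parcs D. v \<le> u}" arbitrary: D rule: less_induct)
  case less
  show ?case
  proof (cases "{(u, v) \<in> parcs D. v \<le> u} = {}")
    case True
    then have "acyclic (parcs D)"
      by (intro acyclic_rank[where f = id]) (auto simp: not_le)
    then show ?thesis by (intro exI[of _ "[]"]) simp
  next
    case False
    then obtain u v where uv: "(u, v) \<in> parcs D" "v \<le> u" by blast
    then have ne: "v \<noteq> u" using less.prems(3) by blast
    define D' where "D' = invert {u, v} D"
    have p: "parcs D' = insert (v, u) (parcs D - {(u, v)})"
      using uv(1) ne less.prems(3)[OF uv(1)] less.prems(3)[of u u] less.prems(3)[of v v]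
      by (auto simp: D'_def parcs_invert in_invert_rel split: if_splits)
    have V: "pverts D' = pverts D" by (simp add: D'_def pverts_invert)
    have fin: "finite {(u, v) \<in> parcs D. v \<le> u}"
      by (rule finite_subset[OF _ less.prems(1)]) auto
    have "{(u, v) \<in> parcs D'. v \<le> u} \<subseteq> {(u, v) \<in> parcs D. v \<le> u} - {(u, v)}"
      using uv(2) ne by (auto simp: p)
    moreover have "(u, v) \<in> {(u, v) \<in> parcs D. v \<le> u}" using uv by simp
    ultimately have "{(u, v) \<in> parcs D'. v \<le> u} \<subset> {(u, v) \<in> parcs D. v \<le> u}" by blast
    then have "card {(u, v) \<in> parcs D'. v \<le> u} < card {(u, v) \<in> parcs D. v \<le> u}"
      using fin by (rule psubset_card_mono[rotated])
    moreover have "finite (parcs D')" "parcs D' \<subseteq> pverts D' \<times> pverts D'"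
      "\<And>a b. (a, b) \<in> parcs D' \<Longrightarrow> (b, a) \<notin> parcs D'"
      using less.prems uv ne by (auto simp: p V)
    ultimately obtain Xs where "\<forall>X \<in> set Xs. X \<subseteq> pverts D'" "acyclic (parcs (fold invert Xs D'))"
      using less.hyps by blast
    then show ?thesis
      using uv less.prems(2) by (intro exI[of _ "{u, v} # Xs"]) (auto simp: V D'_def pverts_invert)
  qed
qed

lemma inversion_number_le_1_iff:
  fixes D :: "nat pair_pre_digraph"
  assumes "oriented_graph D"
  shows "inversion_number D \<le> 1 \<longleftrightarrow> (\<exists>X \<subseteq> pverts D. acyclic (invert_rel X (parcs D)))"
proof
  let ?P = "\<lambda>k. \<exists>Xs. length Xs = k \<and> (\<forall>X \<in> set Xs. X \<subseteq> pverts D) \<and> acyclic (parcs (fold invert Xs D))"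
  assume le: "inversion_number D \<le> 1"
  have "finite (parcs D)" using assms finite_subset by (fastforce simp: oriented_graph_iff)
  then have "\<exists>k. ?P k" using invert_pairs_acyclic[of D] assms by (auto simp: oriented_graph_iff)
  then have "?P (inversion_number D)" unfolding inversion_number_def by (rule LeastI_ex)
  then obtain Xs where "length Xs = inversion_number D"
      and Xs: "\<forall>X \<in> set Xs. X \<subseteq> pverts D" "acyclic (parcs (fold invert Xs D))"
    by blast
  then have "length Xs \<le> 1" using le by simp
  show "\<exists>X \<subseteq> pverts D. acyclic (invert_rel X (parcs D))"
  proof (cases Xs)
    case Nil
    \<comment> \<open>No inversion at all amounts to inverting the empty set.\<close>
    then show ?thesis using Xs by (intro exI[of _ "{}"]) (simp add: invert_rel_def)
  next
    case (Cons X Ys)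
    then show ?thesis using Xs \<open>length Xs \<le> 1\<close> by (intro exI[of _ X]) (simp add: parcs_invert)
  qed
next
  assume "\<exists>X \<subseteq> pverts D. acyclic (invert_rel X (parcs D))"
  then obtain X where "X \<subseteq> pverts D" "acyclic (invert_rel X (parcs D))" by blast
  then show "inversion_number D \<le> 1"
    unfolding inversion_number_def by (intro Least_le exI[of _ "[X]"]) (simp add: parcs_invert)
qed

lemma strongly_connected_iff:
  assumes "oriented_graph D"
  shows "strongly_connected (with_proj D) \<longleftrightarrow>
    pverts D \<noteq> {} \<and> (\<forall>u \<in> pverts D. \<forall>v \<in> pverts D. (u, v) \<in> (parcs D)\<^sup>*)"
proof -
  interpret pair_digraph D using assms by (simp add: oriented_graph_def)
  show ?thesis by (auto simp: strongly_connected_def reachable_conv)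
qed

text \<open>
  The path from the sink \<open>n + 1\<close> back to the source \<open>n\<close> is harmless, because it is broken by inverting
  its two inner vertices.
\<close>

definition strong_hull :: "nat \<Rightarrow> nat rel \<Rightarrow> nat rel" where
  "strong_hull n R = R \<union> {n} \<times> {..<n} \<union> {..<n} \<times> {n + 1} \<union> {(n + 1, n + 2), (n + 2, n + 3), (n + 3, n)}"

lemma in_strong_hull:
  "(u, v) \<in> strong_hull n R \<longleftrightarrow> (u, v) \<in> R \<or> u = n \<and> v < n \<or> u < n \<and> v = n + 1 \<or>
     u = n + 1 \<and> v = n + 2 \<or> u = n + 2 \<and> v = n + 3 \<or> u = n + 3 \<and> v = n"
  by (auto simp: strong_hull_def)

lemma strong_hull_invertible_iff:
  assumes R: "R \<subseteq> {..<n} \<times> {..<n}"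
  shows "(\<exists>X. acyclic (invert_rel X (strong_hull n R))) \<longleftrightarrow> (\<exists>X. acyclic (invert_rel X R))"
proof
  have R_sub: "R \<subseteq> strong_hull n R" by (auto simp: strong_hull_def)
  assume "\<exists>X. acyclic (invert_rel X (strong_hull n R))"
  then show "\<exists>X. acyclic (invert_rel X R)"
    using acyclic_subset[OF _ invert_rel_mono[OF R_sub]] by blast
next
  assume "\<exists>X. acyclic (invert_rel X R)"
  then obtain X where X: "acyclic (invert_rel X R)" by blast
  have "finite R" using R finite_subset by blast
  then have fin: "finite (invert_rel X R)" by (simp add: invert_rel_def)
  define r where "r v = card {w. (w, v) \<in> (invert_rel X R)\<^sup>+}" for v
  have r: "r u < r v" if "(u, v) \<in> invert_rel X R" for u v
    using finite_acyclic_rank[OF fin X that] by (simp add: r_def)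
  \<comment> \<open>Of the added arcs, only the one between \<open>n + 2\<close> and
    \<open>n + 3\<close> gets reversed.\<close>
  define Y where "Y = (X \<inter> {..<n}) \<union> {n + 2, n + 3}"
  \<comment> \<open>The new order is \<open>n + 3\<close>, \<open>n\<close>, the old vertices,
    \<open>n + 1\<close>, \<open>n + 2\<close>. Among the old vertices the rank r decides.\<close>
  define f :: "nat \<Rightarrow> nat" where "f v = (if v < n then 2 else if v = n then 1 else if v = n + 1 then 3
     else if v = n + 2 then 4 else 0)" for v
  have "acyclic (invert_rel Y (strong_hull n R))"
  proof (rule acyclic_rank2[of _ f r])
    fix u v assume uv: "(u, v) \<in> invert_rel Y (strong_hull n R)"
    show "f u < f v \<or> f u = f v \<and> r u < r v"
    proof (cases "u < n \<and> v < n")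
      case True
      then have "(u, v) \<in> invert_rel X R"
        using uv by (auto simp: in_invert_rel Y_def in_strong_hull split: if_splits)
      then show ?thesis using r True by (auto simp: f_def)
    next
      case False
      then have R': "(u, v) \<notin> R" "(v, u) \<notin> R" using R by auto
      have "u \<in> Y \<and> v \<in> Y \<and> (v, u) \<in> strong_hull n R \<or>
          \<not> (u \<in> Y \<and> v \<in> Y) \<and> (u, v) \<in> strong_hull n R"
        using uv by (auto simp: in_invert_rel split: if_splits)
      then show ?thesis
        unfolding in_strong_hull using R' by (elim disjE conjE) (simp_all add: Y_def f_def)
    qed
  qed
  then show "\<exists>X. acyclic (invert_rel X (strong_hull n R))" by blast
qed

lemma strong_hull_subset:
  "R \<subseteq> {..<n} \<times> {..<n} \<Longrightarrow> strong_hull n R \<subseteq> {..<n + 4} \<times> {..<n + 4}"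
  by (auto simp: strong_hull_def)

lemma strong_hull_oriented:
  assumes "R \<subseteq> {..<n} \<times> {..<n}" "\<And>u v. (u, v) \<in> R \<Longrightarrow> (v, u) \<notin> R" "(u, v) \<in> strong_hull n R"
  shows "(v, u) \<notin> strong_hull n R"
proof -
  have "(u, v) \<in> R \<longrightarrow> u < n \<and> v < n" "(v, u) \<in> R \<longrightarrow> u < n \<and> v < n"
    "\<not> ((u, v) \<in> R \<and> (v, u) \<in> R)"
    using assms(1,2) by blast+
  then have "(v, u) \<in> strong_hull n R \<Longrightarrow> False"
    using assms(3) unfolding in_strong_hull by (elim disjE conjE) simp_all
  then show ?thesis by blast
qed

lemma strong_hull_connected:
  assumes n: "0 < n" and u: "u < n + 4" and v: "v < n + 4"
  shows "(u, v) \<in> (strong_hull n R)\<^sup>*"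
proof -
  let ?H = "(strong_hull n R)\<^sup>*"
  have a: "(n, w) \<in> ?H" "(w, n + 1) \<in> ?H" if "w < n" for w
    using that by (auto simp: strong_hull_def)
  have b: "(n + 1, n + 2) \<in> ?H" "(n + 2, n + 3) \<in> ?H" "(n + 3, n) \<in> ?H"
    by (auto simp: strong_hull_def)
  \<comment> \<open>The way from the source to the sink leads through an old vertex, hence
    \<open>0 < n\<close>.\<close>
  have c: "(n, n + 1) \<in> ?H" using a[of 0] n by (meson rtrancl_trans)
  have to: "(w, n) \<in> ?H" if w: "w < n + 4" for w
  proof -
    consider "w < n" | "w = n" | "w = n + 1" | "w = n + 2" | "w = n + 3" using w by linarith
    then show ?thesis by cases (use a b in \<open>meson rtrancl_trans rtrancl.rtrancl_refl\<close>)+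
  qed
  have "(n, w) \<in> ?H" if w: "w < n + 4" for w
  proof -
    consider "w < n" | "w = n" | "w = n + 1" | "w = n + 2" | "w = n + 3" using w by linarith
    then show ?thesis by cases (use a b c in \<open>meson rtrancl_trans rtrancl.rtrancl_refl\<close>)+
  qed
  then show ?thesis using to u v by (meson rtrancl_trans)
qed

section \<open>From satisfiability to inversions\<close>

text \<open>The literals of variable u are \<open>2 * u\<close> and
  \<open>2 * u + 1\<close>.\<close>

definition complement_lit :: "nat \<Rightarrow> nat" where
  "complement_lit l = (if even l then l + 1 else l - 1)"

text \<open>Three directed triangles, on 0, 1, 2, on 0, 1, 3 and on 2, 3, 4. Exactly two vertices of
  each are inverted: the first two triangles give the vertices 2 and 3 the same status, and then the
  third one forces both to be inverted.\<close>

definition forcer_arc :: "nat \<Rightarrow> nat \<Rightarrow> bool" where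
  "forcer_arc r s \<longleftrightarrow> r = 0 \<and> s = 1 \<or> r = 1 \<and> s = 2 \<or> r = 2 \<and> s = 0 \<or> r = 1 \<and> s = 3 \<or>
     r = 3 \<and> s = 0 \<or> r = 2 \<and> s = 3 \<or> r = 3 \<and> s = 4 \<or> r = 4 \<and> s = 2"

text \<open>
  A vertex is a triple \<open>(g, j, l)\<close> of a kind, a clause and a literal. Kinds \<open>0\<close> to \<open>14\<close> are three
  copies of a five-vertex gadget which forces its vertices number \<open>2\<close> and \<open>3\<close> to be inverted,
  kind \<open>15\<close> (with \<open>j = 0\<close>) stands for the literals and kind \<open>16\<close> for their occurrences in clauses.
  The occurrences in a clause lie on a directed cycle together with forced vertices, so at least
  one of them has to be inverted.
\<close>

definition gadget_arc ::
    "(nat \<Rightarrow> nat \<Rightarrow> bool) \<Rightarrow> nat \<Rightarrow> nat \<Rightarrow> nat \<Rightarrow> nat \<Rightarrow> nat \<Rightarrow> nat \<Rightarrow> nat \<Rightarrow> bool" where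
  "gadget_arc occ N g j l g' j' l' \<longleftrightarrow>
     j = j' \<and> l = l' \<and> g < 15 \<and> g' < 15 \<and> g div 5 = g' div 5 \<and> forcer_arc (g mod 5) (g' mod 5) \<or>
     g = 2 \<and> g' = 15 \<and> j' = 0 \<and> l' = complement_lit l \<and> occ j l \<or>
     g = 15 \<and> g' = 16 \<and> j = 0 \<and> l = complement_lit l' \<and> occ j' l' \<or>
     g = 3 \<and> g' = 16 \<and> j = j' \<and> l = l' \<and> \<not> occ j l \<or>
     g = 16 \<and> g' = 2 \<and> j = j' \<and> l = l' \<or>
     g = 16 \<and> g' = 7 \<and> j = j' \<and> l = l' \<or>
     g = 7 \<and> g' = 16 \<and> j = j' \<and> l' = (l + 1) mod N \<or>
     g = 12 \<and> g' = 15 \<and> j = 0 \<and> j' = 0 \<and> l = l' \<and> even l \<or>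
     g = 15 \<and> g' = 15 \<and> j = 0 \<and> j' = 0 \<and> l' = l + 1 \<and> even l \<or>
     g = 15 \<and> g' = 12 \<and> j = 0 \<and> j' = 0 \<and> l = l' + 1 \<and> even l'"

definition gadget_graph :: "(nat \<Rightarrow> nat \<Rightarrow> bool) \<Rightarrow> nat \<Rightarrow> nat \<Rightarrow> (nat \<times> nat \<times> nat) rel" where
  "gadget_graph occ N m = {((g, j, l), (g', j', l')). g < 17 \<and> g' < 17 \<and> j < m \<and> j' < m \<and>
     l < N \<and> l' < N \<and> gadget_arc occ N g j l g' j' l'}"

lemma in_gadget_graph:
  "((g, j, l), (g', j', l')) \<in> gadget_graph occ N m \<longleftrightarrow>
    g < 17 \<and> g' < 17 \<and> j < m \<and> j' < m \<and> l < N \<and> l' < N \<and> gadget_arc occ N g j l g' j' l'"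
  by (simp add: gadget_graph_def)

definition satisfies :: "(nat \<Rightarrow> nat \<Rightarrow> bool) \<Rightarrow> nat \<Rightarrow> nat \<Rightarrow> (nat \<Rightarrow> bool) \<Rightarrow> bool" where
  "satisfies occ N m \<alpha> \<longleftrightarrow>
     (\<forall>l. even l \<longrightarrow> \<alpha> (l + 1) = (\<not> \<alpha> l)) \<and> (\<forall>j < m. \<exists>l < N. occ j l \<and> \<alpha> l)"

lemma complement_lit_less: "even N \<Longrightarrow> l < N \<Longrightarrow> complement_lit l < N"
  unfolding complement_lit_def by (auto elim!: evenE)

lemma forcer_arc_asym: "forcer_arc r s \<Longrightarrow> \<not> forcer_arc s r"
  unfolding forcer_arc_def by (elim disjE conjE) simp_all

lemma gadget_arc_asym:
  assumes "2 \<le> N" "l < N" "l' < N" "gadget_arc occ N g j l g' j' l'"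
  shows "\<not> gadget_arc occ N g' j' l' g j l"
proof
  \<comment> \<open>For \<open>N = 1\<close> a clause cycle would consist of two opposite
    arcs.\<close>
  have m: "(k + 1) mod N \<noteq> k" if "k < N" for k
    using assms(1) that by (cases "k + 1 = N") auto
  assume "gadget_arc occ N g' j' l' g j l"
  with assms(4) show False
    unfolding gadget_arc_def using forcer_arc_asym[of "g mod 5" "g' mod 5"] m[OF assms(2)] m[OF assms(3)]
    by (elim disjE conjE; (linarith | blast | metis))
qed

lemma gadget_graph_sound:
  assumes N: "even N" "0 < N" and m: "0 < m"
    and X: "acyclic (invert_rel X (gadget_graph occ N m))"
  shows "\<exists>\<alpha>. satisfies occ N m \<alpha>"
proof -
  let ?R = "gadget_graph occ N m"
  have forced: "(2, j, l) \<in> X \<and> (3, j, l) \<in> X \<and> (7, j, l) \<in> X \<and> (12, j, l) \<in> X"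
    if "j < m" "l < N" for j l
  proof -
    have f: "(5 * h + 2, j, l) \<in> X \<and> (5 * h + 3, j, l) \<in> X" if h: "h < 3" for h
    proof -
      have e: "((5 * h + r, j, l), (5 * h + s, j, l)) \<in> ?R" if "forcer_arc r s" for r s
      proof -
        have "r < 5" "s < 5" using that by (auto simp: forcer_arc_def)
        then have "5 * h + r < 15" "5 * h + s < 15" "(5 * h + r) div 5 = (5 * h + s) div 5"
          "(5 * h + r) mod 5 = r" "(5 * h + s) mod 5 = s" using h by auto
        then have "gadget_arc occ N (5 * h + r) j l (5 * h + s) j l"
          unfolding gadget_arc_def using that by metis
        then show ?thesis
          using \<open>j < m\<close> \<open>l < N\<close> \<open>5 * h + r < 15\<close> \<open>5 * h + s < 15\<close> by (simp add: in_gadget_graph)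
      qed
      show ?thesis
        using triangle_two_inverted[OF X e[of 0 1] e[of 1 2] e[of 2 0]]
          triangle_two_inverted[OF X e[of 0 1] e[of 1 3] e[of 3 0]]
          triangle_two_inverted[OF X e[of 2 3] e[of 3 4] e[of 4 2]]
        by (auto simp: forcer_arc_def)
    qed
    show ?thesis using f[of 0] f[of 1] f[of 2] by (simp add: numeral_2_eq_2)
  qed
  define \<beta> where "\<beta> l \<longleftrightarrow> (15, 0, l) \<in> X" for l
  have compl: "\<beta> (l + 1) = (\<not> \<beta> l)" if "even l" "l < N" for l
  proof -
    have "l + 1 < N" using that N by (metis Suc_eq_plus1 Suc_lessI even_Suc)
    then have "((12, 0, l), (15, 0, l)) \<in> ?R" "((15, 0, l), (15, 0, l + 1)) \<in> ?R"
      "((15, 0, l + 1), (12, 0, l)) \<in> ?R"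
      using that m by (auto simp: in_gadget_graph gadget_arc_def)
    from triangle_two_inverted[OF X this] show ?thesis
      using forced[OF m that(2)] by (auto simp: \<beta>_def)
  qed
  have complement: "\<beta> (complement_lit l) = (\<not> \<beta> l)" if "l < N" for l
    using compl[of l] compl[of "l - 1"] that by (auto simp: complement_lit_def elim!: oddE)
  have occ: "(16, j, l) \<in> X \<longleftrightarrow> occ j l \<and> \<beta> l" if jl: "j < m" "l < N" for j l
  proof (cases "occ j l")
    case True
    \<comment> \<open>The vertex of kind 2 is forced, so exactly one of the complementary literal
      and the occurrence is inverted: the occurrence agrees with its own literal.\<close>
    have "((2, j, l), (15, 0, complement_lit l)) \<in> ?R" "((15, 0, complement_lit l), (16, j, l)) \<in> ?R"
      "((16, j, l), (2, j, l)) \<in> ?R"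
      using True jl m complement_lit_less[OF N(1) jl(2)] by (auto simp: in_gadget_graph gadget_arc_def)
    from triangle_two_inverted[OF X this] show ?thesis
      using forced[OF jl] complement[OF jl(2)] True by (auto simp: \<beta>_def)
  next
    case False
    \<comment> \<open>Two forced vertices keep the third one from being inverted, so a literal
      outside the clause cannot break its cycle.\<close>
    have "((2, j, l), (3, j, l)) \<in> ?R" "((3, j, l), (16, j, l)) \<in> ?R" "((16, j, l), (2, j, l)) \<in> ?R"
      using False jl by (auto simp: in_gadget_graph gadget_arc_def forcer_arc_def)
    from triangle_two_inverted[OF X this] show ?thesis
      using forced[OF jl] False by auto
  qed
  have clause: "\<exists>l < N. occ j l \<and> \<beta> l" if j: "j < m" for j
  proof (rule ccontr)
    assume "\<not> ?thesis"
    \<comment> \<open>Every arc of the clause cycle has an end of kind 16. If none of these vertices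
      is inverted, the whole cycle survives.\<close>
    then have no: "(16, j, l) \<notin> X" if "l < N" for l using occ[OF j that] that by blast
    let ?S = "invert_rel X ?R"
    have st: "((16, j, l), (16, j, (l + 1) mod N)) \<in> ?S\<^sup>+" if l: "l < N" for l
    proof -
      have "((16, j, l), (7, j, l)) \<in> ?S" "((7, j, l), (16, j, (l + 1) mod N)) \<in> ?S"
        using no[OF l] no[of "(l + 1) mod N"] l j N(2)
        by (auto simp: in_invert_rel in_gadget_graph gadget_arc_def)
      then show ?thesis by (meson r_into_trancl trancl_into_trancl)
    qed
    have "((16, j, 0), (16, j, Suc k mod N)) \<in> ?S\<^sup>+" for k
    proof (induction k)
      case 0
      then show ?case using st[of 0] N by simp
    next
      case (Suc k)
      have "((16, j, Suc k mod N), (16, j, Suc (Suc k) mod N)) \<in> ?S\<^sup>+"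
        using st[of "Suc k mod N"] N(2) by (simp add: mod_Suc_eq)
      then show ?case using Suc by (rule trancl_trans[rotated])
    qed
    from this[of "N - 1"] have "((16, j, 0), (16, j, 0)) \<in> ?S\<^sup>+" using N by simp
    then show False using X by (auto simp: acyclic_def)
  qed
  \<comment> \<open>Beyond N any complementary values will do; \<open>even l\<close> provides
    them.\<close>
  define \<alpha> where "\<alpha> l = (if l < N then \<beta> l else even l)" for l
  have "\<alpha> (l + 1) = (\<not> \<alpha> l)" if "even l" for l
    using compl[OF that] that N(1) by (cases "l < N"; cases "l + 1 < N") (auto simp: \<alpha>_def dest: Suc_lessI)
  moreover have "\<exists>l < N. occ j l \<and> \<alpha> l" if "j < m" for j
    using clause[OF that] by (auto simp: \<alpha>_def)
  ultimately show ?thesis unfolding satisfies_def by blast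
qed

lemma gadget_graph_complete:
  assumes N: "even N" "0 < N" and sat: "satisfies occ N m \<alpha>"
  shows "\<exists>X. acyclic (invert_rel X (gadget_graph occ N m))"
proof -
  have cp: "\<alpha> (Suc l) = (\<not> \<alpha> l)" if "even l" for l using sat that by (simp add: satisfies_def)
  have comp: "\<alpha> (complement_lit l) = (\<not> \<alpha> l)" for l
    using cp[of l] cp[of "l - 1"] by (auto simp: complement_lit_def elim!: oddE)
  define tr where "tr j l \<longleftrightarrow> occ j l \<and> \<alpha> l" for j l
  \<comment> \<open>In each five-vertex gadget one of the vertices 0 and 1 has to be inverted
    besides the forced ones; 0 is chosen.\<close>
  define X where "X = {(g :: nat, j, l). g \<in> {0, 2, 3, 5, 7, 8, 10, 12, 13} \<or> g = 15 \<and> \<alpha> l \<or> g = 16 \<and> tr j l}"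
  \<comment> \<open>The weights of the steps along a clause cycle are chosen such that they sum up to zero.\<close>
  define T where "T j = int (card {l. l < N \<and> tr j l})" for j
  define F where "F j = int (card {l. l < N \<and> \<not> tr j l})" for j
  define wt where "wt j l = (if tr j l then - F j else T j)" for j l
  define S where "S j l = (\<Sum>i<l. wt j i)" for j l
  \<comment> \<open>A satisfied clause contains a true literal, whose complement is false. So the
    cycle has an inverted vertex of kind 16 and one that is not inverted, and both weights are
    nonzero.\<close>
  have T: "T j > 0" and F: "F j > 0" if j: "j < m" for j
  proof -
    obtain l where l: "l < N" "tr j l" using sat j by (auto simp: satisfies_def tr_def)
    then have "\<not> tr j (complement_lit l)" "complement_lit l < N"
      using comp[of l] complement_lit_less[OF N(1)] by (auto simp: tr_def)
    then show "T j > 0" "F j > 0"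
      unfolding T_def F_def using l by (auto simp: card_gt_0_iff)
  qed
  have SN: "S j N = 0" for j
  proof -
    have "S j N = (\<Sum>i\<in>{l. l < N \<and> tr j l}. - F j) + (\<Sum>i\<in>{l. l < N \<and> \<not> tr j l}. T j)"
      unfolding S_def wt_def by (subst sum.If_cases) (auto simp: lessThan_def Collect_conj_eq Compl_eq)
    then show ?thesis by (simp add: T_def F_def)
  qed
  have S0: "S j 0 = 0" for j by (simp add: S_def)
  have Sm: "S j ((l + 1) mod N) = S j (l + 1)" if "l < N" for j l
    using that SN[of j] S0[of j] by (cases "l + 1 = N") auto
  have Sl: "S j (Suc l) = S j l + wt j l" for j l by (simp add: S_def)
  \<comment> \<open>Each five-vertex gadget gets the order 0, 1, 3, 4, 2. Literals have ranks 5 and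
    6. The vertices of kinds 2 and 12, which lie on triangles with literals, go in front of them (4)
    or to the very end (9), depending on the truth values. Ties occur only on the clause cycles, at
    rank 7.\<close>
  define f :: "nat \<times> nat \<times> nat \<Rightarrow> nat" where
    "f = (\<lambda>(g, j, l). if g \<in> {0, 5, 10} then 0 else if g \<in> {1, 6, 11} then 1 else if g \<in> {3, 8, 13} then 2
       else if g \<in> {4, 9, 14} then 3 else if g = 2 then (if tr j l then 4 else 9)
       else if g = 12 then (if \<alpha> l then 9 else 4) else if g = 15 then (if even l then 5 else 6) else 7)"
  \<comment> \<open>Along the cycle, the arc into \<open>(16, j, l)\<close> and the arc out of it
    both change s by \<open>wt j l\<close>. This is negative exactly if the vertex is inverted, that
    is, if both arcs are reversed. As \<open>S j N = 0\<close>, the values match when the cycle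
    closes.\<close>
  define s :: "nat \<times> nat \<times> nat \<Rightarrow> int" where
    "s = (\<lambda>(g, j, l). if g = 7 then 2 * S j (l + 1) else S j l + S j (l + 1))"
  have main: "if (g, j, l) \<in> X \<and> (g', j', l') \<in> X
      then f (g', j', l') < f (g, j, l) \<or> f (g', j', l') = f (g, j, l) \<and> s (g', j', l') < s (g, j, l)
      else f (g, j, l) < f (g', j', l') \<or> f (g, j, l) = f (g', j', l') \<and> s (g, j, l) < s (g', j', l')"
    if a: "gadget_arc occ N g j l g' j' l'" and b: "j < m" "j' < m" "l < N" "l' < N" for g j l g' j' l'
  proof -
    consider
      (forcer) "j = j'" "l = l'" "g < 15" "g' < 15" "g div 5 = g' div 5" "forcer_arc (g mod 5) (g' mod 5)"
    | (1) "g = 2" "g' = 15" "l' = complement_lit l" "occ j l"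
    | (2) "g = 15" "g' = 16" "l = complement_lit l'" "occ j' l'"
    | (3) "g = 3" "g' = 16" "j = j'" "l = l'" "\<not> occ j l"
    | (4) "g = 16" "g' = 2" "j = j'" "l = l'"
    | (5) "g = 16" "g' = 7" "j = j'" "l = l'"
    | (6) "g = 7" "g' = 16" "j = j'" "l' = (l + 1) mod N"
    | (7) "g = 12" "g' = 15" "l = l'" "even l"
    | (8) "g = 15" "g' = 15" "l' = l + 1" "even l"
    | (9) "g = 15" "g' = 12" "l = l' + 1" "even l'"
      using a unfolding gadget_arc_def by metis
    then show ?thesis
    proof cases
      case forcer
      have "g = 5 * (g div 5) + g mod 5" "g' = 5 * (g div 5) + g' mod 5"
        using forcer(5) mult_div_mod_eq[of 5 g] mult_div_mod_eq[of 5 g'] by presburger+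
      moreover have "g div 5 = 0 \<or> g div 5 = 1 \<or> g div 5 = 2" using forcer by auto
      ultimately show ?thesis
        using forcer(1,2,6) unfolding forcer_arc_def
        by (elim disjE conjE) (auto simp: X_def f_def)
    next
      case 1
      then show ?thesis using comp[of l] by (auto simp: X_def f_def tr_def)
    next
      case 2
      then show ?thesis using comp[of l'] by (auto simp: X_def f_def tr_def)
    next
      case 3
      then show ?thesis by (auto simp: X_def f_def tr_def)
    next
      case 4
      then show ?thesis by (auto simp: X_def f_def)
    next
      case 5
      then show ?thesis using T[OF b(1)] F[OF b(1)] by (auto simp: X_def f_def s_def Sl wt_def)
    next
      case 6
      then have "S j l' = S j (Suc l)" using Sm[OF b(3)] by simp
      then show ?thesis using 6 T[OF b(1)] F[OF b(1)] Sl[of j l'] by (auto simp: X_def f_def s_def wt_def)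
    next
      case 7
      then show ?thesis by (auto simp: X_def f_def)
    next
      case 8
      then show ?thesis using cp[of l] by (auto simp: X_def f_def)
    next
      case 9
      then show ?thesis using cp[of l'] by (auto simp: X_def f_def)
    qed
  qed
  have "acyclic (invert_rel X (gadget_graph occ N m))"
  proof (rule acyclic_rank2[of _ f s])
    fix u v assume uv: "(u, v) \<in> invert_rel X (gadget_graph occ N m)"
    obtain g j l g' j' l' where e: "u = (g, j, l)" "v = (g', j', l')" by (metis prod_cases3)
    show "f u < f v \<or> f u = f v \<and> s u < s v"
    proof (cases "u \<in> X \<and> v \<in> X")
      case True
      then have "(v, u) \<in> gadget_graph occ N m" using uv by (simp add: in_invert_rel)
      then show ?thesis using main[of g' j' l' g j l] True by (simp add: e in_gadget_graph)
    next
      case False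
      then have "(u, v) \<in> gadget_graph occ N m" using uv by (auto simp: in_invert_rel split: if_splits)
      then show ?thesis using main[of g j l g' j' l'] False unfolding e in_gadget_graph by presburger
    qed
  qed
  then show ?thesis by blast
qed

section \<open>Vertices as numbers\<close>

definition numbered_gadget_graph :: "(nat \<Rightarrow> nat \<Rightarrow> bool) \<Rightarrow> nat \<Rightarrow> nat \<Rightarrow> nat rel" where
  "numbered_gadget_graph occ N m = {(u, v). u < 17 * (N * m) \<and> v < 17 * (N * m) \<and>
     gadget_arc occ N (u mod 17) (u div 17 div N) (u div 17 mod N) (v mod 17) (v div 17 div N) (v div 17 mod N)}"

text \<open>Coding and decoding of triples are homomorphisms between the two graphs, and each
  direction pulls an inversion back along one of them.\<close>

lemma numbered_gadget_graph_iff: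
  assumes N: "even N" "0 < N" and m: "0 < m"
  shows "(\<exists>X. acyclic (invert_rel X (numbered_gadget_graph occ N m))) \<longleftrightarrow> (\<exists>\<alpha>. satisfies occ N m \<alpha>)"
proof
  define en where "en = (\<lambda>(g, j, l). g + 17 * (l + N * j))"
  assume "\<exists>X. acyclic (invert_rel X (numbered_gadget_graph occ N m))"
  then obtain X where X: "acyclic (invert_rel X (numbered_gadget_graph occ N m))" by blast
  have en: "en (g, j, l) < 17 * (N * m) \<and> en (g, j, l) mod 17 = g \<and> en (g, j, l) div 17 div N = j \<and>
      en (g, j, l) div 17 mod N = l"
    if "g < 17" "j < m" "l < N" for g j l
  proof -
    have "l + N * j < N * (j + 1)" using that by simp
    also have "\<dots> \<le> N * m" using that by (intro mult_le_mono) auto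
    finally have "l + N * j + 1 \<le> N * m" by simp
    then have "17 * (l + N * j + 1) \<le> 17 * (N * m)" by (rule mult_le_mono2)
    then have "g + 17 * (l + N * j) < 17 * (N * m)" using that(1) by simp
    moreover have "(g + 17 * k) mod 17 = g" "(g + 17 * k) div 17 = k" for k using that(1) by auto
    moreover have "(l + N * j) div N = j" "(l + N * j) mod N = l" using that(3) by auto
    ultimately show ?thesis unfolding en_def prod.case by (simp only:)
  qed
  have hom: "(en a, en b) \<in> numbered_gadget_graph occ N m" if "(a, b) \<in> gadget_graph occ N m" for a b
    using that en by (cases a; cases b) (simp add: in_gadget_graph numbered_gadget_graph_def)
  have "acyclic (invert_rel (en -` X) (gadget_graph occ N m))"
    by (rule acyclic_invert_hom[OF X]) (rule hom)
  then show "\<exists>\<alpha>. satisfies occ N m \<alpha>" by (rule gadget_graph_sound[OF N m])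
next
  assume "\<exists>\<alpha>. satisfies occ N m \<alpha>"
  then obtain X where X: "acyclic (invert_rel X (gadget_graph occ N m))"
    using gadget_graph_complete[OF N] by blast
  have "u div 17 div N < m" if "u < 17 * (N * m)" for u
    using that N by (simp add: less_mult_imp_div_less mult.commute)
  then have hom: "((u mod 17, u div 17 div N, u div 17 mod N), (v mod 17, v div 17 div N, v div 17 mod N)) \<in> gadget_graph occ N m"
    if "(u, v) \<in> numbered_gadget_graph occ N m" for u v
    using that N by (simp add: in_gadget_graph numbered_gadget_graph_def)
  have "acyclic (invert_rel ((\<lambda>u. (u mod 17, u div 17 div N, u div 17 mod N)) -` X) (numbered_gadget_graph occ N m))"
    by (rule acyclic_invert_hom[OF X]) (rule hom)
  then show "\<exists>X. acyclic (invert_rel X (numbered_gadget_graph occ N m))" by blast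
qed

lemma numbered_gadget_graph_asym:
  assumes "2 \<le> N" "(u, v) \<in> numbered_gadget_graph occ N m"
  shows "(v, u) \<notin> numbered_gadget_graph occ N m"
proof -
  have "u div 17 mod N < N" "v div 17 mod N < N" using assms(1) by auto
  from gadget_arc_asym[OF assms(1) this] show ?thesis
    using assms(2) unfolding numbered_gadget_graph_def by blast
qed

section \<open>The tableau of a verifier\<close>

text \<open>Definable functions handle numbers only, so the tuples that index clauses and atoms are
  coded by their digits in base B.\<close>

definition digit :: "nat \<Rightarrow> nat \<Rightarrow> nat \<Rightarrow> nat" where
  "digit B u i = u div B ^ i mod B"

lemma digit_less: "0 < B \<Longrightarrow> digit B u i < B"
  by (simp add: digit_def)

lemma digit_Suc: "digit B u (Suc i) = digit B (u div B) i"
  by (simp add: digit_def div_mult2_eq)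

lemma number_with_digits:
  "(\<And>i. i < n \<Longrightarrow> d i < B) \<Longrightarrow> \<exists>u < B ^ n. \<forall>i < n. digit B u i = d i"
proof (induction n arbitrary: d)
  case 0
  then show ?case by simp
next
  case (Suc n)
  have "\<exists>u < B ^ n. \<forall>i < n. digit B u i = d (Suc i)" using Suc.prems by (intro Suc.IH) auto
  then obtain u where u: "u < B ^ n" "\<And>i. i < n \<Longrightarrow> digit B u i = d (Suc i)" by blast
  have d0: "d 0 < B" using Suc.prems by simp
  have "B * (u + 1) \<le> B * B ^ n" using u by (intro mult_le_mono2) auto
  then have "d 0 + B * u < B ^ Suc n" using d0 by simp
  moreover have "digit B (d 0 + B * u) i = d i" if "i < Suc n" for i
    using that u d0 by (cases i) (auto simp: digit_Suc, simp add: digit_def)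
  ultimately show ?case by blast
qed

lemma digits_unique:
  "u < B ^ n \<Longrightarrow> v < B ^ n \<Longrightarrow> (\<And>i. i < n \<Longrightarrow> digit B u i = digit B v i) \<Longrightarrow> u = v"
proof (induction n arbitrary: u v)
  case 0
  then show ?case by simp
next
  case (Suc n)
  have "u div B = v div B"
  proof (rule Suc.IH)
    show "u div B < B ^ n" "v div B < B ^ n"
      using Suc.prems(1,2) by (auto intro!: less_mult_imp_div_less simp: mult.commute)
    show "digit B (u div B) i = digit B (v div B) i" if "i < n" for i
      using Suc.prems(3)[of "Suc i"] that by (simp add: digit_Suc)
  qed
  moreover have "u mod B = v mod B" using Suc.prems(3)[of 0] by (simp add: digit_def)
  ultimately show ?case by (metis div_mult_mod_eq)
qed

lemma pair_strings_length: "length (pair_strings x y) = 2 * length x + 2 + length y"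
  by (induction x) (auto simp: pair_strings_def)

lemma pair_strings_Cons: "pair_strings (b # x) y = b # b # pair_strings x y"
  by (simp add: pair_strings_def)

lemma pair_strings_nth:
  "pair_strings x y ! i =
     (if i < 2 * length x then x ! (i div 2)
      else if i = 2 * length x then False else if i = 2 * length x + 1 then True
      else y ! (i - (2 * length x + 2)))"
proof (induction x arbitrary: i)
  case Nil
  then show ?case by (auto simp: pair_strings_def nth_Cons split: nat.split)
next
  case (Cons b x)
  consider "i = 0" | "i = 1" | k where "i = Suc (Suc k)"
    by (metis One_nat_def not0_implies_Suc)
  then show ?case by cases (auto simp: pair_strings_Cons Cons.IH)
qed

definition move_code :: "head_move \<Rightarrow> nat" where
  "move_code m = nat (head_shift m + 1)"

text \<open>\<open>E\<close> lists all situations of the machine: the scanned symbols, followed by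
  the state as component number \<open>tm_tapes M\<close>. A position in \<open>E\<close> names a
  transition.\<close>

locale tableau =
  fixes M :: turing_machine and W :: "bool list set" and p q :: "nat poly" and E :: "nat list list"
  assumes wf: "wf_turing_machine M"
    and computes: "tm_computes_in_time M (\<lambda>w. [w \<in> W]) (poly q)"
    and E: "set E = {ss @ [s] | ss s. length ss = tm_tapes M \<and> (\<forall>a \<in> set ss. a < tm_symbols M) \<and> s < tm_states M}"
begin

abbreviation "K \<equiv> tm_tapes M"

text \<open>Halting becomes an idle transition, so that the tableau can extend to a time bound that
  depends on the length of x alone.\<close>

definition effect :: "nat \<Rightarrow> nat list \<Rightarrow> nat \<times> (nat \<times> head_move) list" where
  "effect s ss = (if s = tm_halt M then (s, map (\<lambda>a. (a, Move_None)) ss) else tm_delta M s ss)"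

text \<open>The default 0 outside the table, here and in the next three definitions, gives the
  finite support that \<open>definable_table\<close> and \<open>definable_table2\<close> ask
  for.\<close>

definition entry :: "nat \<Rightarrow> nat \<Rightarrow> nat" where
  "entry e k = (if e < length E \<and> k < Suc K then E ! e ! k else 0)"

definition next_state :: "nat \<Rightarrow> nat" where
  "next_state e = (if e < length E then fst (effect (last (E ! e)) (butlast (E ! e))) else 0)"

definition written :: "nat \<Rightarrow> nat \<Rightarrow> nat" where
  "written e k = (if e < length E \<and> k < K
     then fst (snd (effect (last (E ! e)) (butlast (E ! e))) ! k) else 0)"

definition moved :: "nat \<Rightarrow> nat \<Rightarrow> nat" where
  "moved e k = (if e < length E \<and> k < K
     then move_code (snd (snd (effect (last (E ! e)) (butlast (E ! e))) ! k)) else 0)"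

definition input_bound :: "nat \<Rightarrow> nat" where
  "input_bound n = 2 * n + 2 + poly p n"

definition time_bound :: "nat \<Rightarrow> nat" where
  "time_bound n = poly q (input_bound n)"

text \<open>The number of cell 0 in the tableau. As a head moves at most \<open>time_bound n\<close>
  cells to the left, shifted positions are natural numbers.\<close>

definition origin :: "nat \<Rightarrow> nat" where
  "origin n = time_bound n + input_bound n + 1"

text \<open>A single base for all coordinates: it exceeds all times, shifted head positions, tapes,
  states, symbols, transitions and kinds of clauses in use.\<close>

definition base :: "nat \<Rightarrow> nat" where
  "base n = 2 * origin n + tm_states M + tm_symbols M + K + length E + 20"

text \<open>The initial tapes. The first one holds x with doubled bits, the separator 01 and
  \<open>poly p (length x)\<close> cells for the certificate, where \<open>s \<le> 2\<close> leaves
  the choice between the blank and the two bits.\<close>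

definition allowed :: "bool list \<Rightarrow> nat \<Rightarrow> nat \<Rightarrow> nat \<Rightarrow> bool" where
  "allowed x k c s \<longleftrightarrow>
     (if k = 0 \<and> origin (length x) \<le> c \<and> c < origin (length x) + 2 * length x then
        s = 1 + of_bool ((c - origin (length x)) div 2 < length x \<and> x ! ((c - origin (length x)) div 2))
      else if k = 0 \<and> c = origin (length x) + 2 * length x then s = 1
      else if k = 0 \<and> c = origin (length x) + 2 * length x + 1 then s = 2
      else if k = 0 \<and> origin (length x) + 2 * length x + 2 \<le> c \<and> c < origin (length x) + input_bound (length x)
        then s \<le> 2
      else s = 0)"

text \<open>
  Atoms are tuples of five numbers: \<open>(0, t, k, c, 0)\<close> says that at time \<open>t\<close> the head of tape \<open>k\<close> is
  on cell \<open>c\<close>, \<open>(1, t, k, c, s)\<close> that this cell contains \<open>s\<close>, \<open>(2, t, k, s, 0)\<close> that \<open>s\<close> is scanned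
  on tape \<open>k\<close> (or is the state, for \<open>k = K\<close>), and \<open>(3, t, e, 0, 0)\<close> that transition \<open>e\<close> takes place.
  All clauses are Horn clauses that propagate the facts about the run forward in time, except for
  the choice of the contents of the first tape.
\<close>

definition active :: "bool list \<Rightarrow> nat \<Rightarrow> nat \<Rightarrow> nat \<Rightarrow> nat \<Rightarrow> nat \<Rightarrow> nat \<Rightarrow> bool" where
  "active x f t k c r s \<longleftrightarrow>
     f = 0 \<or>
     f = 1 \<and> s < length E \<or>
     f = 2 \<and> s < length E \<and> t < time_bound (length x) \<or>
     f = 3 \<and> s < length E \<and> t < time_bound (length x) \<and> k < K \<or>
     f = 4 \<and> s < length E \<and> t < time_bound (length x) \<and> k < K \<and> r + 1 = c + moved s k \<or>
     f = 5 \<and> t < time_bound (length x) \<and> c \<noteq> r \<or>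
     f = 6 \<and> k < K \<or>
     f = 7 \<or>
     f = 8 \<and> k < K \<or>
     f = 9 \<and> origin (length x) + 2 * length x + 2 \<le> c \<and> c + 1 < origin (length x) + input_bound (length x) \<or>
     f = 10"

text \<open>The sign g is 0 for positive and 1 for negative literals. By f, the clauses say: 0 a
  symbol is scanned, 1 the transition is selected, 2 to 4 it sets the state, writes and moves the
  head, 5 other cells are kept, 6 to 8 the initial configuration, 9 a blank in the certificate area
  is followed by a blank, 10 the answer is not 1, which would mean rejection.\<close>

definition occurs :: "bool list \<Rightarrow> nat \<Rightarrow> nat \<Rightarrow> nat \<Rightarrow> nat \<Rightarrow> nat \<Rightarrow> nat \<Rightarrow> nat \<Rightarrow>
    nat \<Rightarrow> nat \<Rightarrow> nat \<Rightarrow> nat \<Rightarrow> nat \<Rightarrow> bool" where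
  "occurs x f t k c r s g a b1 b2 b3 b4 \<longleftrightarrow>
     f = 0 \<and> (g = 1 \<and> a = 0 \<and> b1 = t \<and> b2 = k \<and> b3 = c \<and> b4 = 0 \<or>
       g = 1 \<and> a = 1 \<and> b1 = t \<and> b2 = k \<and> b3 = c \<and> b4 = s \<or>
       g = 0 \<and> a = 2 \<and> b1 = t \<and> b2 = k \<and> b3 = s \<and> b4 = 0) \<or>
     f = 1 \<and> (g = 1 \<and> a = 2 \<and> b1 = t \<and> b2 \<le> K \<and> b3 = entry s b2 \<and> b4 = 0 \<or>
       g = 0 \<and> a = 3 \<and> b1 = t \<and> b2 = s \<and> b3 = 0 \<and> b4 = 0) \<or>
     f = 2 \<and> (g = 1 \<and> a = 3 \<and> b1 = t \<and> b2 = s \<and> b3 = 0 \<and> b4 = 0 \<or>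
       g = 0 \<and> a = 2 \<and> b1 = t + 1 \<and> b2 = K \<and> b3 = next_state s \<and> b4 = 0) \<or>
     f = 3 \<and> (g = 1 \<and> a = 3 \<and> b1 = t \<and> b2 = s \<and> b3 = 0 \<and> b4 = 0 \<or>
       g = 1 \<and> a = 0 \<and> b1 = t \<and> b2 = k \<and> b3 = c \<and> b4 = 0 \<or>
       g = 0 \<and> a = 1 \<and> b1 = t + 1 \<and> b2 = k \<and> b3 = c \<and> b4 = written s k) \<or>
     f = 4 \<and> (g = 1 \<and> a = 3 \<and> b1 = t \<and> b2 = s \<and> b3 = 0 \<and> b4 = 0 \<or>
       g = 1 \<and> a = 0 \<and> b1 = t \<and> b2 = k \<and> b3 = c \<and> b4 = 0 \<or>
       g = 0 \<and> a = 0 \<and> b1 = t + 1 \<and> b2 = k \<and> b3 = r \<and> b4 = 0) \<or>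
     f = 5 \<and> (g = 1 \<and> a = 0 \<and> b1 = t \<and> b2 = k \<and> b3 = r \<and> b4 = 0 \<or>
       g = 1 \<and> a = 1 \<and> b1 = t \<and> b2 = k \<and> b3 = c \<and> b4 = s \<or>
       g = 0 \<and> a = 1 \<and> b1 = t + 1 \<and> b2 = k \<and> b3 = c \<and> b4 = s) \<or>
     f = 6 \<and> g = 0 \<and> a = 0 \<and> b1 = 0 \<and> b2 = k \<and> b3 = origin (length x) \<and> b4 = 0 \<or>
     f = 7 \<and> g = 0 \<and> a = 2 \<and> b1 = 0 \<and> b2 = K \<and> b3 = tm_start M \<and> b4 = 0 \<or>
     f = 8 \<and> g = 0 \<and> a = 1 \<and> b1 = 0 \<and> b2 = k \<and> b3 = c \<and> allowed x k c b4 \<or>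
     f = 9 \<and> (g = 1 \<and> a = 1 \<and> b1 = 0 \<and> b2 = 0 \<and> b3 = c \<and> b4 = 0 \<or>
       g = 0 \<and> a = 1 \<and> b1 = 0 \<and> b2 = 0 \<and> b3 = c + 1 \<and> b4 = 0) \<or>
     f = 10 \<and> g = 1 \<and> a = 1 \<and> b1 = time_bound (length x) \<and> b2 = K - 1 \<and> b3 = origin (length x) \<and> b4 = 1"

definition tableau_sat :: "bool list \<Rightarrow> (nat \<Rightarrow> nat \<Rightarrow> nat \<Rightarrow> nat \<Rightarrow> nat \<Rightarrow> bool) \<Rightarrow> bool" where
  "tableau_sat x A \<longleftrightarrow> (\<forall>f t k c r s. f < base (length x) \<longrightarrow> t < base (length x) \<longrightarrow> k < base (length x) \<longrightarrow>
     c < base (length x) \<longrightarrow> r < base (length x) \<longrightarrow> s < base (length x) \<longrightarrow> active x f t k c r s \<longrightarrow>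
     (\<exists>g a b1 b2 b3 b4. g < 2 \<and> a < base (length x) \<and> b1 < base (length x) \<and> b2 < base (length x) \<and>
        b3 < base (length x) \<and> b4 < base (length x) \<and> occurs x f t k c r s g a b1 b2 b3 b4 \<and>
        (A a b1 b2 b3 b4 \<longleftrightarrow> g = 0)))"

section \<open>Runs of the verifier\<close>

lemma K_pos: "1 \<le> K" and symbols_ge: "3 \<le> tm_symbols M"
  using wf by (auto simp: wf_turing_machine_def)

definition valid_config :: "tm_config \<Rightarrow> bool" where
  "valid_config c \<longleftrightarrow> fst c < tm_states M \<and> length (snd c) = K \<and>
     (\<forall>k < K. \<forall>i. fst (snd c ! k) i < tm_symbols M)"

definition scan :: "tm_config \<Rightarrow> nat list" where
  "scan c = map tape_read (snd c)"

lemma effect_bounds: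
  assumes "s < tm_states M" "length ss = K" "\<forall>a \<in> set ss. a < tm_symbols M"
  shows "fst (effect s ss) < tm_states M \<and> length (snd (effect s ss)) = K \<and>
    (\<forall>k < K. fst (snd (effect s ss) ! k) < tm_symbols M)"
  using wf assms unfolding wf_turing_machine_def effect_def by (auto simp: nth_mem)

lemma tm_step_effect:
  "tm_step M c = (fst (effect (fst c) (scan c)), map2 tape_act (snd (effect (fst c) (scan c))) (snd c))"
  by (cases c) (auto simp: tm_step_def effect_def scan_def Let_def map2_map_map zip_map1 zip_same_conv_map
      intro!: nth_equalityI)

lemma scan_bound: "valid_config c \<Longrightarrow> length (scan c) = K \<and> (\<forall>a \<in> set (scan c). a < tm_symbols M)"
  unfolding valid_config_def scan_def tape_read_def
  by (auto simp: in_set_conv_nth) (metis fst_conv)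

lemma scan_nth: "valid_config c \<Longrightarrow> k < K \<Longrightarrow> scan c ! k = tape_read (snd c ! k)"
  by (simp add: scan_def valid_config_def)

lemma step_nth:
  assumes "valid_config c" "k < K"
  shows "snd (tm_step M c) ! k = tape_act (snd (effect (fst c) (scan c)) ! k) (snd c ! k)"
  using assms effect_bounds[of "fst c" "scan c"] scan_bound[OF assms(1)]
  by (simp add: tm_step_effect valid_config_def)

lemma valid_step: "valid_config c \<Longrightarrow> valid_config (tm_step M c)"
  using effect_bounds[of "fst c" "scan c"] scan_bound[of c]
  by (auto simp: valid_config_def tm_step_effect tape_act_def)

lemma valid_init: "valid_config (tm_init M w)"
  using wf unfolding valid_config_def wf_turing_machine_def tm_init_def
  by (auto simp: nth_Cons input_tape_def blank_tape_def bit_symbol_def split: nat.split)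

definition config :: "bool list \<Rightarrow> nat \<Rightarrow> tm_config" where
  "config w t = (tm_step M ^^ t) (tm_init M w)"

lemma config_Suc: "config w (Suc t) = tm_step M (config w t)"
  by (simp add: config_def)

lemma valid_run: "valid_config (config w t)"
  by (induction t) (auto simp: config_Suc valid_step, simp add: config_def valid_init)

lemma head_bound: "k < K \<Longrightarrow> \<bar>snd (snd (config w t) ! k)\<bar> \<le> int t"
proof (induction t)
  case 0
  then show ?case by (auto simp: config_def tm_init_def nth_Cons input_tape_def blank_tape_def split: nat.split)
next
  case (Suc t)
  let ?m = "snd (snd (effect (fst (config w t)) (scan (config w t))) ! k)"
  have "\<bar>head_shift ?m\<bar> \<le> 1" by (cases ?m) auto
  then have "\<bar>snd (snd (config w t) ! k) + head_shift ?m\<bar> \<le> 1 + int t" using Suc by linarith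
  then show ?case using Suc.prems by (simp add: config_Suc step_nth[OF valid_run] tape_act_def)
qed

definition transition :: "tm_config \<Rightarrow> nat" where
  "transition c = (SOME e. e < length E \<and> E ! e = scan c @ [fst c])"

lemma transition:
  assumes "valid_config c"
  shows "transition c < length E" "E ! transition c = scan c @ [fst c]"
proof -
  have "scan c @ [fst c] \<in> set E"
    using scan_bound[OF assms] assms by (auto simp: E valid_config_def)
  then have "\<exists>e. e < length E \<and> E ! e = scan c @ [fst c]" by (metis in_set_conv_nth)
  from someI_ex[OF this] show "transition c < length E" "E ! transition c = scan c @ [fst c]"
    unfolding transition_def by auto
qed

lemma E_length: "e < length E \<Longrightarrow> length (E ! e) = Suc K"
  using E nth_mem[of e E] by auto

lemma next_state_transition: "e < length E \<Longrightarrow> E ! e = scan c @ [fst c] \<Longrightarrow> next_state e = fst (tm_step M c)"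
  by (simp add: next_state_def tm_step_effect)

text \<open>\<open>moved\<close> is the head shift plus one, which avoids negative numbers; hence
  the \<open>+ 1\<close> in the equation for the head.\<close>

lemma step_transition:
  assumes "valid_config c" "e < length E" "E ! e = scan c @ [fst c]" "k < K"
  shows "fst (snd (tm_step M c) ! k) = (fst (snd c ! k))(snd (snd c ! k) := written e k)"
    and "snd (snd (tm_step M c) ! k) + 1 = snd (snd c ! k) + int (moved e k)"
proof -
  have "head_shift m = int (move_code m) - 1" for m by (cases m) (auto simp: move_code_def)
  then show "fst (snd (tm_step M c) ! k) = (fst (snd c ! k))(snd (snd c ! k) := written e k)"
    "snd (snd (tm_step M c) ! k) + 1 = snd (snd c ! k) + int (moved e k)"
    using assms by (simp_all add: step_nth tape_act_def written_def moved_def)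
qed

lemma entry_transition:
  assumes "valid_config c" "e < length E" "E ! e = scan c @ [fst c]"
  shows "k < K \<Longrightarrow> entry e k = tape_read (snd c ! k)" "entry e K = fst c"
  using assms scan_bound[OF assms(1)] scan_nth[OF assms(1)] by (auto simp: entry_def nth_append)

text \<open>Halting is absorbing, so the answer is still there at the uniform time bound even if the
  pair is shorter than \<open>input_bound\<close> allows.\<close>

lemma final_cell:
  assumes "length y \<le> poly p (length x)"
  shows "fst (snd (config (pair_strings x y) (time_bound (length x))) ! (K - 1)) 0 =
     (if pair_strings x y \<in> W then 2 else 1)"
proof -
  let ?w = "pair_strings x y"
  define c where "c = config ?w (poly q (length ?w))"
  have h: "fst c = tm_halt M" "tape_holds (last (snd c)) [?w \<in> W]"
    using computes unfolding tm_computes_in_time_def Let_def c_def config_def by auto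
  have "length ?w \<le> input_bound (length x)"
    using assms by (simp add: pair_strings_length input_bound_def)
  then have le: "poly q (length ?w) \<le> time_bound (length x)"
    unfolding time_bound_def by (rule poly_nat_mono)
  have halt: "(tm_step M ^^ n) c = c" for n
    by (induction n) (use h in \<open>auto simp: tm_step_def\<close>)
  have "config ?w (time_bound (length x)) = (tm_step M ^^ (time_bound (length x) - poly q (length ?w))) c"
    using le unfolding c_def config_def by (simp flip: funpow_add comp_apply[of "_ ^^ _" "_ ^^ _"])
  then have "config ?w (time_bound (length x)) = c" by (simp add: halt)
  moreover have "last (snd c) = snd c ! (K - 1)"
  proof -
    have "length (snd c) = K" using valid_run by (simp add: c_def valid_config_def)
    then show ?thesis using K_pos last_conv_nth[of "snd c"] by fastforce
  qed
  ultimately show ?thesis using h(2) by (simp add: tape_holds_def bit_symbol_def)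
qed

end

context tableau
begin

section \<open>Assignments of the tableau and accepted certificates\<close>

lemma base_bounds:
  "time_bound n < base n" "origin n + input_bound n < base n" "origin n + time_bound n + 1 < base n"
  "K < base n" "tm_states M < base n" "tm_symbols M < base n" "length E < base n" "11 < base n"
  by (auto simp: base_def origin_def)

lemma input_tape_cell:
  "fst (input_tape w) (int c - int d) = (if d \<le> c \<and> c - d < length w then bit_symbol (w ! (c - d)) else 0)"
  by (auto simp: input_tape_def nat_diff_distrib')

lemma init_cell:
  "k < K \<Longrightarrow> fst (snd (config w 0) ! k) i = (if k = 0 then fst (input_tape w) i else 0)"
  by (cases k) (auto simp: config_def tm_init_def blank_tape_def)

lemma head_cell:
  assumes "k < K" "t \<le> time_bound n"
  obtains h where "h < base n" "int h = snd (snd (config w t) ! k) + int (origin n)"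
proof -
  have "\<bar>snd (snd (config w t) ! k)\<bar> \<le> int (time_bound n)" using head_bound[OF assms(1), of w t] assms(2) by simp
  then have "0 \<le> snd (snd (config w t) ! k) + int (origin n)"
    "snd (snd (config w t) ! k) + int (origin n) < int (base n)"
    using base_bounds(3)[of n] by (auto simp: origin_def)
  then show ?thesis using that[of "nat (snd (snd (config w t) ! k) + int (origin n))"] by auto
qed

text \<open>A satisfying assignment may contain more than the facts of a run, for instance several
  symbols in one cell. The clauses that propagate facts force it to contain all facts of the run on
  a suitable certificate, and kind 10, the only clause without positive literals, excludes
  rejection.\<close>

lemma tableau_sound:
  assumes "tableau_sat x A"
  shows "\<exists>y. length y \<le> poly p (length x) \<and> pair_strings x y \<in> W"
proof -
  define n where "n = length x"
  define B where "B = base n"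
  define T where "T = time_bound n"
  define Or where "Or = origin n"
  note bb = base_bounds[of n, folded B_def T_def Or_def]
  have cl: "\<exists>g a b1 b2 b3 b4. g < 2 \<and> occurs x f t k c r s g a b1 b2 b3 b4 \<and> (A a b1 b2 b3 b4 \<longleftrightarrow> g = 0)"
    if "f < B" "t < B" "k < B" "c < B" "r < B" "s < B" "active x f t k c r s" for f t k c r s
    using assms[unfolded tableau_sat_def, rule_format, folded n_def, folded B_def, OF that] by blast
  have c0: "A 2 t k s 0" if "t < B" "k < B" "c < B" "s < B" "A 0 t k c 0" "A 1 t k c s" for t k c s
    using cl[of 0 t k c 0 s] that bb by (auto simp: active_def occurs_def)
  have c1: "A 3 t s 0 0" if "t < B" "s < length E" "\<And>k. k \<le> K \<Longrightarrow> A 2 t k (entry s k) 0" for t s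
    using cl[of 1 t 0 0 0 s] that bb by (auto simp: active_def occurs_def)
  have c2: "A 2 (Suc t) K (next_state s) 0" if "t < T" "s < length E" "A 3 t s 0 0" for t s
    using cl[of 2 t 0 0 0 s] that bb by (auto simp: active_def occurs_def T_def n_def)
  have c3: "A 1 (Suc t) k c (written s k)"
    if "t < T" "s < length E" "k < K" "c < B" "A 3 t s 0 0" "A 0 t k c 0" for t s k c
    using cl[of 3 t k c 0 s] that bb by (auto simp: active_def occurs_def T_def n_def)
  have c4: "A 0 (Suc t) k r 0"
    if "t < T" "s < length E" "k < K" "c < B" "r < B" "r + 1 = c + moved s k" "A 3 t s 0 0" "A 0 t k c 0"
    for t s k c r
    using cl[of 4 t k c r s] that bb by (auto simp: active_def occurs_def T_def n_def)
  have c5: "A 1 (Suc t) k c s"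
    if "t < T" "k < B" "c < B" "r < B" "s < B" "c \<noteq> r" "A 0 t k r 0" "A 1 t k c s" for t k c r s
    using cl[of 5 t k c r s] that bb by (auto simp: active_def occurs_def T_def n_def)
  have c6: "A 0 0 k Or 0" if "k < K" for k
    using cl[of 6 0 k 0 0 0] that bb by (auto simp: active_def occurs_def Or_def n_def)
  have c7: "A 2 0 K (tm_start M) 0"
    using cl[of 7 0 0 0 0 0] bb by (auto simp: active_def occurs_def)
  have c8: "\<exists>s. allowed x k c s \<and> A 1 0 k c s" if "k < K" "c < B" for k c
    using cl[of 8 0 k c 0 0] that bb by (auto simp: active_def occurs_def)
  have c9: "A 1 0 0 (Suc c) 0"
    if "Or + 2 * n + 2 \<le> c" "c + 1 < Or + input_bound n" "A 1 0 0 c 0" for c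
    using cl[of 9 0 0 c 0 0] that bb by (auto simp: active_def occurs_def Or_def n_def)
  have c10: "\<not> A 1 T (K - 1) Or 1"
    using cl[of 10 0 0 0 0 0] bb by (auto simp: active_def occurs_def T_def Or_def n_def)
  define P where "P = poly p n"
  define Y where "Y = Or + 2 * n + 2"
  have YP: "Or + input_bound n = Y + P" by (simp add: Y_def P_def input_bound_def)
  \<comment> \<open>The certificate ends before the first cell that holds neither bit; the clauses
    of kind 9 make the cells from there on blank. If a cell holds both bits, the symbol 2 is
    taken.\<close>
  define bit where "bit i \<longleftrightarrow> A 1 0 0 (Y + i) 1 \<or> A 1 0 0 (Y + i) 2" for i
  define len where "len = (LEAST i. i = P \<or> \<not> bit i)"
  have len: "len = P \<or> \<not> bit len" unfolding len_def by (rule LeastI[of _ P]) simp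
  have lenP: "len \<le> P" unfolding len_def by (rule Least_le) simp
  have bits: "bit i" if "i < len" for i using not_less_Least[OF that[unfolded len_def]] by blast
  have blank: "A 1 0 0 (Y + i) 0" if "len \<le> i" "i < P" for i
    using that
  proof (induction i rule: dec_induct)
    case base
    then have "\<not> bit len" using len by simp
    obtain s where s: "allowed x 0 (Y + len) s" "A 1 0 0 (Y + len) s"
      using c8[of 0 "Y + len"] K_pos base bb YP by auto
    then have "s \<le> 2"
      using base YP by (auto simp: allowed_def Y_def Or_def n_def split: if_splits)
    then have "s = 0 \<or> s = 1 \<or> s = 2" by linarith
    then show ?case using s(2) \<open>\<not> bit len\<close> by (auto simp: bit_def)
  next
    case (step i)
    then show ?case using c9[of "Y + i"] YP by (auto simp: Y_def)
  qed
  define y where "y = map (\<lambda>i. A 1 0 0 (Y + i) 2) [0..<len]"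
  define w where "w = pair_strings x y"
  have lw: "length w = 2 * n + 2 + len" by (simp add: w_def pair_strings_length y_def n_def)
  have init: "A 1 0 k c (fst (snd (config w 0) ! k) (int c - int Or))" if k: "k < K" and c: "c < B" for k c
  proof -
    obtain s where s: "allowed x k c s" "A 1 0 k c s" using c8[OF k c] by blast
    let ?v = "fst (snd (config w 0) ! k) (int c - int Or)"
    show ?thesis
    proof (cases "k = 0")
      case False
      then have "s = 0" "?v = 0" using s(1) k by (auto simp: allowed_def init_cell)
      then show ?thesis using s(2) by simp
    next
      case True
      have v: "?v = (if Or \<le> c \<and> c - Or < length w then bit_symbol (w ! (c - Or)) else 0)"
        using True k by (simp add: init_cell input_tape_cell)
      consider "c < Or \<or> Y + P \<le> c" | "Or \<le> c" "c < Y" | "Y \<le> c" "c < Y + P" by linarith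
      then show ?thesis
      proof cases
        case 1
        then have "?v = 0" unfolding v lw using lenP by (auto simp: Y_def)
        moreover have "s = 0" using 1 s(1) YP unfolding allowed_def Y_def Or_def n_def
          by (auto split: if_splits)
        ultimately show ?thesis using s(2) by simp
      next
        case 2
        have "?v = bit_symbol (w ! (c - Or))" unfolding v lw using 2 by (auto simp: Y_def)
        moreover have "s = bit_symbol (w ! (c - Or))"
          using 2 s(1) True unfolding w_def pair_strings_nth allowed_def Y_def Or_def n_def
          by (auto simp: bit_symbol_def split: if_splits)
        ultimately show ?thesis using s(2) by simp
      next
        case 3
        define i where "i = c - Y"
        have i: "c = Y + i" "i < P" using 3 by (auto simp: i_def)
        show ?thesis
        proof (cases "i < len")
          case False
          then have "?v = 0" unfolding v lw using i by (auto simp: Y_def)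
          then show ?thesis using blank[of i] False i True by simp
        next
          case t: True
          have "w ! (c - Or) = A 1 0 0 (Y + i) 2"
            using i t unfolding w_def pair_strings_nth by (simp add: Y_def n_def y_def)
          then have "?v = bit_symbol (A 1 0 0 (Y + i) 2)" unfolding v lw using i t by (auto simp: Y_def)
          then show ?thesis using bits[OF t] i True by (auto simp: bit_def bit_symbol_def)
        qed
      qed
    qed
  qed
  have inv: "A 2 t K (fst (config w t)) 0 \<and>
      (\<forall>k < K. \<forall>h. int h = snd (snd (config w t) ! k) + int Or \<longrightarrow> A 0 t k h 0) \<and>
      (\<forall>k < K. \<forall>c < B. A 1 t k c (fst (snd (config w t) ! k) (int c - int Or)))" if "t \<le> T" for t
    using that
  proof (induction t)
    case 0
    have "fst (config w 0) = tm_start M" by (simp add: config_def tm_init_def)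
    moreover have "snd (snd (config w 0) ! k) = 0" if "k < K" for k
      using head_bound[OF that, of w 0] by simp
    ultimately show ?case using c6 c7 init by simp
  next
    case (Suc t)
    let ?c = "config w t"
    have tT: "t < T" "t < B" using Suc.prems bb by auto
    have val: "valid_config ?c" by (rule valid_run)
    define e where "e = transition ?c"
    note e = transition[OF val, folded e_def]
    have st: "A 2 t K (fst ?c) 0"
      and hd: "\<And>k h. k < K \<Longrightarrow> int h = snd (snd ?c ! k) + int Or \<Longrightarrow> A 0 t k h 0"
      and ct: "\<And>k c. k < K \<Longrightarrow> c < B \<Longrightarrow> A 1 t k c (fst (snd ?c ! k) (int c - int Or))"
      using Suc by auto
    have sym: "fst (snd ?c ! k) i < B" if "k < K" for k i
      using val that bb by (meson less_trans valid_config_def)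
    have rd: "A 2 t k (entry e k) 0" if "k \<le> K" for k
    proof (cases "k = K")
      case True
      then show ?thesis using entry_transition(2)[OF val e] st by simp
    next
      case False
      then have k: "k < K" using that by simp
      obtain h where h: "h < B" "int h = snd (snd ?c ! k) + int Or"
        using head_cell[OF k, of t n w] tT by (auto simp: B_def T_def Or_def)
      have "A 1 t k h (tape_read (snd ?c ! k))"
        using ct[OF k h(1)] h(2) by (simp add: tape_read_def)
      moreover have "tape_read (snd ?c ! k) < B" using sym[OF k] by (simp add: tape_read_def)
      ultimately show ?thesis
        using c0[OF tT(2) _ h(1) _ hd[OF k h(2)]] k bb entry_transition(1)[OF val e k] by simp
    qed
    have tr: "A 3 t e 0 0" by (rule c1[OF tT(2) e(1) rd])
    have "A 2 (Suc t) K (fst (config w (Suc t))) 0"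
      using c2[OF tT(1) e(1) tr] next_state_transition[OF e] by (simp add: config_Suc)
    moreover have "A 0 (Suc t) k h' 0" if k: "k < K" and h': "int h' = snd (snd (config w (Suc t)) ! k) + int Or" for k h'
    proof -
      obtain h where h: "h < B" "int h = snd (snd ?c ! k) + int Or"
        using head_cell[OF k, of t n w] tT by (auto simp: B_def T_def Or_def)
      have "int h' + 1 = int h + int (moved e k)"
        using step_transition(2)[OF val e k] h' h(2) by (simp add: config_Suc)
      then have eq: "h' + 1 = h + moved e k" by linarith
      obtain h'' where "h'' < B" "int h'' = snd (snd (config w (Suc t)) ! k) + int Or"
        using head_cell[OF k, of "Suc t" n w] Suc.prems by (auto simp: B_def T_def Or_def)
      then have "h' < B" using h' by simp
      then show ?thesis using c4[OF tT(1) e(1) k h(1) _ eq tr hd[OF k h(2)]] by blast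
    qed
    moreover have "A 1 (Suc t) k c (fst (snd (config w (Suc t)) ! k) (int c - int Or))"
      if k: "k < K" and c: "c < B" for k c
    proof -
      obtain h where h: "h < B" "int h = snd (snd ?c ! k) + int Or"
        using head_cell[OF k, of t n w] tT by (auto simp: B_def T_def Or_def)
      have v: "fst (snd (config w (Suc t)) ! k) (int c - int Or) =
          (if c = h then written e k else fst (snd ?c ! k) (int c - int Or))"
        using step_transition(1)[OF val e k] h(2) by (auto simp: config_Suc)
      show ?thesis
      proof (cases "c = h")
        case True
        then show ?thesis using v c3[OF tT(1) e(1) k h(1) tr hd[OF k h(2)]] by simp
      next
        case False
        then show ?thesis
          using v c5[OF tT(1) _ c h(1) sym[OF k] False hd[OF k h(2)] ct[OF k c]] k bb by simp
      qed
    qed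
    ultimately show ?case by blast
  qed
  have ly: "length y \<le> poly p (length x)" using lenP by (simp add: y_def P_def n_def)
  have "A 1 T (K - 1) Or (fst (snd (config w T) ! (K - 1)) 0)"
  proof -
    have "K - 1 < K" "Or < B" using K_pos bb by auto
    then have "A 1 T (K - 1) Or (fst (snd (config w T) ! (K - 1)) (int Or - int Or))"
      using inv[of T] by blast
    then show ?thesis by simp
  qed
  then have "w \<in> W"
    using final_cell[OF ly] c10 by (auto simp: w_def T_def n_def split: if_splits)
  then show ?thesis using ly by (auto simp: w_def)
qed

text \<open>The atoms receive exactly the truth values that they have in the run on the
  certificate.\<close>

lemma tableau_complete:
  assumes y: "length y \<le> poly p (length x)" and acc: "pair_strings x y \<in> W"
  shows "\<exists>A. tableau_sat x A"
proof -
  define n where "n = length x"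
  define B where "B = base n"
  define T where "T = time_bound n"
  define Or where "Or = origin n"
  note bb = base_bounds[of n, folded B_def T_def Or_def]
  define w where "w = pair_strings x y"
  define hd where "hd t k = snd (snd (config w t) ! k)" for t k
  define ct where "ct t k = fst (snd (config w t) ! k)" for t k
  define A where "A a t b c d \<longleftrightarrow>
     a = 0 \<and> b < K \<and> d = 0 \<and> int c = hd t b + int Or \<or>
     a = 1 \<and> b < K \<and> ct t b (int c - int Or) = d \<or>
     a = 2 \<and> d = 0 \<and> (b < K \<and> ct t b (hd t b) = c \<or> b = K \<and> fst (config w t) = c) \<or>
     a = 3 \<and> c = 0 \<and> d = 0 \<and> b < length E \<and> E ! b = scan (config w t) @ [fst (config w t)]"
    for a t b c d :: nat
  have A0: "A 0 t k c d \<longleftrightarrow> k < K \<and> d = 0 \<and> int c = hd t k + int Or" for t k c d by (simp add: A_def)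
  have A1: "A 1 t k c s \<longleftrightarrow> k < K \<and> ct t k (int c - int Or) = s" for t k c s by (simp add: A_def)
  have A2: "A 2 t k s d \<longleftrightarrow> d = 0 \<and> (k < K \<and> ct t k (hd t k) = s \<or> k = K \<and> fst (config w t) = s)"
    for t k s d by (simp add: A_def)
  have A3: "A 3 t e c d \<longleftrightarrow> c = 0 \<and> d = 0 \<and> e < length E \<and> E ! e = scan (config w t) @ [fst (config w t)]"
    for t e c d by (simp add: A_def)
  have val: "valid_config (config w t)" for t by (rule valid_run)
  have sym: "ct t k i < tm_symbols M" if "k < K" for t k i
    using val[of t] that by (simp add: valid_config_def ct_def)
  have stt: "fst (config w t) < tm_states M" for t using val[of t] by (simp add: valid_config_def)
  have entry_B: "entry e k < B" for e k
  proof (cases "e < length E \<and> k < Suc K")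
    case True
    then have "E ! e \<in> set E" by simp
    then obtain ss s where ss: "E ! e = ss @ [s]" "length ss = K" "\<forall>a \<in> set ss. a < tm_symbols M" "s < tm_states M"
      unfolding E by auto
    then have "ss ! k < tm_symbols M" if "k < K" using that by simp
    then have "ss ! k < B" if "k < K" using that bb less_trans by blast
    then show ?thesis using True bb ss by (auto simp: entry_def nth_append less_Suc_eq)
  qed (use bb in \<open>auto simp: entry_def\<close>)
  have lw: "length w = 2 * n + 2 + length y" by (simp add: w_def pair_strings_length n_def)
  have c0: "ct 0 k (int c - int Or) =
      (if k = 0 \<and> Or \<le> c \<and> c - Or < length w then bit_symbol (w ! (c - Or)) else 0)" if "k < K" for k c
    using that by (simp add: ct_def init_cell input_tape_cell)
  let ?G = "\<lambda>f t k c r s. \<exists>g a b1 b2 b3 b4. g < 2 \<and> a < B \<and> b1 < B \<and> b2 < B \<and> b3 < B \<and> b4 < B \<and>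
        occurs x f t k c r s g a b1 b2 b3 b4 \<and> (A a b1 b2 b3 b4 \<longleftrightarrow> g = 0)"
  have lit: "?G f t k c r s"
    if "occurs x f t k c r s g a b1 b2 b3 b4" "A a b1 b2 b3 b4 \<longleftrightarrow> g = 0"
      "g < 2" "a < B" "b1 < B" "b2 < B" "b3 < B" "b4 < B" for f t k c r s g a b1 b2 b3 b4
    using that by blast
  have "?G f t k c r s"
    if fB: "f < B" and tB: "t < B" and kB: "k < B" and cB: "c < B" and rB: "r < B" and sB: "s < B"
      and act: "active x f t k c r s" for f t k c r s
  proof -
    have B0: "0 < B" "2 < B" "3 < B" "1 < B" using bb by auto
    \<comment> \<open>The case with number k belongs to the clauses of kind
      \<open>k - 1\<close>.\<close>
    consider "f = 0" | "f = 1" "s < length E" | "f = 2" "s < length E" "t < T"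
      | "f = 3" "s < length E" "t < T" "k < K"
      | "f = 4" "s < length E" "t < T" "k < K" "r + 1 = c + moved s k"
      | "f = 5" "t < T" "c \<noteq> r" | "f = 6" "k < K" | "f = 7" | "f = 8" "k < K"
      | "f = 9" "Or + 2 * n + 2 \<le> c" "c + 1 < Or + input_bound n" | "f = 10"
      using act unfolding active_def T_def Or_def n_def by metis
    then show ?thesis
    proof cases
      case 1
      show ?thesis
      proof (cases "A 0 t k c 0 \<and> A 1 t k c s")
        case True
        then have "A 2 t k s 0" unfolding A0 A1 A2 by auto
        then show ?thesis by (intro lit[of _ _ _ _ _ _ 0 2 t k s 0]) (use 1 B0 tB kB sB in \<open>auto simp: occurs_def\<close>)
      next
        case False
        then show ?thesis
          using lit[of f t k c r s 1 0 t k c 0] lit[of f t k c r s 1 1 t k c s] 1 B0 tB kB cB sB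
          by (auto simp: occurs_def)
      qed
    next
      case 2
      show ?thesis
      proof (cases "\<forall>k \<le> K. A 2 t k (entry s k) 0")
        case True
        have l: "length (scan (config w t)) = K" using scan_bound[OF val] by simp
        have "E ! s = scan (config w t) @ [fst (config w t)]"
        proof (rule nth_equalityI)
          show "length (E ! s) = length (scan (config w t) @ [fst (config w t)])"
            using E_length[OF 2(2)] l by simp
          fix i assume "i < length (E ! s)"
          then have "i \<le> K" using E_length[OF 2(2)] by simp
          then have "A 2 t i (entry s i) 0" using True by blast
          then show "E ! s ! i = (scan (config w t) @ [fst (config w t)]) ! i"
            using 2(2) \<open>i \<le> K\<close> l unfolding A2 entry_def
            by (auto simp: nth_append ct_def hd_def scan_nth[OF val] tape_read_def)
        qed
        then have "A 3 t s 0 0" using 2 by (simp add: A3)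
        then show ?thesis by (intro lit[of _ _ _ _ _ _ 0 3 t s 0 0]) (use 2 B0 tB sB in \<open>auto simp: occurs_def\<close>)
      next
        case False
        then obtain k' where k': "k' \<le> K" "\<not> A 2 t k' (entry s k') 0" by blast
        then show ?thesis using bb
          by (intro lit[of _ _ _ _ _ _ 1 2 t k' "entry s k'" 0]) (use 2 B0 tB entry_B in \<open>auto simp: occurs_def\<close>)
      qed
    next
      case 3
      show ?thesis
      proof (cases "A 3 t s 0 0")
        case True
        then have "fst (config w (Suc t)) = next_state s"
          using next_state_transition[of s "config w t"] by (simp add: A3 config_Suc)
        then have "A 2 (t + 1) K (next_state s) 0" "next_state s < B"
          using stt[of "Suc t"] bb by (auto simp: A2)
        then show ?thesis
          by (intro lit[of _ _ _ _ _ _ 0 2 "t + 1" K "next_state s" 0]) (use 3 B0 bb in \<open>auto simp: occurs_def\<close>)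
      next
        case False
        then show ?thesis
          by (intro lit[of _ _ _ _ _ _ 1 3 t s 0 0]) (use 3 B0 tB sB in \<open>auto simp: occurs_def\<close>)
      qed
    next
      case 4
      show ?thesis
      proof (cases "A 3 t s 0 0 \<and> A 0 t k c 0")
        case True
        then have e: "s < length E" "E ! s = scan (config w t) @ [fst (config w t)]" by (auto simp: A3)
        have "ct (Suc t) k (int c - int Or) = written s k"
          using step_transition(1)[OF val e 4(4)] True by (auto simp: ct_def hd_def config_Suc A0)
        then have "A 1 (t + 1) k c (written s k)" "written s k < B"
          using 4 sym[OF 4(4), of "Suc t" "int c - int Or"] bb by (auto simp: A1[unfolded One_nat_def])
        then show ?thesis
          by (intro lit[of _ _ _ _ _ _ 0 1 "t + 1" k c "written s k"]) (use 4 B0 bb cB kB in \<open>auto simp: occurs_def\<close>)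
      next
        case False
        then show ?thesis
          using lit[of f t k c r s 1 3 t s 0 0] lit[of f t k c r s 1 0 t k c 0] 4 B0 tB kB cB sB
          by (auto simp: occurs_def)
      qed
    next
      case 5
      show ?thesis
      proof (cases "A 3 t s 0 0 \<and> A 0 t k c 0")
        case True
        then have e: "s < length E" "E ! s = scan (config w t) @ [fst (config w t)]" by (auto simp: A3)
        have "int r = hd (Suc t) k + int Or"
          using step_transition(2)[OF val e 5(4)] True 5(5) by (simp add: hd_def config_Suc A0)
        then have "A 0 (t + 1) k r 0" using 5 by (auto simp: A0)
        then show ?thesis
          by (intro lit[of _ _ _ _ _ _ 0 0 "t + 1" k r 0]) (use 5 B0 bb rB kB in \<open>auto simp: occurs_def\<close>)
      next
        case False
        then show ?thesis
          using lit[of f t k c r s 1 3 t s 0 0] lit[of f t k c r s 1 0 t k c 0] 5 B0 tB kB cB sB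
          by (auto simp: occurs_def)
      qed
    next
      case 6
      show ?thesis
      proof (cases "A 0 t k r 0 \<and> A 1 t k c s")
        case True
        then have k: "k < K" "int c - int Or \<noteq> hd t k" "ct t k (int c - int Or) = s"
          using 6 by (auto simp: A0 A1[unfolded One_nat_def])
        have "ct (Suc t) k (int c - int Or) = s"
          using step_transition(1)[OF val transition[OF val] k(1)] k by (simp add: ct_def hd_def config_Suc)
        then have "A 1 (t + 1) k c s" using k by (auto simp: A1[unfolded One_nat_def])
        then show ?thesis
          by (intro lit[of _ _ _ _ _ _ 0 1 "t + 1" k c s]) (use 6 B0 bb cB kB sB in \<open>auto simp: occurs_def\<close>)
      next
        case False
        then show ?thesis
          using lit[of f t k c r s 1 0 t k r 0] lit[of f t k c r s 1 1 t k c s] 6 B0 tB kB cB rB sB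
          by (auto simp: occurs_def)
      qed
    next
      case 7
      have "A 0 0 k Or 0" using 7 head_bound[OF 7(2), of w 0] by (simp add: A0 hd_def)
      then show ?thesis
        by (intro lit[of _ _ _ _ _ _ 0 0 0 k Or 0]) (use 7 B0 bb kB in \<open>auto simp: occurs_def Or_def n_def\<close>)
    next
      case 8
      have "A 2 0 K (tm_start M) 0" by (simp add: A2 config_def tm_init_def)
      moreover have "tm_start M < B" using stt[of 0] bb by (simp add: config_def tm_init_def)
      ultimately show ?thesis
        by (intro lit[of _ _ _ _ _ _ 0 2 0 K "tm_start M" 0]) (use 8 B0 bb in \<open>auto simp: occurs_def\<close>)
    next
      case 9
      let ?s = "ct 0 k (int c - int Or)"
      have "A 1 0 k c ?s" using 9 by (simp add: A1[unfolded One_nat_def])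
      moreover have "?s < B" using sym[OF 9(2), of 0] bb less_trans by blast
      moreover have "allowed x k c ?s"
      proof (cases "k = 0 \<and> Or \<le> c \<and> c < Or + length w")
        case True
        define i where "i = c - Or"
        have i: "c = Or + i" "i < length w" using True by (auto simp: i_def)
        have s: "?s = bit_symbol (w ! i)" using c0[OF 9(2), of c] True i by simp
        consider "i < 2 * n" | "i = 2 * n" | "i = 2 * n + 1" | "2 * n + 2 \<le> i" by linarith
        then show ?thesis
        proof cases
          case 1
          then have "w ! i = x ! (i div 2)" "i div 2 < length x"
            by (auto simp: w_def pair_strings_nth n_def)
          then show ?thesis using 1 True i(1) s
            by (auto simp: allowed_def bit_symbol_def Or_def n_def)
        next
          case 2
          then have "\<not> w ! i" by (auto simp: w_def pair_strings_nth n_def)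
          then show ?thesis using 2 True i(1) s by (simp add: allowed_def bit_symbol_def Or_def n_def)
        next
          case 3
          then have "w ! i" by (auto simp: w_def pair_strings_nth n_def)
          then show ?thesis using 3 True i(1) s by (simp add: allowed_def bit_symbol_def Or_def n_def)
        next
          case 4
          have "i < input_bound n" using i(2) y by (simp add: lw input_bound_def n_def)
          moreover have "?s \<le> 2" unfolding s by (simp add: bit_symbol_def)
          ultimately show ?thesis using 4 True i(1) by (simp add: allowed_def Or_def n_def)
        qed
      next
        case False
        then have "?s = 0" using c0[OF 9(2), of c] by auto
        then show ?thesis using False lw by (auto simp: allowed_def Or_def n_def)
      qed
      ultimately show ?thesis
        by (intro lit[of _ _ _ _ _ _ 0 1 0 k c ?s]) (use 9 B0 bb cB kB in \<open>auto simp: occurs_def\<close>)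
    next
      case 10
      show ?thesis
      proof (cases "A 1 0 0 c 0")
        case True
        then have "ct 0 0 (int c - int Or) = 0" "0 < K" using K_pos by (auto simp: A1[unfolded One_nat_def])
        then have "ct 0 0 (int (c + 1) - int Or) = 0"
          using 10 unfolding c0[OF \<open>0 < K\<close>] lw by (auto simp: bit_symbol_def split: if_splits)
        then have "A 1 0 0 (c + 1) 0" using \<open>0 < K\<close> by (simp add: A1[unfolded One_nat_def])
        then show ?thesis
          by (intro lit[of _ _ _ _ _ _ 0 1 0 0 "c + 1" 0]) (use 10 B0 bb in \<open>auto simp: occurs_def\<close>)
      next
        case False
        then show ?thesis
          by (intro lit[of _ _ _ _ _ _ 1 1 0 0 c 0]) (use 10 B0 bb cB in \<open>auto simp: occurs_def\<close>)
      qed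
    next
      case 11
      have "ct T (K - 1) 0 = 2"
        using final_cell[OF y] acc by (simp add: ct_def T_def n_def w_def)
      then have "\<not> A 1 T (K - 1) Or 1" by (simp add: A1[unfolded One_nat_def])
      then show ?thesis
        by (intro lit[of _ _ _ _ _ _ 1 1 T "K - 1" Or 1]) (use 11 B0 bb in \<open>auto simp: occurs_def T_def Or_def n_def\<close>)
    qed
  qed
  then have "tableau_sat x A" unfolding tableau_sat_def B_def n_def by blast
  then show ?thesis by blast
qed

end

section \<open>The reduction\<close>

lemma definable_digit:
  assumes "definable A" "definable U"
  shows "definable (\<lambda>x \<rho>. digit (A x \<rho>) (U x \<rho>) i)"
  unfolding digit_def using assms by (intro definable_intros)

lemma definable_pred_even: "definable A \<Longrightarrow> definable_pred (\<lambda>x \<rho>. even (A x \<rho>))"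
  unfolding even_iff_mod_2_eq_zero by (intro definable_intros)

lemma definable_complement_lit: "definable A \<Longrightarrow> definable (\<lambda>x \<rho>. complement_lit (A x \<rho>))"
  unfolding complement_lit_def by (intro definable_intros definable_pred_even)

lemma definable_pred_forcer_arc:
  "definable A \<Longrightarrow> definable B \<Longrightarrow> definable_pred (\<lambda>x \<rho>. forcer_arc (A x \<rho>) (B x \<rho>))"
  unfolding forcer_arc_def by (intro definable_intros)

lemma definable_pred_gadget_arc:
  assumes "\<And>J L. definable J \<Longrightarrow> definable L \<Longrightarrow> definable_pred (\<lambda>x \<rho>. occ x (J x \<rho>) (L x \<rho>))"
    and "definable N" "definable G" "definable J" "definable L" "definable G'" "definable J'" "definable L'"
  shows "definable_pred (\<lambda>x \<rho>. gadget_arc (occ x) (N x \<rho>) (G x \<rho>) (J x \<rho>) (L x \<rho>) (G' x \<rho>) (J' x \<rho>) (L' x \<rho>))"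
  unfolding gadget_arc_def using assms(2-8)
  by (intro assms(1) definable_intros definable_pred_even definable_complement_lit definable_pred_forcer_arc)

context tableau
begin

text \<open>A clause that is not active contains all literals, so it always holds.\<close>

definition clause_occ :: "bool list \<Rightarrow> nat \<Rightarrow> nat \<Rightarrow> bool" where
  "clause_occ x j l \<longleftrightarrow>
     (let B = base (length x); d = digit B j; b = digit B (l div 2)
      in active x (d 0) (d 1) (d 2) (d 3) (d 4) (d 5) \<longrightarrow>
         occurs x (d 0) (d 1) (d 2) (d 3) (d 4) (d 5) (l mod 2) (b 0) (b 1) (b 2) (b 3) (b 4))"

lemma nat_less_numeral_cases:
  "(i :: nat) < 5 \<Longrightarrow> i = 0 \<or> i = 1 \<or> i = 2 \<or> i = 3 \<or> i = 4"
  "(i :: nat) < 6 \<Longrightarrow> i = 0 \<or> i = 1 \<or> i = 2 \<or> i = 3 \<or> i = 4 \<or> i = 5"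
  by linarith+

text \<open>A clause is a number with the digits f, t, k, c, r, s, an atom is a number with five
  digits, and a literal is twice an atom plus its sign. By existence and uniqueness of digits,
  assignments of numbers and of tuples correspond.\<close>

lemma satisfies_clause_occ_iff:
  "(\<exists>\<alpha>. satisfies (clause_occ x) (2 * base (length x) ^ 5) (base (length x) ^ 6) \<alpha>) \<longleftrightarrow> (\<exists>A. tableau_sat x A)"
proof
  define B where "B = base (length x)"
  have B: "0 < B" using base_bounds(8)[of "length x"] by (simp add: B_def)
  assume "\<exists>\<alpha>. satisfies (clause_occ x) (2 * base (length x) ^ 5) (base (length x) ^ 6) \<alpha>"
  then obtain \<alpha> where neg: "\<And>l. even l \<Longrightarrow> \<alpha> (l + 1) = (\<not> \<alpha> l)"
    and cl: "\<And>j. j < B ^ 6 \<Longrightarrow> \<exists>l < 2 * B ^ 5. clause_occ x j l \<and> \<alpha> l"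
    by (auto simp: satisfies_def B_def)
  define A where "A a b1 b2 b3 b4 \<longleftrightarrow> (\<exists>u < B ^ 5. digit B u 0 = a \<and> digit B u 1 = b1 \<and> digit B u 2 = b2 \<and>
     digit B u 3 = b3 \<and> digit B u 4 = b4 \<and> \<alpha> (2 * u))" for a b1 b2 b3 b4
  have A: "A (digit B u 0) (digit B u 1) (digit B u 2) (digit B u 3) (digit B u 4) \<longleftrightarrow> \<alpha> (2 * u)"
    if u: "u < B ^ 5" for u
  proof
    assume "A (digit B u 0) (digit B u 1) (digit B u 2) (digit B u 3) (digit B u 4)"
    then obtain v where v: "v < B ^ 5" "\<alpha> (2 * v)" "digit B v 0 = digit B u 0" "digit B v 1 = digit B u 1"
      "digit B v 2 = digit B u 2" "digit B v 3 = digit B u 3" "digit B v 4 = digit B u 4"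
      unfolding A_def by blast
    have "digit B v i = digit B u i" if "i < 5" for i
      using nat_less_numeral_cases(1)[OF that] v(3-7) by (elim disjE) simp_all
    then show "\<alpha> (2 * u)" using digits_unique[OF v(1) u] v(2) by simp
  qed (use u in \<open>auto simp: A_def\<close>)
  have "tableau_sat x A"
    unfolding tableau_sat_def B_def[symmetric]
  proof (intro allI impI)
    fix f t k c r s
    assume less: "f < B" "t < B" "k < B" "c < B" "r < B" "s < B" and act: "active x f t k c r s"
    have "\<exists>j < B ^ 6. \<forall>i < 6. digit B j i = [f, t, k, c, r, s] ! i"
    proof (rule number_with_digits)
      show "[f, t, k, c, r, s] ! i < B" if "i < 6" for i
        using nat_less_numeral_cases(2)[OF that] less by (elim disjE) simp_all
    qed
    then obtain j where j: "j < B ^ 6" and dig: "\<And>i. i < 6 \<Longrightarrow> digit B j i = [f, t, k, c, r, s] ! i" by blast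
    have d: "digit B j 0 = f" "digit B j 1 = t" "digit B j 2 = k" "digit B j 3 = c" "digit B j 4 = r" "digit B j 5 = s"
      using dig[of 0] dig[of 1] dig[of 2] dig[of 3] dig[of 4] dig[of 5] by simp_all
    obtain l where l: "l < 2 * B ^ 5" "clause_occ x j l" "\<alpha> l" using cl[OF j] by blast
    define u where "u = l div 2"
    have u: "u < B ^ 5" using l(1) by (simp add: u_def less_mult_imp_div_less mult.commute)
    have occ: "occurs x f t k c r s (l mod 2) (digit B u 0) (digit B u 1) (digit B u 2) (digit B u 3) (digit B u 4)"
      using l(2) act unfolding clause_occ_def Let_def B_def[symmetric] d u_def[symmetric] by blast
    have val: "\<alpha> (2 * u) \<longleftrightarrow> l mod 2 = 0"
    proof (cases "even l")
      case True
      then show ?thesis using l(3) by (simp add: u_def)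
    next
      case False
      then have "l = 2 * u + 1" by (simp add: u_def)
      then show ?thesis using l(3) neg[of "2 * u"] False by (simp add: odd_iff_mod_2_eq_one)
    qed
    show "\<exists>g a b1 b2 b3 b4. g < 2 \<and> a < B \<and> b1 < B \<and> b2 < B \<and> b3 < B \<and> b4 < B \<and>
        occurs x f t k c r s g a b1 b2 b3 b4 \<and> (A a b1 b2 b3 b4 \<longleftrightarrow> g = 0)"
    proof (intro exI conjI)
      show "occurs x f t k c r s (l mod 2) (digit B u 0) (digit B u 1) (digit B u 2) (digit B u 3) (digit B u 4)"
        by (rule occ)
      show "A (digit B u 0) (digit B u 1) (digit B u 2) (digit B u 3) (digit B u 4) \<longleftrightarrow> l mod 2 = 0"
        unfolding A[OF u] by (rule val)
    qed (simp_all add: digit_less[OF B])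
  qed
  then show "\<exists>A. tableau_sat x A" by blast
next
  define B where "B = base (length x)"
  have B: "0 < B" using base_bounds(8)[of "length x"] by (simp add: B_def)
  assume "\<exists>A. tableau_sat x A"
  then obtain A where A: "tableau_sat x A" by blast
  define b where "b u \<longleftrightarrow> A (digit B u 0) (digit B u 1) (digit B u 2) (digit B u 3) (digit B u 4)" for u
  define \<alpha> where "\<alpha> l \<longleftrightarrow> (b (l div 2) \<longleftrightarrow> even l)" for l
  have "\<alpha> (l + 1) = (\<not> \<alpha> l)" if "even l" for l using that by (auto simp: \<alpha>_def)
  moreover have "\<exists>l < 2 * B ^ 5. clause_occ x j l \<and> \<alpha> l" if "j < B ^ 6" for j
  proof -
    define d where "d = digit B j"
    show ?thesis
    proof (cases "active x (d 0) (d 1) (d 2) (d 3) (d 4) (d 5)")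
      case False
      then have "clause_occ x j l" for l unfolding clause_occ_def Let_def d_def B_def by blast
      moreover have "\<alpha> 0 \<or> \<alpha> 1" by (auto simp: \<alpha>_def)
      moreover have "0 < 2 * B ^ 5" "1 < 2 * B ^ 5" using B by (auto simp: Suc_lessI)
      ultimately show ?thesis by blast
    next
      case True
      have dl: "d i < B" for i using digit_less[OF B] by (simp add: d_def)
      obtain g a b1 b2 b3 b4 where g: "g < 2" and less: "a < B" "b1 < B" "b2 < B" "b3 < B" "b4 < B"
        and occ: "occurs x (d 0) (d 1) (d 2) (d 3) (d 4) (d 5) g a b1 b2 b3 b4"
        and val: "A a b1 b2 b3 b4 \<longleftrightarrow> g = 0"
        using A[unfolded tableau_sat_def, rule_format, folded B_def, OF dl dl dl dl dl dl True] by blast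
      have "\<exists>u < B ^ 5. \<forall>i < 5. digit B u i = [a, b1, b2, b3, b4] ! i"
      proof (rule number_with_digits)
        show "[a, b1, b2, b3, b4] ! i < B" if "i < 5" for i
          using nat_less_numeral_cases(1)[OF that] less by (elim disjE) simp_all
      qed
      then obtain u where u: "u < B ^ 5" and dig: "\<And>i. i < 5 \<Longrightarrow> digit B u i = [a, b1, b2, b3, b4] ! i" by blast
      have du: "digit B u 0 = a" "digit B u 1 = b1" "digit B u 2 = b2" "digit B u 3 = b3" "digit B u 4 = b4"
        using dig[of 0] dig[of 1] dig[of 2] dig[of 3] dig[of 4] by simp_all
      define l where "l = 2 * u + g"
      have l: "l div 2 = u" "l mod 2 = g" "l < 2 * B ^ 5" using g u by (auto simp: l_def)
      have "clause_occ x j l"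
        unfolding clause_occ_def Let_def B_def[symmetric] d_def[symmetric] l du using occ by blast
      moreover have "\<alpha> l"
        unfolding \<alpha>_def l b_def du even_iff_mod_2_eq_zero using val by simp
      ultimately show ?thesis using l(3) by blast
    qed
  qed
  ultimately show "\<exists>\<alpha>. satisfies (clause_occ x) (2 * base (length x) ^ 5) (base (length x) ^ 6) \<alpha>"
    unfolding satisfies_def B_def by blast
qed

section \<open>Definability of the tableau\<close>

lemma definable_bounds:
  "definable (\<lambda>x \<rho>. input_bound (length x))" "definable (\<lambda>x \<rho>. time_bound (length x))"
  "definable (\<lambda>x \<rho>. origin (length x))" "definable (\<lambda>x \<rho>. base (length x))"
  unfolding base_def origin_def time_bound_def input_bound_def by (intro definable_intros)+

lemma definable_tables:
  assumes "definable S" "definable J"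
  shows "definable (\<lambda>x \<rho>. entry (S x \<rho>) (J x \<rho>))" "definable (\<lambda>x \<rho>. next_state (S x \<rho>))"
    "definable (\<lambda>x \<rho>. written (S x \<rho>) (J x \<rho>))" "definable (\<lambda>x \<rho>. moved (S x \<rho>) (J x \<rho>))"
proof -
  show "definable (\<lambda>x \<rho>. entry (S x \<rho>) (J x \<rho>))"
    by (rule definable_table2[OF assms, where G = entry and n = "length E" and m = "Suc K"])
      (auto simp: entry_def)
  show "definable (\<lambda>x \<rho>. next_state (S x \<rho>))"
    by (rule definable_table[OF assms(1), where G = next_state and n = "length E"])
      (auto simp: next_state_def)
  show "definable (\<lambda>x \<rho>. written (S x \<rho>) (J x \<rho>))"
    by (rule definable_table2[OF assms, where G = written and n = "length E" and m = K])
      (auto simp: written_def)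
  show "definable (\<lambda>x \<rho>. moved (S x \<rho>) (J x \<rho>))"
    by (rule definable_table2[OF assms, where G = moved and n = "length E" and m = K])
      (auto simp: moved_def)
qed

lemma definable_pred_allowed:
  assumes "definable J" "definable C" "definable S"
  shows "definable_pred (\<lambda>x \<rho>. allowed x (J x \<rho>) (C x \<rho>) (S x \<rho>))"
  unfolding allowed_def using assms by (intro definable_intros definable_bounds)

lemma definable_pred_active:
  assumes "definable F" "definable T" "definable J" "definable C" "definable R" "definable S"
  shows "definable_pred (\<lambda>x \<rho>. active x (F x \<rho>) (T x \<rho>) (J x \<rho>) (C x \<rho>) (R x \<rho>) (S x \<rho>))"
  unfolding active_def using assms by (intro definable_intros definable_bounds definable_tables)

lemma definable_pred_occurs:
  assumes "definable F" "definable T" "definable J" "definable C" "definable R" "definable S"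
    and "definable G" "definable A" "definable B1" "definable B2" "definable B3" "definable B4"
  shows "definable_pred (\<lambda>x \<rho>. occurs x (F x \<rho>) (T x \<rho>) (J x \<rho>) (C x \<rho>) (R x \<rho>) (S x \<rho>)
     (G x \<rho>) (A x \<rho>) (B1 x \<rho>) (B2 x \<rho>) (B3 x \<rho>) (B4 x \<rho>))"
  unfolding occurs_def using assms
  by (intro definable_intros definable_bounds definable_tables definable_pred_allowed)

lemma definable_pred_clause_occ:
  assumes "definable J" "definable L"
  shows "definable_pred (\<lambda>x \<rho>. clause_occ x (J x \<rho>) (L x \<rho>))"
  unfolding clause_occ_def Let_def using assms
  by (intro definable_pred_imp definable_pred_active definable_pred_occurs definable_digit definable_bounds
      definable_mod definable_div definable_const)

section \<open>The graph of the reduction\<close>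

definition reduction_size :: "bool list \<Rightarrow> nat" where
  "reduction_size x = 17 * (2 * base (length x) ^ 5 * base (length x) ^ 6)"

definition reduction_graph :: "bool list \<Rightarrow> nat pair_pre_digraph" where
  "reduction_graph x = \<lparr>pverts = {..<reduction_size x + 4},
     parcs = strong_hull (reduction_size x)
       (numbered_gadget_graph (clause_occ x) (2 * base (length x) ^ 5) (base (length x) ^ 6))\<rparr>"

lemma definable_reduction_size: "definable (\<lambda>x \<rho>. reduction_size x)"
  unfolding reduction_size_def by (intro definable_intros definable_bounds)

lemma definable_pred_reduction_arc:
  assumes "definable U" "definable V"
  shows "definable_pred (\<lambda>x \<rho>. (U x \<rho>, V x \<rho>) \<in> parcs (reduction_graph x))"
  unfolding reduction_graph_def pair_pre_digraph.simps in_strong_hull numbered_gadget_graph_def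
    mem_Collect_eq prod.case
  using assms
  by (intro definable_pred_gadget_arc[OF definable_pred_clause_occ] definable_intros definable_bounds
      definable_reduction_size)

lemma numbered_subset:
  "numbered_gadget_graph (clause_occ x) (2 * base (length x) ^ 5) (base (length x) ^ 6) \<subseteq>
     {..<reduction_size x} \<times> {..<reduction_size x}"
  by (auto simp: numbered_gadget_graph_def reduction_size_def)

lemma base_pos: "0 < base n"
  using base_bounds(8)[of n] by simp

lemma oriented_reduction_graph: "oriented_graph (reduction_graph x)"
proof -
  have "2 \<le> 2 * base (length x) ^ 5" using base_pos by (simp add: Suc_leI)
  then show ?thesis
    unfolding oriented_graph_iff reduction_graph_def pair_pre_digraph.simps
    using strong_hull_subset[OF numbered_subset] strong_hull_oriented[OF numbered_subset numbered_gadget_graph_asym]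
    by blast
qed

lemma strongly_connected_reduction_graph: "strongly_connected (with_proj (reduction_graph x))"
proof -
  have "0 < reduction_size x" using base_pos by (simp add: reduction_size_def)
  then show ?thesis
    unfolding strongly_connected_iff[OF oriented_reduction_graph]
    by (auto simp: reduction_graph_def intro!: strong_hull_connected)
qed

lemma inversion_number_reduction_graph:
  "inversion_number (reduction_graph x) \<le> 1 \<longleftrightarrow> (\<exists>y. length y \<le> poly p (length x) \<and> pair_strings x y \<in> W)"
proof -
  let ?N = "2 * base (length x) ^ 5" and ?m = "base (length x) ^ 6"
  let ?R = "numbered_gadget_graph (clause_occ x) ?N ?m"
  \<comment> \<open>\<open>inversion_number_le_1_iff\<close> speaks of sets of vertices;
    intersecting an arbitrary set with the vertex set does not affect the inversion.\<close>
  have restrict: "invert_rel (X \<inter> V) S = invert_rel X S" if "S \<subseteq> V \<times> V" for X V and S :: "nat rel"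
    using that by (auto simp: invert_rel_def)
  have "inversion_number (reduction_graph x) \<le> 1 \<longleftrightarrow>
      (\<exists>X. acyclic (invert_rel X (strong_hull (reduction_size x) ?R)))"
    unfolding inversion_number_le_1_iff[OF oriented_reduction_graph]
    using restrict[OF strong_hull_subset[OF numbered_subset[of x]]]
    by (auto simp: reduction_graph_def) (metis inf_le2)
  also have "\<dots> \<longleftrightarrow> (\<exists>\<alpha>. satisfies (clause_occ x) ?N ?m \<alpha>)"
    unfolding strong_hull_invertible_iff[OF numbered_subset]
    using base_pos by (intro numbered_gadget_graph_iff) auto
  also have "\<dots> \<longleftrightarrow> (\<exists>y. length y \<le> poly p (length x) \<and> pair_strings x y \<in> W)"
    unfolding satisfies_clause_occ_iff using tableau_sound tableau_complete by blast
  finally show ?thesis .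
qed

end

section \<open>NP-completeness\<close>

lemma concat_rows:
  "concat (map (\<lambda>u. map (f u) [0..<n]) [0..<m]) = map (\<lambda>i. f (i div n) (i mod n)) [0..<m * n]"
proof (induction m)
  case (Suc m)
  have "map (f m) [0..<n] = map (\<lambda>i. f ((i + m * n) div n) ((i + m * n) mod n)) [0..<n]" by simp
  also have "\<dots> = map (\<lambda>i. f (i div n) (i mod n)) (map (\<lambda>i. i + m * n) [0..<n])" by simp
  also have "\<dots> = map (\<lambda>i. f (i div n) (i mod n)) [m * n..<n + m * n]" by (simp only: map_add_upt)
  finally have "map (f m) [0..<n] = map (\<lambda>i. f (i div n) (i mod n)) [m * n..<m * n + n]"
    by (simp add: add.commute)
  moreover have "[0..<Suc m * n] = [0..<m * n] @ [m * n..<m * n + n]"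
    using upt_add_eq_append[of 0 "m * n" n] by (simp add: add.commute)
  moreover have "concat (map (\<lambda>u. map (f u) [0..<n]) [0..<Suc m]) =
      concat (map (\<lambda>u. map (f u) [0..<n]) [0..<m]) @ map (f m) [0..<n]" by simp
  ultimately show ?case using Suc by (simp only: map_append)
qed simp

text \<open>Position n carries the separator \<open>False\<close>, and the matrix starts at
  \<open>n + 1\<close>.\<close>

definition code_bit :: "nat \<Rightarrow> nat rel \<Rightarrow> nat \<Rightarrow> bool" where
  "code_bit n R i \<longleftrightarrow> i < n \<or> n < i \<and> ((i - (n + 1)) div n, (i - (n + 1)) mod n) \<in> R"

lemma encode_digraph_eq:
  assumes "pverts D = {..<n}"
  shows "encode_digraph D = map (code_bit n (parcs D)) [0..<n + 1 + n * n]"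
proof -
  have "encode_digraph D =
      replicate n True @ [False] @ map (\<lambda>i. (i div n, i mod n) \<in> parcs D) [0..<n * n]"
    using assms by (simp add: encode_digraph_def concat_rows)
  also have "\<dots> = map (code_bit n (parcs D)) [0..<n + 1 + n * n]"
  proof (rule nth_equalityI)
    fix i assume "i < length (replicate n True @ [False] @ map (\<lambda>i. (i div n, i mod n) \<in> parcs D) [0..<n * n])"
    then have i: "i < n + 1 + n * n" by simp
    then have rhs: "map (code_bit n (parcs D)) [0..<n + 1 + n * n] ! i = code_bit n (parcs D) i"
      by (simp del: upt_Suc)
    have "i < n \<or> i = n \<or> i = n + 1 + (i - (n + 1)) \<and> i - (n + 1) < n * n" using i by linarith
    then obtain k where "i < n \<or> i = n \<or> i = n + 1 + k \<and> k < n * n" by blast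
    then show "(replicate n True @ [False] @ map (\<lambda>i. (i div n, i mod n) \<in> parcs D) [0..<n * n]) ! i =
        map (code_bit n (parcs D)) [0..<n + 1 + n * n] ! i"
      unfolding rhs by (elim disjE conjE) (simp_all add: nth_append code_bit_def)
  qed simp
  finally show ?thesis .
qed

lemma encode_digraph_nth:
  "pverts D = {..<n} \<Longrightarrow> i < n + 1 + n * n \<Longrightarrow> encode_digraph D ! i = code_bit n (parcs D) i"
  by (simp add: encode_digraph_eq del: upt_Suc)

lemma code_bit_arc: "u < n \<Longrightarrow> v < n \<Longrightarrow> code_bit n R (n + 1 + u * n + v) \<longleftrightarrow> (u, v) \<in> R"
  by (simp add: code_bit_def)

lemma arc_index_less: "u < n \<Longrightarrow> v < n \<Longrightarrow> u * n + v < n * (n :: nat)"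
  by (metis add.commute add_less_cancel_left le_trans linorder_not_le mult.commute mult_Suc
      mult_le_mono2 Suc_leI less_le_trans)

text \<open>The block of ones in front of the separator determines the number of vertices, and the
  matrix determines the arcs. Injectivity is what makes membership of an encoding in the language a
  statement about the encoded graph.\<close>

lemma encode_digraph_inj:
  fixes D D' :: "nat pair_pre_digraph"
  assumes eq: "encode_digraph D = encode_digraph D'"
    and D: "pverts D = {..<n}" "parcs D \<subseteq> pverts D \<times> pverts D"
    and D': "pverts D' = {..<n'}" "parcs D' \<subseteq> pverts D' \<times> pverts D'"
  shows "D = D'"
proof -
  have tw: "length (takeWhile id (encode_digraph G)) = card (pverts G)" for G
    by (simp add: encode_digraph_def Let_def takeWhile_append takeWhile_replicate)
  have n: "n = n'" using tw[of D] tw[of D'] eq D(1) D'(1) by simp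
  have "(u, v) \<in> parcs D \<longleftrightarrow> (u, v) \<in> parcs D'" if "u < n" "v < n" for u v
  proof -
    have "encode_digraph D ! (n + 1 + (u * n + v)) = encode_digraph D' ! (n + 1 + (u * n + v))"
      by (simp add: eq)
    moreover have "n + 1 + (u * n + v) < n + 1 + n * n" using arc_index_less[OF that] by simp
    ultimately show ?thesis
      using encode_digraph_nth[OF D(1)] encode_digraph_nth[OF D'(1)] code_bit_arc[OF that]
      by (simp add: add.assoc flip: n)
  qed
  then have "parcs D = parcs D'" using D D' n by auto
  then show ?thesis using D(1) D'(1) n by simp
qed

lemma polytime_computable_encode:
  assumes verts: "\<And>x. pverts (D x) = {..<n x}" and n: "definable (\<lambda>x \<rho>. n x)"
    and arcs: "\<And>U V. definable U \<Longrightarrow> definable V \<Longrightarrow> definable_pred (\<lambda>x \<rho>. (U x \<rho>, V x \<rho>) \<in> parcs (D x))"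
  shows "polytime_computable (\<lambda>x. encode_digraph (D x))"
proof -
  have "definable (\<lambda>x \<rho>. of_bool (code_bit (n x) (parcs (D x)) (\<rho> 0)))"
    unfolding code_bit_def by (intro definable_intros n arcs)
  moreover have "definable (\<lambda>x \<rho>. n x + 1 + n x * n x)" by (intro definable_intros n)
  ultimately show ?thesis
    using polytime_computable_definable by (fastforce simp: encode_digraph_eq[OF verts])
qed

lemma in_inv_le_1_problem:
  assumes D: "pverts D = {..<n}" "oriented_graph D" "C D"
  shows "encode_digraph D \<in> inv_le_1_problem C \<longleftrightarrow> inversion_number D \<le> 1"
proof
  assume "encode_digraph D \<in> inv_le_1_problem C"
  then obtain D' where D': "encode_digraph D = encode_digraph D'" "pverts D' = {..<card (pverts D')}"
      "oriented_graph D'" "inversion_number D' \<le> 1"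
    unfolding inv_le_1_problem_def by blast
  have "D = D'"
    using D D' by (intro encode_digraph_inj[OF D'(1) D(1) _ D'(2)]) (auto simp: oriented_graph_iff)
  then show "inversion_number D \<le> 1" using D'(4) by simp
next
  assume "inversion_number D \<le> 1"
  moreover have "pverts D = {..<card (pverts D)}" using D(1) by simp
  ultimately show "encode_digraph D \<in> inv_le_1_problem C"
    using D unfolding inv_le_1_problem_def by blast
qed

text \<open>All graphs of the reduction are strongly connected, so one reduction serves every class
  of graphs that includes the strongly connected ones, in particular the two of the theorem.\<close>

lemma NP_hard_inv_le_1_problem:
  assumes C: "\<And>D :: nat pair_pre_digraph. strongly_connected (with_proj D) \<Longrightarrow> C D"
  shows "NP_hard (inv_le_1_problem C)"
  unfolding NP_hard_def
proof
  fix A assume "A \<in> complexity_NP"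
  then obtain V p where V: "V \<in> complexity_P"
    and A: "\<And>x. x \<in> A \<longleftrightarrow> (\<exists>y. length y \<le> poly p (length x) \<and> pair_strings x y \<in> V)"
    unfolding complexity_NP_def by auto
  obtain M q where M: "wf_turing_machine M" "tm_computes_in_time M (\<lambda>w. [w \<in> V]) (poly q)"
    using V unfolding complexity_P_def polytime_computable_def by blast
  let ?S = "{ss @ [s] | ss s. length ss = tm_tapes M \<and> (\<forall>a \<in> set ss. a < tm_symbols M) \<and> s < tm_states M}"
  have "?S = (\<lambda>(ss, s). ss @ [s]) ` ({ss. set ss \<subseteq> {..<tm_symbols M} \<and> length ss = tm_tapes M} \<times> {..<tm_states M})"
    by (auto simp: subset_iff)
  then have "finite ?S" by (simp add: finite_lists_length_eq)
  from finite_list[OF this] obtain E where E: "set E = ?S" by (elim exE)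
  interpret tableau M V p q E by unfold_locales (use M E in auto)
  have red: "x \<in> A \<longleftrightarrow> encode_digraph (reduction_graph x) \<in> inv_le_1_problem C" for x
  proof -
    have "encode_digraph (reduction_graph x) \<in> inv_le_1_problem C \<longleftrightarrow> inversion_number (reduction_graph x) \<le> 1"
      by (rule in_inv_le_1_problem[where n = "reduction_size x + 4"])
        (auto simp: reduction_graph_def[of x] oriented_reduction_graph[unfolded reduction_graph_def]
          intro: C strongly_connected_reduction_graph[unfolded reduction_graph_def])
    then show ?thesis unfolding A inversion_number_reduction_graph by blast
  qed
  have "polytime_computable (\<lambda>x. encode_digraph (reduction_graph x))"
  proof (rule polytime_computable_encode)
    show "pverts (reduction_graph x) = {..<reduction_size x + 4}" for x by (simp add: reduction_graph_def)
    show "definable (\<lambda>x \<rho>. reduction_size x + 4)" by (intro definable_intros definable_reduction_size)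
  qed (rule definable_pred_reduction_arc)
  then show "polytime_reducible A (inv_le_1_problem C)"
    unfolding polytime_reducible_def using red by blast
qed

section \<open>A polynomial-time verifier\<close>

definition word_bit :: "bool list \<Rightarrow> nat \<Rightarrow> bool" where
  "word_bit w i \<longleftrightarrow> i < length w \<and> w ! i"

lemma definable_pred_word_bit: "definable A \<Longrightarrow> definable_pred (\<lambda>w \<rho>. word_bit w (A w \<rho>))"
  unfolding word_bit_def by (rule definable_pred_bit)

text \<open>The separator 01 is the first aligned block of two different bits, so the number of
  blocks before it is the length of the first component of a pair.\<close>

definition first_length :: "bool list \<Rightarrow> nat" where
  "first_length w = (\<Sum>i < length w. of_bool (\<forall>j < Suc i. word_bit w (2 * j) = word_bit w (2 * j + 1)))"

lemma definable_first_length: "definable (\<lambda>w \<rho>. first_length w)"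
  unfolding first_length_def by (intro definable_intros definable_pred_word_bit)

lemma pair_strings_bits:
  "i < length x \<Longrightarrow> word_bit (pair_strings x y) (2 * i) = x ! i"
  "i < length x \<Longrightarrow> word_bit (pair_strings x y) (2 * i + 1) = x ! i"
  "\<not> word_bit (pair_strings x y) (2 * length x)"
  "word_bit (pair_strings x y) (2 * length x + 1)"
  "word_bit (pair_strings x y) (2 * length x + 2 + k) \<longleftrightarrow> k < length y \<and> y ! k"
  by (auto simp: word_bit_def pair_strings_length pair_strings_nth)

lemma first_length_pair_strings: "first_length (pair_strings x y) = length x"
proof -
  let ?w = "pair_strings x y"
  have "(\<forall>j < Suc i. word_bit ?w (2 * j) = word_bit ?w (2 * j + 1)) \<longleftrightarrow> i < length x" for i
  proof
    assume a: "\<forall>j < Suc i. word_bit ?w (2 * j) = word_bit ?w (2 * j + 1)"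
    show "i < length x"
    proof (rule ccontr)
      assume "\<not> i < length x"
      then show False using a pair_strings_bits(3,4)[of x y] by auto
    qed
  qed (simp add: pair_strings_bits(1,2)[unfolded Suc_eq_plus1[symmetric]])
  then have "first_length ?w = (\<Sum>i < length ?w. of_bool (i < length x))"
    by (simp add: first_length_def)
  also have "\<dots> = card ({..<length ?w} \<inter> {i. i < length x})" by simp
  also have "{..<length ?w} \<inter> {i. i < length x} = {..<length x}" by (auto simp: pair_strings_length)
  finally show ?thesis by simp
qed

text \<open>
  A certificate consists of the characteristic vector of the inverted set and the matrices of three
  strict partial orders: one contains all arcs after the inversion, and the other two make every
  vertex reachable from vertex \<open>0\<close>, and conversely.
\<close>

definition strict_order_below :: "nat \<Rightarrow> (nat \<Rightarrow> nat \<Rightarrow> bool) \<Rightarrow> bool" where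
  "strict_order_below n r \<longleftrightarrow> (\<forall>u < n. \<not> r u u) \<and>
     (\<forall>u < n. \<forall>v < n. \<forall>w < n. r u v \<and> r v w \<longrightarrow> r u w)"

text \<open>\<open>S\<close> switches on the test of strong connectivity. Every vertex except 0 has
  an in-neighbour that precedes it in r1 and an out-neighbour that precedes it in r2; as the orders
  are finite, following these neighbours ends in 0.\<close>

definition certified :: "bool \<Rightarrow> nat \<Rightarrow> (nat \<Rightarrow> nat \<Rightarrow> bool) \<Rightarrow> (nat \<Rightarrow> bool) \<Rightarrow>
    (nat \<Rightarrow> nat \<Rightarrow> bool) \<Rightarrow> (nat \<Rightarrow> nat \<Rightarrow> bool) \<Rightarrow> (nat \<Rightarrow> nat \<Rightarrow> bool) \<Rightarrow> bool" where
  "certified S n adj X r0 r1 r2 \<longleftrightarrow>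
     (\<forall>u < n. \<forall>v < n. adj u v \<longrightarrow> \<not> adj v u) \<and>
     (\<forall>u < n. \<forall>v < n. (if X u \<and> X v then adj v u else adj u v) \<longrightarrow> r0 u v) \<and>
     strict_order_below n r0 \<and>
     (S \<longrightarrow> 0 < n \<and> strict_order_below n r1 \<and> strict_order_below n r2 \<and>
        (\<forall>v < n. v \<noteq> 0 \<longrightarrow> (\<exists>u < n. adj u v \<and> r1 u v)) \<and>
        (\<forall>v < n. v \<noteq> 0 \<longrightarrow> (\<exists>u < n. adj v u \<and> r2 u v)))"

text \<open>Relations read off a word agree with the intended ones only on arguments below
  n.\<close>

lemma certified_cong:
  assumes "\<And>u v. u < n \<Longrightarrow> v < n \<Longrightarrow> adj' u v = adj u v" "\<And>u. u < n \<Longrightarrow> X' u = X u"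
    "\<And>u v. u < n \<Longrightarrow> v < n \<Longrightarrow> r0' u v = r0 u v" "\<And>u v. u < n \<Longrightarrow> v < n \<Longrightarrow> r1' u v = r1 u v"
    "\<And>u v. u < n \<Longrightarrow> v < n \<Longrightarrow> r2' u v = r2 u v"
    and "certified S n adj X r0 r1 r2"
  shows "certified S n adj' X' r0' r1' r2'"
proof -
  have order: "strict_order_below n r' \<longleftrightarrow> strict_order_below n r"
    if "\<And>u v. u < n \<Longrightarrow> v < n \<Longrightarrow> r' u v = r u v" for r r'
    unfolding strict_order_below_def by (simp add: that)
  have "(\<exists>u < n. adj' u v \<and> r1' u v) \<longleftrightarrow> (\<exists>u < n. adj u v \<and> r1 u v)"
    "(\<exists>u < n. adj' v u \<and> r2' u v) \<longleftrightarrow> (\<exists>u < n. adj v u \<and> r2 u v)" if "v < n" for v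
    using assms(1,4,5) that by blast+
  then have "certified S n adj' X' r0' r1' r2' \<longleftrightarrow> certified S n adj X r0 r1 r2"
    unfolding certified_def
    by (simp add: assms(1-3) order[of r0' r0, OF assms(3)] order[of r1' r1, OF assms(4)]
        order[of r2' r2, OF assms(5)])
  then show ?thesis using assms(6) by blast
qed

lemma strict_order_below_acyclic:
  assumes r: "strict_order_below n r" and R: "\<And>u v. (u, v) \<in> R \<Longrightarrow> u < n \<and> v < n \<and> r u v"
  shows "acyclic R"
proof -
  have "u < n \<and> v < n \<and> r u v" if "(u, v) \<in> R\<^sup>+" for u v
    using that
  proof (induction rule: trancl_induct)
    case (step v w)
    then show ?case using R[OF step(2)] r unfolding strict_order_below_def by blast
  qed (use R in blast)
  then show ?thesis using r unfolding acyclic_def strict_order_below_def by blast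
qed

lemma strict_order_below_reach:
  assumes r: "strict_order_below n r" and "v < n"
    and pred: "\<And>v. v < n \<Longrightarrow> v \<noteq> 0 \<Longrightarrow> \<exists>u < n. (u, v) \<in> R \<and> r u v"
  shows "(0, v) \<in> R\<^sup>*"
proof -
  let ?Q = "{(u, v). u < n \<and> v < n \<and> r u v}"
  have "finite ?Q" by (rule finite_subset[of _ "{..<n} \<times> {..<n}"]) auto
  then have "wf ?Q"
    using strict_order_below_acyclic[OF r, of ?Q] by (intro finite_acyclic_wf) auto
  then show ?thesis using \<open>v < n\<close>
  proof (induction v rule: wf_induct_rule)
    case (less v)
    show ?case
    proof (cases "v = 0")
      case False
      then obtain u where "u < n" "(u, v) \<in> R" "r u v" using pred less.prems by blast
      then show ?thesis using less by (auto intro: rtrancl_into_rtrancl)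
    qed simp
  qed
qed

text \<open>The last vertex but one of a shortest path from 0 is closer to 0. Comparing distances
  thus gives the orders of a certificate.\<close>

lemma reach_order:
  assumes "(0, v) \<in> R\<^sup>*" "v \<noteq> (0 :: nat)"
  shows "\<exists>u. (u, v) \<in> R \<and> (LEAST k. (0, u) \<in> R ^^ k) < (LEAST k. (0, v) \<in> R ^^ k)"
proof -
  define k where "k = (LEAST k. (0, v) \<in> R ^^ k)"
  have "\<exists>k. (0, v) \<in> R ^^ k" using rtrancl_imp_relpow[OF assms(1)] by blast
  then have k: "(0, v) \<in> R ^^ k" unfolding k_def by (rule LeastI_ex)
  then obtain j where j: "k = Suc j" using assms(2) by (cases k) auto
  then obtain u where u: "(0, u) \<in> R ^^ j" "(u, v) \<in> R" using k by auto
  then have "(LEAST k. (0, u) \<in> R ^^ k) \<le> j" by (intro Least_le)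
  then show ?thesis using u j unfolding k_def[symmetric] by auto
qed

lemma certified_sound:
  assumes c: "certified S n adj X r0 r1 r2"
  defines "D \<equiv> \<lparr>pverts = {..<n}, parcs = {(u, v). u < n \<and> v < n \<and> adj u v}\<rparr>"
  shows "oriented_graph D" "inversion_number D \<le> 1" "S \<Longrightarrow> strongly_connected (with_proj D)"
proof -
  show o: "oriented_graph D"
    using c unfolding oriented_graph_iff certified_def by (auto simp: D_def)
  have "acyclic (invert_rel {u. u < n \<and> X u} (parcs D))"
  proof (rule strict_order_below_acyclic)
    show "strict_order_below n r0" using c by (simp add: certified_def)
    fix u v assume "(u, v) \<in> invert_rel {u. u < n \<and> X u} (parcs D)"
    then have "u < n" "v < n" "if X u \<and> X v then adj v u else adj u v"
      by (auto simp: in_invert_rel D_def split: if_splits)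
    then show "u < n \<and> v < n \<and> r0 u v" using c unfolding certified_def by blast
  qed
  then show "inversion_number D \<le> 1"
    unfolding inversion_number_le_1_iff[OF o] by (intro exI[of _ "{u. u < n \<and> X u}"]) (auto simp: D_def)
  show "strongly_connected (with_proj D)" if S
  proof -
    have s: "0 < n" "strict_order_below n r1" "strict_order_below n r2"
      "\<And>v. v < n \<Longrightarrow> v \<noteq> 0 \<Longrightarrow> \<exists>u < n. adj u v \<and> r1 u v"
      "\<And>v. v < n \<Longrightarrow> v \<noteq> 0 \<Longrightarrow> \<exists>u < n. adj v u \<and> r2 u v"
      using c that unfolding certified_def by blast+
    have 1: "(0, v) \<in> (parcs D)\<^sup>*" if "v < n" for v
      by (rule strict_order_below_reach[OF s(2) that]) (use s(4) in \<open>auto simp: D_def\<close>)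
    have "(0, v) \<in> ((parcs D)\<inverse>)\<^sup>*" if "v < n" for v
      by (rule strict_order_below_reach[OF s(3) that]) (use s(5) in \<open>auto simp: D_def\<close>)
    then have 2: "(v, 0) \<in> (parcs D)\<^sup>*" if "v < n" for v
      using that by (simp add: rtrancl_converse)
    have "(u, v) \<in> (parcs D)\<^sup>*" if "u < n" "v < n" for u v
      using 2[OF that(1)] 1[OF that(2)] by (rule rtrancl_trans)
    moreover have "pverts D = {..<n}" by (simp add: D_def)
    ultimately show ?thesis unfolding strongly_connected_iff[OF o] using s(1) by auto
  qed
qed

lemma certified_complete:
  assumes D: "pverts D = {..<n}" "oriented_graph D" "inversion_number D \<le> 1"
    and S: "S \<Longrightarrow> strongly_connected (with_proj D)"
  shows "\<exists>X r0 r1 r2. certified S n (\<lambda>u v. (u, v) \<in> parcs D) X r0 r1 r2"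
proof -
  obtain X where X: "acyclic (invert_rel X (parcs D))"
    using D(3) unfolding inversion_number_le_1_iff[OF D(2)] by blast
  define r0 where "r0 u v \<longleftrightarrow> (u, v) \<in> (invert_rel X (parcs D))\<^sup>+" for u v
  define r1 where "r1 u v \<longleftrightarrow> (LEAST k. (0, u) \<in> parcs D ^^ k) < (LEAST k. (0, v) \<in> parcs D ^^ k)" for u v
  define r2 where "r2 u v \<longleftrightarrow> (LEAST k. (0, u) \<in> ((parcs D)\<inverse>) ^^ k) < (LEAST k. (0, v) \<in> ((parcs D)\<inverse>) ^^ k)" for u v
  have sub: "u < n" "v < n" if "(u, v) \<in> parcs D" for u v
    using D(1,2) that unfolding oriented_graph_iff by auto
  have "certified S n (\<lambda>u v. (u, v) \<in> parcs D) (\<lambda>u. u \<in> X) r0 r1 r2"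
    unfolding certified_def
  proof (intro conjI impI)
    show "\<forall>u < n. \<forall>v < n. (u, v) \<in> parcs D \<longrightarrow> (v, u) \<notin> parcs D"
      using D(2) by (simp add: oriented_graph_iff)
    show "\<forall>u < n. \<forall>v < n. (if u \<in> X \<and> v \<in> X then (v, u) \<in> parcs D else (u, v) \<in> parcs D) \<longrightarrow> r0 u v"
      unfolding r0_def in_invert_rel[symmetric] by blast
    show "strict_order_below n r0"
      using X unfolding strict_order_below_def r0_def acyclic_def by (blast intro: trancl_trans)
    show "strict_order_below n r1" "strict_order_below n r2"
      unfolding strict_order_below_def r1_def r2_def by auto
  next
    assume S
    then have sc: "{..<n} \<noteq> {}" "\<And>u v. u < n \<Longrightarrow> v < n \<Longrightarrow> (u, v) \<in> (parcs D)\<^sup>*"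
      using S unfolding strongly_connected_iff[OF D(2)] D(1) by auto
    then show n: "0 < n" by auto
    show "\<forall>v < n. v \<noteq> 0 \<longrightarrow> (\<exists>u < n. (u, v) \<in> parcs D \<and> r1 u v)"
      using reach_order[OF sc(2)[OF n]] sub unfolding r1_def by blast
    have "(0, v) \<in> ((parcs D)\<inverse>)\<^sup>*" if "v < n" for v
      using sc(2)[OF that n] by (simp add: rtrancl_converse)
    then show "\<forall>v < n. v \<noteq> 0 \<longrightarrow> (\<exists>u < n. (v, u) \<in> parcs D \<and> r2 u v)"
      using reach_order[of _ "(parcs D)\<inverse>"] sub unfolding r2_def by (meson converse_iff)
  qed
  then show ?thesis by blast
qed

text \<open>Bit i of the first component stands at position \<open>2 * i\<close>, and the
  certificate begins two positions after the doubled bits. It consists of n bits for the inverted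
  set and three matrices at the offsets \<open>n\<close>, \<open>n + n * n\<close> and
  \<open>n + 2 * (n * n)\<close>. The number n is found by bounded search.\<close>

definition verifies :: "bool \<Rightarrow> bool list \<Rightarrow> bool" where
  "verifies S w \<longleftrightarrow> (\<exists>n < length w. first_length w = n + 1 + n * n \<and>
     (\<forall>i < n. word_bit w (2 * i)) \<and> \<not> word_bit w (2 * n) \<and>
     certified S n (\<lambda>u v. word_bit w (2 * (n + 1 + u * n + v)))
       (\<lambda>u. word_bit w (2 * first_length w + 2 + u))
       (\<lambda>u v. word_bit w (2 * first_length w + 2 + (n + u * n + v)))
       (\<lambda>u v. word_bit w (2 * first_length w + 2 + (n + n * n + u * n + v)))
       (\<lambda>u v. word_bit w (2 * first_length w + 2 + (n + 2 * (n * n) + u * n + v))))"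

lemma definable_pred_verifies: "definable_pred (\<lambda>w \<rho>. verifies S w)"
  unfolding verifies_def certified_def strict_order_below_def
  by (intro definable_intros definable_pred_word_bit definable_first_length)


lemma inv_le_1_problem_in_NP:
  assumes C: "\<And>D. C D \<longleftrightarrow> (S \<longrightarrow> strongly_connected (with_proj D))"
  shows "inv_le_1_problem C \<in> complexity_NP"
proof -
  have "definable (\<lambda>w \<rho>. of_bool (verifies S w))"
    by (rule definable_of_bool[OF definable_pred_verifies])
  from polytime_computable_definable[OF definable_one this]
  have "{w. verifies S w} \<in> complexity_P" by (simp add: complexity_P_def)
  moreover have "x \<in> inv_le_1_problem C \<longleftrightarrow>
      (\<exists>y. length y \<le> poly [:0, 3:] (length x) \<and> pair_strings x y \<in> {w. verifies S w})" for x
  proof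
    assume "x \<in> inv_le_1_problem C"
    then obtain D where x: "x = encode_digraph D" and D: "pverts D = {..<card (pverts D)}" "oriented_graph D"
        "C D" "inversion_number D \<le> 1"
      unfolding inv_le_1_problem_def by blast
    define n where "n = card (pverts D)"
    have Dn: "pverts D = {..<n}" using D(1) by (simp add: n_def)
    have lx: "length x = n + 1 + n * n" by (simp add: x encode_digraph_eq[OF Dn] del: upt_Suc)
    obtain X r0 r1 r2 where cert: "certified S n (\<lambda>u v. (u, v) \<in> parcs D) X r0 r1 r2"
      using certified_complete[OF Dn D(2,4)] D(3) C by blast
    define row where "row r = map (\<lambda>i. r (i div n) (i mod n)) [0..<n * n]" for r :: "nat \<Rightarrow> nat \<Rightarrow> bool"
    define y where "y = map X [0..<n] @ row r0 @ row r1 @ row r2"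
    have lrow: "length (row r) = n * n" for r by (simp add: row_def)
    have nrow: "row r ! (u * n + v) = r u v" if "u < n" "v < n" for r u v
      using arc_index_less[OF that] that by (simp add: row_def)
    \<comment> \<open>This is at most three times \<open>length x\<close>, which explains the
      polynomial \<open>[:0, 3:]\<close>.\<close>
    have ly: "length y = n + 3 * (n * n)" by (simp add: y_def lrow)
    let ?w = "pair_strings x y"
    have fl: "first_length ?w = length x" by (rule first_length_pair_strings)
    have xb: "word_bit ?w (2 * i) = code_bit n (parcs D) i" if "i < n + 1 + n * n" for i
      using that pair_strings_bits(1)[of i x y] by (simp add: lx) (simp add: x encode_digraph_nth[OF Dn])
    have yX: "word_bit ?w (2 * length x + 2 + u) = X u" if "u < n" for u
      unfolding pair_strings_bits(5) using that by (simp add: ly) (simp add: y_def nth_append)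
    have yr: "word_bit ?w (2 * length x + 2 + (n + k * (n * n) + u * n + v)) = ([r0, r1, r2] ! k) u v"
      if "u < n" "v < n" "k < 3" for u v k
    proof -
      have i: "u * n + v < n * n" by (rule arc_index_less[OF that(1,2)])
      have "k = 0 \<or> k = 1 \<or> k = 2" using that(3) by linarith
      then have "y ! (n + (k * (n * n) + (u * n + v))) = ([r0, r1, r2] ! k) u v \<and>
          n + (k * (n * n) + (u * n + v)) < length y"
        using i nrow[OF that(1,2)] by (elim disjE) (simp_all add: ly y_def nth_append lrow)
      then show ?thesis unfolding pair_strings_bits(5) by (simp add: add.assoc)
    qed
    have adj: "word_bit ?w (2 * (n + 1 + u * n + v)) \<longleftrightarrow> (u, v) \<in> parcs D" if "u < n" "v < n" for u v
      using xb[of "n + 1 + u * n + v"] arc_index_less[OF that] code_bit_arc[OF that] by simp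
    have "certified S n (\<lambda>u v. word_bit ?w (2 * (n + 1 + u * n + v)))
       (\<lambda>u. word_bit ?w (2 * length x + 2 + u))
       (\<lambda>u v. word_bit ?w (2 * length x + 2 + (n + u * n + v)))
       (\<lambda>u v. word_bit ?w (2 * length x + 2 + (n + n * n + u * n + v)))
       (\<lambda>u v. word_bit ?w (2 * length x + 2 + (n + 2 * (n * n) + u * n + v)))"
      using yr[of _ _ 0] yr[of _ _ 1] yr[of _ _ 2] by (intro certified_cong[OF adj yX _ _ _ cert]) simp_all
    moreover have "word_bit ?w (2 * i)" if "i < n" for i using that xb[of i] by (simp add: code_bit_def)
    moreover have "\<not> word_bit ?w (2 * n)" using xb[of n] by (simp add: code_bit_def)
    moreover have "n < length ?w" by (simp add: pair_strings_length lx)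
    ultimately have "verifies S ?w" unfolding verifies_def fl using lx by blast
    moreover have "length y \<le> poly [:0, 3:] (length x)" by (simp add: ly lx)
    ultimately show "\<exists>y. length y \<le> poly [:0, 3:] (length x) \<and> pair_strings x y \<in> {w. verifies S w}"
      by blast
  next
    assume "\<exists>y. length y \<le> poly [:0, 3:] (length x) \<and> pair_strings x y \<in> {w. verifies S w}"
    then obtain y where "verifies S (pair_strings x y)" by blast
    then obtain n X r0 r1 r2 where lx: "length x = n + 1 + n * n"
      and ones: "\<forall>i < n. word_bit (pair_strings x y) (2 * i)" and zero: "\<not> word_bit (pair_strings x y) (2 * n)"
      and cert: "certified S n (\<lambda>u v. word_bit (pair_strings x y) (2 * (n + 1 + u * n + v))) X r0 r1 r2"
      unfolding verifies_def first_length_pair_strings by (elim exE conjE) (rule that)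
    define D where "D = \<lparr>pverts = {..<n}, parcs = {(u, v). u < n \<and> v < n \<and>
      word_bit (pair_strings x y) (2 * (n + 1 + u * n + v))}\<rparr>"
    note D = certified_sound[OF cert, folded D_def]
    have Dn: "pverts D = {..<n}" by (simp add: D_def)
    \<comment> \<open>An accepted x is the encoding of the graph read off it: leading ones,
      separator and matrix fill all of its positions.\<close>
    have "x = encode_digraph D"
    proof (rule nth_equalityI)
      show "length x = length (encode_digraph D)" by (simp add: encode_digraph_eq[OF Dn] lx)
      fix i assume i: "i < length x"
      have xi: "x ! i = word_bit (pair_strings x y) (2 * i)" using pair_strings_bits(1)[OF i] by simp
      have "i < n \<or> i = n \<or> i = n + 1 + (i - (n + 1)) \<and> i - (n + 1) < n * n" using i lx by linarith
      then obtain k where "i < n \<or> i = n \<or> i = n + 1 + k \<and> k < n * n" by blast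
      then have "code_bit n (parcs D) i \<longleftrightarrow> word_bit (pair_strings x y) (2 * i)"
      proof (elim disjE conjE)
        assume k: "i = n + 1 + k" "k < n * n"
        then have "0 < n" by (cases n) auto
        then have "k div n < n" "k mod n < n" using k(2) by (auto simp: less_mult_imp_div_less)
        then have "(k div n, k mod n) \<in> parcs D \<longleftrightarrow>
            word_bit (pair_strings x y) (2 * (n + 1 + k div n * n + k mod n))"
          unfolding D_def pair_pre_digraph.simps mem_Collect_eq prod.case by blast
        moreover have "code_bit n (parcs D) i \<longleftrightarrow> (k div n, k mod n) \<in> parcs D"
          using k(1) by (simp add: code_bit_def)
        ultimately have "code_bit n (parcs D) i \<longleftrightarrow>
            word_bit (pair_strings x y) (2 * (n + 1 + k div n * n + k mod n))" by blast
        also have "n + 1 + k div n * n + k mod n = i"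
          using k(1) by (simp add: add.assoc)
        finally show ?thesis .
      qed (use ones zero in \<open>auto simp: code_bit_def\<close>)
      then show "x ! i = encode_digraph D ! i" using i lx by (simp add: xi encode_digraph_nth[OF Dn])
    qed
    moreover have "C D" using C D(3) by blast
    ultimately show "x \<in> inv_le_1_problem C"
      using in_inv_le_1_problem[OF Dn D(1)] D(2) by blast
  qed
  ultimately show ?thesis unfolding complexity_NP_def by blast
qed

theorem theorem6p1:
  shows "NP_complete (inv_le_1_problem (\<lambda>D. True)) \<and>
         NP_complete (inv_le_1_problem (\<lambda>D. strongly_connected (with_proj D)))"
proof
  show "NP_complete (inv_le_1_problem (\<lambda>D. True))"
    unfolding NP_complete_def
    using inv_le_1_problem_in_NP[of _ False] NP_hard_inv_le_1_problem by simp
  show "NP_complete (inv_le_1_problem (\<lambda>D. strongly_connected (with_proj D)))"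
    unfolding NP_complete_def
    using inv_le_1_problem_in_NP[of _ True] NP_hard_inv_le_1_problem by simp
qed

end
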